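(* Let $\mathcal{V}$ be a Banach $Cl$-space, let $U\subset\mathbb{C}$ be a conjugate symmetric open set, and let $T\in\mathcal{B}^{\rm r}(\mathcal{V})$ with $\sigma_{\mathbb C}(T)\subset U$. Then the assignment $$\mathcal{O}_s(U,\mathcal{B}^{\rm r}(\mathcal{V})_{\mathbb C})\ni F\mapsto F(T)\in\mathcal{B}^{\rm r}(\mathcal{V})$$ is an $\mathbb{R}$-linear map, and the map $$\mathcal{O}_s(U)\ni f\mapsto f(T)\in\mathcal{B}^{\rm r}(\mathcal{V})$$ is a unital real algebra morphism. Moreover: (1) for all $F\in\mathcal{O}_s(U,\mathcal{B}^{\rm r}(\mathcal{V})_{\mathbb C})$ and $f\in\mathcal{O}_s(U)$, we have $(Ff)(T)=F(T)f(T)$; (2) for every polynomial $P(\zeta)=\sum_{k=0}^m A_k\zeta^k$, $\zeta\in\mathbb{C}$, with $A_k\in\mathcal{B}^{\rm r}(\mathcal{V})$ for all $k=0,1,\dots,m$, we have $P(T)=\sum_{k=0}^m A_kT^k\in\mathcal{B}^{\rm r}(\mathcal{V})$.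
   Context: Fix an integer $n\ge0$. $\mathfrak{C}_n$ is the unital associative real algebra generated by $e_1,\dots,e_n$ with $e_j^2=-1$, $e_je_k=-e_ke_j$ ($j\ne k$), with basis $e_J=e_{j_1}\cdots e_{j_p}$ for $J=\{j_1<\dots<j_p\}\subset\{1,\dots,n\}$, $e_\emptyset=1$, and norm $|\sum_J a_Je_J|^2=\sum_J a_J^2$. A Banach $Cl$-space is a real Banach space $\mathcal{V}$ which is a two-sided module (bimodule) over the real algebra $\mathfrak{C}_n$, such that for some constant $C>0$, $\|x\mathbf a\|\le C\|x\||\mathbf a|$ and $\|\mathbf a x\|\le C\|x\||\mathbf a|$ for all $x\in\mathcal{V}$, $\mathbf a\in\mathfrak{C}_n$. $\mathcal{B}(\mathcal{V})$ is the algebra of bounded $\mathbb{R}$-linear operators on $\mathcal{V}$ and $\mathcal{B}^{\rm r}(\mathcal{V})=\{T\in\mathcal{B}(\mathcal{V}):T(x\mathbf a)=T(x)\mathbf a\ \forall x\in\mathcal{V},\mathbf a\in\mathfrak{C}_n\}$. $\mathcal{V}_{\mathbb C}=\mathcal{V}+i\mathcal{V}$ is the complexification, and $T_{\mathbb C}(x+iy)=Tx+iTy$ for $T\in\mathcal{B}(\mathcal{V})$. $\mathcal{B}^{\rm r}(\mathcal{V}_{\mathbb C})$ is the algebra of bounded $\mathbb{C}$-linear operators on $\mathcal{V}_{\mathbb C}$ commuting with all right multiplications by elements of $\mathfrak{C}_n$; it is identified with the complexification $\mathcal{B}^{\rm r}(\mathcal{V})_{\mathbb C}=\mathcal{B}^{\rm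 r}(\mathcal{V})+i\mathcal{B}^{\rm r}(\mathcal{V})$ via $T_1+iT_2\mapsto T_{1\mathbb C}+iT_{2\mathbb C}$, and $\mathcal{B}^{\rm r}(\mathcal{V})$ is identified with the real subalgebra of operators $T_{\mathbb C}$, i.e. the elements fixed by the conjugation $\overline{T_1+iT_2}=T_1-iT_2$. The complex spectrum of $T$ is $\sigma_{\mathbb C}(T)=\sigma(T_{\mathbb C})$, the spectrum of $T_{\mathbb C}$ on $\mathcal{V}_{\mathbb C}$; it is conjugate symmetric (a set $U\subset\mathbb{C}$ is conjugate symmetric if $\zeta\in U\iff\bar\zeta\in U$). $\mathcal{O}_s(U,\mathcal{B}^{\rm r}(\mathcal{V})_{\mathbb C})$ is the set of analytic functions $F:U\to\mathcal{B}^{\rm r}(\mathcal{V})_{\mathbb C}$ with $F(\bar\zeta)=\overline{F(\zeta)}$ for all $\zeta\in U$; $\mathcal{O}_s(U)$ is the real algebra of analytic $f:U\to\mathbb{C}$ with $f(\bar\zeta)=\overline{f(\zeta)}$ (regarded as operator-valued via scalar multiples of the identity). A Cauchy domain in $U$ is a bounded open set $\Delta$ with $\overline\Delta\subset U$ whose boundary consists of finitely many closed, piecewise smooth, positively oriented curves. For $F\in\mathcal{O}_s(U,\mathcal{B}^{\rm r}(\mathcal{V})_{\mathbb C})$, $F(T)=\frac{1}{2\pi i}\int_\Gamma F(\zeta)(\zeta-T)^{-1}d\zeta$, where $\Gamma$ is the boundary of a Cauchy domain in $U$ containing $\sigma_{\mathbb C}(T)$, $T$ being identified with $T_{\mathbb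 C}$; the integral is an element of $\mathcal{B}^{\rm r}(\mathcal{V})_{\mathbb C}$ independent of $\Gamma$, and part of the assertion is that it lies in $\mathcal{B}^{\rm r}(\mathcal{V})$. *)

theory Defs
  imports "HOL-Complex_Analysis.Complex_Analysis"
begin

section \<open>Clifford algebras\<close>

text \<open>
  The type \<open>clifford\<close> is the union over all \<open>n\<close> of the real Clifford algebras with generators
  \<open>e\<^sub>1, \<dots>, e\<^sub>n\<close>, that is the algebra with basis \<open>e\<^sub>J\<close>, where \<open>J\<close> ranges over the finite sets of
  natural numbers; an element is given by its coefficients. The algebra on exactly \<open>n\<close>
  generators is the subset \<open>Cl n\<close>. This way \<open>n = 0\<close> is not excluded and \<open>n\<close> stays a number.
\<close>

typedef clifford = "{f :: nat set \<Rightarrow> real. finite {J. f J \<noteq> 0} \<and> (\<forall>J. f J \<noteq> 0 \<longrightarrow> finite J)}"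
  morphisms cl_coeff Clifford
  by (rule exI[of _ "\<lambda>_. 0"]) auto

setup_lifting type_definition_clifford

text \<open>
  \<open>e\<^sub>I e\<^sub>J = cl_sign I J e\<^sub>K\<close> with \<open>K\<close> the symmetric difference of \<open>I\<close> and \<open>J\<close>: sorting the product costs
  a sign for each pair \<open>j < i\<close>, and each common index \<open>i = j\<close> contributes \<open>e\<^sub>i\<^sup>2 = -1\<close>.
\<close>

definition cl_sign :: "nat set \<Rightarrow> nat set \<Rightarrow> real" where
  "cl_sign I J = (\<Prod>i\<in>I. \<Prod>j\<in>J. if j \<le> i then -1 else 1)"

definition cl_mult :: "(nat set \<Rightarrow> real) \<Rightarrow> (nat set \<Rightarrow> real) \<Rightarrow> nat set \<Rightarrow> real" where
  "cl_mult f g K = (\<Sum>I | f I \<noteq> 0. \<Sum>J | g J \<noteq> 0.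
     if sym_diff I J = K then cl_sign I J * f I * g J else 0)"

definition cl_fin :: "(nat set \<Rightarrow> real) \<Rightarrow> bool" where
  "cl_fin f \<longleftrightarrow> finite {J. f J \<noteq> 0} \<and> (\<forall>J. f J \<noteq> 0 \<longrightarrow> finite J)"

lemma cl_finI: "(\<And>J. f J \<noteq> 0 \<Longrightarrow> J \<subseteq> {..<N}) \<Longrightarrow> cl_fin f"
proof -
  assume a: "\<And>J. f J \<noteq> 0 \<Longrightarrow> J \<subseteq> {..<N::nat}"
  then have "{J. f J \<noteq> 0} \<subseteq> Pow {..<N}" by auto
  then have "finite {J. f J \<noteq> 0}" by (rule finite_subset) simp
  with a show ?thesis unfolding cl_fin_def using finite_subset by blast
qed

lemma cl_finE:
  assumes "cl_fin f"
  obtains N where "\<And>M J. N \<le> M \<Longrightarrow> f J \<noteq> 0 \<Longrightarrow> J \<subseteq> {..<M}"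
proof -
  let ?X = "\<Union>{J. f J \<noteq> 0}"
  have "finite ?X" using assms unfolding cl_fin_def by auto
  then obtain N where "?X \<subseteq> {..<N}" using finite_nat_iff_bounded by blast
  then have "J \<subseteq> {..<M}" if "N \<le> M" "f J \<noteq> 0" for M J
  proof -
    have "J \<subseteq> {..<N}" using that \<open>?X \<subseteq> {..<N}\<close> by blast
    then show ?thesis using that(1) by auto
  qed
  then show ?thesis using that by blast
qed

lemma cl_mult_alt:
  assumes "finite S" "{I. f I \<noteq> 0} \<subseteq> S" "{I. g I \<noteq> 0} \<subseteq> S"
  shows "cl_mult f g K = (\<Sum>I\<in>S. \<Sum>J\<in>S. if sym_diff I J = K then cl_sign I J * f I * g J else 0)"
proof -
  have "(\<Sum>J | g J \<noteq> 0. if sym_diff I J = K then cl_sign I J * f I * g J else 0)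
      = (\<Sum>J\<in>S. if sym_diff I J = K then cl_sign I J * f I * g J else 0)" for I
    by (rule sum.mono_neutral_left) (use assms in auto)
  then show ?thesis unfolding cl_mult_def
    by (simp, intro sum.mono_neutral_left) (use assms in \<open>auto intro!: sum.neutral split: if_splits\<close>)
qed

lemma cl_mult_bound:
  assumes "\<And>J. f J \<noteq> 0 \<Longrightarrow> J \<subseteq> A" "\<And>J. g J \<noteq> 0 \<Longrightarrow> J \<subseteq> A" "cl_mult f g K \<noteq> 0"
  shows "K \<subseteq> A"
proof (rule ccontr)
  assume n: "\<not> K \<subseteq> A"
  have "cl_mult f g K = 0" unfolding cl_mult_def
  proof (intro sum.neutral ballI)
    fix I J assume IJ: "I \<in> {I. f I \<noteq> 0}" "J \<in> {J. g J \<noteq> 0}"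
    then have "I \<subseteq> A" "J \<subseteq> A" using assms(1)[of I] assms(2)[of J] by auto
    then have "sym_diff I J \<noteq> K" using n by blast
    then show "(if sym_diff I J = K then cl_sign I J * f I * g J else 0) = 0" by simp
  qed
  with assms show False by simp
qed

lemma cl_fin_mult: "cl_fin f \<Longrightarrow> cl_fin g \<Longrightarrow> cl_fin (cl_mult f g)"
proof -
  assume "cl_fin f" "cl_fin g"
  then obtain N M where "\<And>L J. N \<le> L \<Longrightarrow> f J \<noteq> 0 \<Longrightarrow> J \<subseteq> {..<L}"
    "\<And>L J. M \<le> L \<Longrightarrow> g J \<noteq> 0 \<Longrightarrow> J \<subseteq> {..<L}" by (metis cl_finE)
  then have "J \<subseteq> {..<max N M}" if "f J \<noteq> 0 \<or> g J \<noteq> 0" for J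
    using that by (meson max.cobounded1 max.cobounded2)
  then have "K \<subseteq> {..<max N M}" if "cl_mult f g K \<noteq> 0" for K
    using cl_mult_bound[of f "{..<max N M}" g K] that by simp
  then show ?thesis by (rule cl_finI)
qed

lemma prod_sym_diff:
  fixes h :: "nat \<Rightarrow> real"
  assumes "finite I" "finite J" "\<And>i. h i * h i = 1"
  shows "prod h (sym_diff I J) = prod h I * prod h J"
proof -
  have I: "prod h I = prod h (I - J) * prod h (I \<inter> J)"
    using prod.Int_Diff[OF assms(1), of h J] by (simp add: mult.commute)
  have J: "prod h J = prod h (J - I) * prod h (I \<inter> J)"
    using prod.Int_Diff[OF assms(2), of h I] by (simp add: mult.commute Int_commute)
  have "prod h (I \<inter> J) * prod h (I \<inter> J) = 1"
    by (simp add: prod.distrib[symmetric] assms(3))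
  moreover have "prod h (sym_diff I J) = prod h (I - J) * prod h (J - I)"
    by (rule prod.union_disjoint) (use assms in auto)
  ultimately show ?thesis unfolding I J by algebra
qed

lemma prod_sign_sq: "(\<And>j. j \<in> J \<Longrightarrow> h j * h j = (1::real)) \<Longrightarrow> prod h J * prod h J = 1"
  by (simp add: prod.distrib[symmetric])

lemma cl_sign_left:
  "finite I \<Longrightarrow> finite J \<Longrightarrow> cl_sign (sym_diff I J) K = cl_sign I K * cl_sign J K"
  unfolding cl_sign_def by (intro prod_sym_diff prod_sign_sq) auto

lemma cl_sign_right:
  "finite I \<Longrightarrow> finite J \<Longrightarrow> cl_sign K (sym_diff I J) = cl_sign K I * cl_sign K J"
  unfolding cl_sign_def prod.swap[of _ _ K] by (intro prod_sym_diff prod_sign_sq) auto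

lemma cl_mult_assoc:
  assumes "cl_fin f" "cl_fin g" "cl_fin h"
  shows "cl_mult (cl_mult f g) h = cl_mult f (cl_mult g h)"
proof
  fix K
  obtain N1 N2 N3 where N: "\<And>L J. N1 \<le> L \<Longrightarrow> f J \<noteq> 0 \<Longrightarrow> J \<subseteq> {..<L}"
    "\<And>L J. N2 \<le> L \<Longrightarrow> g J \<noteq> 0 \<Longrightarrow> J \<subseteq> {..<L}"
    "\<And>L J. N3 \<le> L \<Longrightarrow> h J \<noteq> 0 \<Longrightarrow> J \<subseteq> {..<L}" using assms by (metis cl_finE)
  define A where "A = {..<max N1 (max N2 N3)}"
  have b: "\<And>J. f J \<noteq> 0 \<Longrightarrow> J \<subseteq> A" "\<And>J. g J \<noteq> 0 \<Longrightarrow> J \<subseteq> A" "\<And>J. h J \<noteq> 0 \<Longrightarrow> J \<subseteq> A"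
    unfolding A_def using N by (meson max.cobounded1 max.cobounded2 max.coboundedI2)+
  have b': "\<And>J. cl_mult f g J \<noteq> 0 \<Longrightarrow> J \<subseteq> A" "\<And>J. cl_mult g h J \<noteq> 0 \<Longrightarrow> J \<subseteq> A"
    using cl_mult_bound[of f A g] cl_mult_bound[of g A h] b by blast+
  define S where "S = Pow A"
  have fS: "finite S" by (simp add: S_def A_def)
  have fin: "finite I" if "I \<in> S" for I using that unfolding S_def A_def by (auto intro: finite_subset)
  have sd: "sym_diff I J \<in> S" if "I \<in> S" "J \<in> S" for I J using that unfolding S_def by auto
  have sup: "{I. f I \<noteq> 0} \<subseteq> S" "{I. g I \<noteq> 0} \<subseteq> S" "{I. h I \<noteq> 0} \<subseteq> S"
    "{I. cl_mult f g I \<noteq> 0} \<subseteq> S" "{I. cl_mult g h I \<noteq> 0} \<subseteq> S"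
    unfolding S_def using b b' by blast+
  have ass: "sym_diff (sym_diff I J) M = sym_diff I (sym_diff J M)" for I J M :: "nat set" by blast
  have pull: "(if Q then c * (\<Sum>I\<in>S. \<Sum>J\<in>S. if P I J then x I J else 0) * d else 0)
      = (\<Sum>I\<in>S. \<Sum>J\<in>S. if P I J then (if Q then c * x I J * d else 0) else 0)"
    for Q c P x and d :: real
    by (cases Q) (simp_all add: sum_distrib_left sum_distrib_right if_distrib[of "\<lambda>t. c * t"]
        if_distrib[of "\<lambda>t. t * d"] cong: if_cong)
  have pull2: "(if Q then c * (\<Sum>I\<in>S. \<Sum>J\<in>S. if P I J then x I J else 0) else 0)
      = (\<Sum>I\<in>S. \<Sum>J\<in>S. if P I J then (if Q then c * x I J else 0) else 0)"
    for Q P x and c :: real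
    using pull[of Q c P x 1] by (simp only: mult_1_right)
  have swap3: "(\<Sum>L\<in>S. \<Sum>I\<in>S. \<Sum>J\<in>S. X L I J) = (\<Sum>I\<in>S. \<Sum>J\<in>S. \<Sum>L\<in>S. X L I J)"
    for X :: "nat set \<Rightarrow> nat set \<Rightarrow> nat set \<Rightarrow> real"
  proof -
    have "(\<Sum>L\<in>S. \<Sum>I\<in>S. \<Sum>J\<in>S. X L I J) = (\<Sum>I\<in>S. \<Sum>L\<in>S. \<Sum>J\<in>S. X L I J)" by (rule sum.swap)
    also have "\<dots> = (\<Sum>I\<in>S. \<Sum>J\<in>S. \<Sum>L\<in>S. X L I J)" by (intro sum.cong refl sum.swap)
    finally show ?thesis .
  qed
  have collapse: "(\<Sum>L\<in>S. if x = L then X L else 0) = X x" if "x \<in> S" for x and X :: "nat set \<Rightarrow> real"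
    using sum.delta'[OF fS, of x X] that by simp
  have "cl_mult (cl_mult f g) h K = (\<Sum>M\<in>S. \<Sum>L\<in>S. if sym_diff L M = K then
      cl_sign L M * (\<Sum>I\<in>S. \<Sum>J\<in>S. if sym_diff I J = L then cl_sign I J * f I * g J else 0) * h M else 0)"
    unfolding cl_mult_alt[OF fS sup(4) sup(3)] cl_mult_alt[OF fS sup(1) sup(2)] by (rule sum.swap)
  also have "\<dots> = (\<Sum>M\<in>S. \<Sum>L\<in>S. \<Sum>I\<in>S. \<Sum>J\<in>S. if sym_diff I J = L then
      (if sym_diff L M = K then cl_sign L M * (cl_sign I J * f I * g J) * h M else 0) else 0)"
    unfolding pull ..
  also have "\<dots> = (\<Sum>M\<in>S. \<Sum>I\<in>S. \<Sum>J\<in>S. \<Sum>L\<in>S. if sym_diff I J = L then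
      (if sym_diff L M = K then cl_sign L M * (cl_sign I J * f I * g J) * h M else 0) else 0)"
    by (intro sum.cong refl swap3)
  also have "\<dots> = (\<Sum>M\<in>S. \<Sum>I\<in>S. \<Sum>J\<in>S.
      if sym_diff (sym_diff I J) M = K then cl_sign (sym_diff I J) M * (cl_sign I J * f I * g J) * h M else 0)"
    by (intro sum.cong refl collapse sd)
  also have "\<dots> = (\<Sum>I\<in>S. \<Sum>J\<in>S. \<Sum>M\<in>S.
      if sym_diff (sym_diff I J) M = K then cl_sign (sym_diff I J) M * (cl_sign I J * f I * g J) * h M else 0)"
    by (rule swap3)
  also have "\<dots> = (\<Sum>I\<in>S. \<Sum>J\<in>S. \<Sum>M\<in>S.
      if sym_diff I (sym_diff J M) = K then cl_sign I (sym_diff J M) * f I * (cl_sign J M * g J * h M) else 0)"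
    by (intro sum.cong refl if_cong) (unfold ass cl_sign_left[OF fin fin] cl_sign_right[OF fin fin], simp_all)
  also have "\<dots> = (\<Sum>I\<in>S. \<Sum>J\<in>S. \<Sum>M\<in>S. \<Sum>L\<in>S. if sym_diff J M = L then
      (if sym_diff I L = K then cl_sign I L * f I * (cl_sign J M * g J * h M) else 0) else 0)"
    by (intro sum.cong refl collapse[symmetric] sd)
  also have "\<dots> = (\<Sum>I\<in>S. \<Sum>L\<in>S. \<Sum>J\<in>S. \<Sum>M\<in>S. if sym_diff J M = L then
      (if sym_diff I L = K then cl_sign I L * f I * (cl_sign J M * g J * h M) else 0) else 0)"
    by (intro sum.cong refl swap3[symmetric])
  also have "\<dots> = (\<Sum>I\<in>S. \<Sum>L\<in>S. if sym_diff I L = K then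
      cl_sign I L * f I * (\<Sum>J\<in>S. \<Sum>M\<in>S. if sym_diff J M = L then cl_sign J M * g J * h M else 0) else 0)"
    unfolding pull2 ..
  also have "\<dots> = cl_mult f (cl_mult g h) K"
    unfolding cl_mult_alt[OF fS sup(1) sup(5)] cl_mult_alt[OF fS sup(2) sup(3)] ..
  finally show "cl_mult (cl_mult f g) h K = cl_mult f (cl_mult g h) K" .
qed


lemma cl_mult_add:
  assumes "cl_fin f" "cl_fin g" "cl_fin h"
  shows "cl_mult (\<lambda>J. f J + g J) h = (\<lambda>J. cl_mult f h J + cl_mult g h J)"
    and "cl_mult h (\<lambda>J. f J + g J) = (\<lambda>J. cl_mult h f J + cl_mult h g J)"
proof -
  define S where "S = {J. f J \<noteq> 0} \<union> {J. g J \<noteq> 0} \<union> {J. h J \<noteq> 0}"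
  have S: "finite S" "{J. f J \<noteq> 0} \<subseteq> S" "{J. g J \<noteq> 0} \<subseteq> S" "{J. h J \<noteq> 0} \<subseteq> S"
    "{J. f J + g J \<noteq> 0} \<subseteq> S"
    using assms by (auto simp: S_def cl_fin_def)
  show "cl_mult (\<lambda>J. f J + g J) h = (\<lambda>J. cl_mult f h J + cl_mult g h J)"
    unfolding cl_mult_alt[OF S(1,5,4)] cl_mult_alt[OF S(1,2,4)] cl_mult_alt[OF S(1,3,4)]
      sum.distrib[symmetric] by (intro ext sum.cong refl) (simp add: algebra_simps)
  show "cl_mult h (\<lambda>J. f J + g J) = (\<lambda>J. cl_mult h f J + cl_mult h g J)"
    unfolding cl_mult_alt[OF S(1,4,5)] cl_mult_alt[OF S(1,4,2)] cl_mult_alt[OF S(1,4,3)]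
      sum.distrib[symmetric] by (intro ext sum.cong refl) (simp add: algebra_simps)
qed

lemma cl_mult_scale:
  assumes "cl_fin f" "cl_fin g"
  shows "cl_mult (\<lambda>J. r * f J) g = (\<lambda>J. r * cl_mult f g J)"
    and "cl_mult f (\<lambda>J. r * g J) = (\<lambda>J. r * cl_mult f g J)"
proof -
  define S where "S = {J. f J \<noteq> 0} \<union> {J. g J \<noteq> 0}"
  have S: "finite S" "{J. f J \<noteq> 0} \<subseteq> S" "{J. g J \<noteq> 0} \<subseteq> S"
    "{J. r * f J \<noteq> 0} \<subseteq> S" "{J. r * g J \<noteq> 0} \<subseteq> S"
    using assms by (auto simp: S_def cl_fin_def)
  show "cl_mult (\<lambda>J. r * f J) g = (\<lambda>J. r * cl_mult f g J)"
    unfolding cl_mult_alt[OF S(1,4,3)] cl_mult_alt[OF S(1,2,3)] sum_distrib_left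
    by (intro ext sum.cong refl) simp
  show "cl_mult f (\<lambda>J. r * g J) = (\<lambda>J. r * cl_mult f g J)"
    unfolding cl_mult_alt[OF S(1,2,5)] cl_mult_alt[OF S(1,2,3)] sum_distrib_left
    by (intro ext sum.cong refl) simp
qed

lemma cl_mult_one:
  assumes "cl_fin f"
  shows "cl_mult (\<lambda>J. if J = {} then 1 else 0) f = f"
    and "cl_mult f (\<lambda>J. if J = {} then 1 else 0) = f"
proof -
  have f: "finite {J. f J \<noteq> 0}" using assms by (simp add: cl_fin_def)
  have o: "{J::nat set. (if J = {} then 1 else 0::real) \<noteq> 0} = {{}}" by auto
  show "cl_mult (\<lambda>J. if J = {} then 1 else 0) f = f"
    by (rule ext, unfold cl_mult_def o) (simp add: cl_sign_def f)
  show "cl_mult f (\<lambda>J. if J = {} then 1 else 0) = f"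
    by (rule ext, unfold cl_mult_def o) (simp add: cl_sign_def f)
qed

instantiation clifford :: real_algebra_1
begin

lift_definition zero_clifford :: clifford is "\<lambda>_. 0" by simp
lift_definition one_clifford :: clifford is "\<lambda>J. if J = {} then 1 else 0" by simp
lift_definition plus_clifford :: "clifford \<Rightarrow> clifford \<Rightarrow> clifford" is "\<lambda>f g J. f J + g J"
proof -
  fix f g :: "nat set \<Rightarrow> real"
  assume a: "finite {J. f J \<noteq> 0} \<and> (\<forall>J. f J \<noteq> 0 \<longrightarrow> finite J)"
    "finite {J. g J \<noteq> 0} \<and> (\<forall>J. g J \<noteq> 0 \<longrightarrow> finite J)"
  have "{J. f J + g J \<noteq> 0} \<subseteq> {J. f J \<noteq> 0} \<union> {J. g J \<noteq> 0}" by auto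
  with a show "finite {J. f J + g J \<noteq> 0} \<and> (\<forall>J. f J + g J \<noteq> 0 \<longrightarrow> finite J)"
    by (metis (no_types, lifting) add.left_neutral finite_UnI finite_subset)
qed
lift_definition uminus_clifford :: "clifford \<Rightarrow> clifford" is "\<lambda>f J. - f J" by simp
lift_definition scaleR_clifford :: "real \<Rightarrow> clifford \<Rightarrow> clifford" is "\<lambda>r f J. r * f J" by simp
definition minus_clifford :: "clifford \<Rightarrow> clifford \<Rightarrow> clifford" where "a - b = a + - (b::clifford)"
lift_definition times_clifford :: "clifford \<Rightarrow> clifford \<Rightarrow> clifford" is cl_mult
  by (rule cl_fin_mult[unfolded cl_fin_def])

instance
proof
  fix a b c :: clifford and r s :: real
  show "a + b + c = a + (b + c)" "a + b = b + a" "0 + a = a" "- a + a = 0"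
    "r *\<^sub>R (a + b) = r *\<^sub>R a + r *\<^sub>R b" "(r + s) *\<^sub>R a = r *\<^sub>R a + s *\<^sub>R a"
    "r *\<^sub>R s *\<^sub>R a = (r * s) *\<^sub>R a" "1 *\<^sub>R a = a"
    by (transfer; simp add: algebra_simps)+
  show "a - b = a + - b" by (rule minus_clifford_def)
  show "a * b * c = a * (b * c)"
    by (transfer, rule cl_mult_assoc) (simp_all add: cl_fin_def)
  show "(a + b) * c = a * c + b * c"
    by (transfer, rule cl_mult_add) (simp_all add: cl_fin_def)
  show "a * (b + c) = a * b + a * c"
    by (transfer, rule cl_mult_add) (simp_all add: cl_fin_def)
  show "r *\<^sub>R a * b = r *\<^sub>R (a * b)" 
    by (transfer, rule cl_mult_scale) (simp_all add: cl_fin_def)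
  show "a * r *\<^sub>R b = r *\<^sub>R (a * b)"
    by (transfer, rule cl_mult_scale) (simp_all add: cl_fin_def)
  show "1 * a = a" "a * 1 = a"
    by (transfer, rule cl_mult_one, simp add: cl_fin_def)+
  show "(0::clifford) \<noteq> 1" by transfer (metis zero_neq_one)
qed

end

definition Cl :: "nat \<Rightarrow> clifford set" where
  "Cl n = {a. \<forall>J. cl_coeff a J \<noteq> 0 \<longrightarrow> J \<subseteq> {1..n}}"

definition cl_norm :: "clifford \<Rightarrow> real" where
  "cl_norm a = sqrt (\<Sum>J | cl_coeff a J \<noteq> 0. (cl_coeff a J)\<^sup>2)"

lift_definition cl_basis :: "nat set \<Rightarrow> clifford" is
  "\<lambda>J K. if K = J \<and> finite J then 1 else 0" by simp

lemma cl_basis_mult: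
  assumes "finite I" "finite J"
  shows "cl_basis I * cl_basis J = cl_sign I J *\<^sub>R cl_basis (sym_diff I J)"
  using assms
proof transfer
  fix I J :: "nat set" assume "finite I" "finite J"
  then have "{K. (if K = I \<and> finite I then 1 else 0::real) \<noteq> 0} = {I}"
    "{K. (if K = J \<and> finite J then 1 else 0::real) \<noteq> 0} = {J}" by auto
  then show "cl_mult (\<lambda>K. if K = I \<and> finite I then 1 else 0) (\<lambda>K. if K = J \<and> finite J then 1 else 0) =
    (\<lambda>K. cl_sign I J * (if K = sym_diff I J \<and> finite (sym_diff I J) then 1 else 0))"
    unfolding cl_mult_def using \<open>finite I\<close> \<open>finite J\<close> by (intro ext) auto
qed

lemma cl_basis_empty: "cl_basis {} = 1"
  by (rule cl_coeff_inject[THEN iffD1], rule ext) (simp add: cl_basis.rep_eq one_clifford.rep_eq)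

lemma cl_gen_square: "cl_basis {j} * cl_basis {j} = -1"
proof -
  have "cl_basis {j} * cl_basis {j} = cl_sign {j} {j} *\<^sub>R cl_basis (sym_diff {j} {j})"
    by (rule cl_basis_mult) simp_all
  also have "\<dots> = -1" by (simp add: cl_sign_def cl_basis_empty)
  finally show ?thesis .
qed

lemma cl_gen_anticommute: "j \<noteq> k \<Longrightarrow> cl_basis {j} * cl_basis {k} = - (cl_basis {k} * cl_basis {j})"
proof -
  assume jk: "j \<noteq> k"
  then have "sym_diff {j} {k} = {j, k}" "sym_diff {k} {j} = {j, k}" by auto
  then show ?thesis using jk by (cases "j < k") (simp_all add: cl_basis_mult cl_sign_def)
qed

lemma cl_basis_prod:
  "finite J \<Longrightarrow> cl_basis J = prod_list (map (\<lambda>j. cl_basis {j}) (sorted_list_of_set J))"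
proof (induction rule: finite_linorder_min_induct)
  case empty
  then show ?case by (simp add: cl_basis_empty)
next
  case (insert b A)
  have "cl_sign {b} A = 1" unfolding cl_sign_def by (intro prod.neutral ballI) (use insert(2) in auto)
  moreover have "sym_diff {b} A = insert b A" using insert(2) by auto
  moreover have "sorted_list_of_set (insert b A) = b # sorted_list_of_set A"
    using insert(1,2) by (subst sorted_list_of_set_insert) (auto intro!: insort_is_Cons less_imp_le)
  ultimately show ?case using insert cl_basis_mult[of "{b}" A] by simp
qed

lemma Cl_eq_span: "Cl n = span (cl_basis ` Pow {1..n})"
proof
  show "Cl n \<subseteq> span (cl_basis ` Pow {1..n})"
  proof
    fix a assume a: "a \<in> Cl n"
    have s: "cl_coeff (\<Sum>J\<in>S. cl_coeff a J *\<^sub>R cl_basis J) K = (\<Sum>J\<in>S. cl_coeff a J * cl_coeff (cl_basis J) K)"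
      if "finite S" for S K
      using that by (induction S) (simp_all add: zero_clifford.rep_eq plus_clifford.rep_eq scaleR_clifford.rep_eq)
    have "cl_coeff a K = cl_coeff (\<Sum>J\<in>Pow {1..n}. cl_coeff a J *\<^sub>R cl_basis J) K" for K
    proof -
      have "(\<Sum>J\<in>Pow {1..n}. cl_coeff a J * cl_coeff (cl_basis J) K)
          = (\<Sum>J\<in>Pow {1..n}. if K = J then cl_coeff a J else 0)"
        by (intro sum.cong refl) (auto simp: cl_basis.rep_eq intro: finite_subset)
      also have "\<dots> = cl_coeff a K" using a by (auto simp: Cl_def)
      finally show ?thesis by (simp add: s)
    qed
    then have "a = (\<Sum>J\<in>Pow {1..n}. cl_coeff a J *\<^sub>R cl_basis J)"
      unfolding cl_coeff_inject[symmetric] by (rule ext)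
    also have "\<dots> \<in> span (cl_basis ` Pow {1..n})"
      by (rule span_sum, rule span_scale, rule span_base) (rule imageI)
    finally show "a \<in> span (cl_basis ` Pow {1..n})" .
  qed
  have "subspace (Cl n)"
  proof (rule subspaceI)
    fix a b r assume a: "a \<in> Cl n"
    then show "r *\<^sub>R a \<in> Cl n" by (simp add: Cl_def scaleR_clifford.rep_eq)
    assume b: "b \<in> Cl n"
    have "J \<subseteq> {1..n}" if "cl_coeff a J + cl_coeff b J \<noteq> 0" for J
    proof -
      have "cl_coeff a J \<noteq> 0 \<or> cl_coeff b J \<noteq> 0" using that by auto
      then show ?thesis using a b unfolding Cl_def by blast
    qed
    then show "a + b \<in> Cl n" by (simp add: Cl_def plus_clifford.rep_eq)
  qed (simp add: Cl_def zero_clifford.rep_eq)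
  then show "span (cl_basis ` Pow {1..n}) \<subseteq> Cl n"
    by (intro span_minimal) (auto simp: Cl_def cl_basis.rep_eq split: if_splits)
qed


section \<open>Banach Clifford modules and right linear operators\<close>

locale banach_cl_space =
  fixes n :: nat
    and lact :: "clifford \<Rightarrow> 'v::banach \<Rightarrow> 'v"
    and ract :: "'v \<Rightarrow> clifford \<Rightarrow> 'v"
  assumes lact_linear: "a \<in> Cl n \<Longrightarrow> linear (lact a)"
    and lact_add: "a \<in> Cl n \<Longrightarrow> b \<in> Cl n \<Longrightarrow> lact (a + b) x = lact a x + lact b x"
    and lact_scaleR: "a \<in> Cl n \<Longrightarrow> lact (r *\<^sub>R a) x = r *\<^sub>R lact a x"
    and lact_mult: "a \<in> Cl n \<Longrightarrow> b \<in> Cl n \<Longrightarrow> lact (a * b) x = lact a (lact b x)"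
    and lact_one: "lact 1 x = x"
    and ract_linear: "a \<in> Cl n \<Longrightarrow> linear (\<lambda>x. ract x a)"
    and ract_add: "a \<in> Cl n \<Longrightarrow> b \<in> Cl n \<Longrightarrow> ract x (a + b) = ract x a + ract x b"
    and ract_scaleR: "a \<in> Cl n \<Longrightarrow> ract x (r *\<^sub>R a) = r *\<^sub>R ract x a"
    and ract_mult: "a \<in> Cl n \<Longrightarrow> b \<in> Cl n \<Longrightarrow> ract x (a * b) = ract (ract x a) b"
    and ract_one: "ract x 1 = x"
    and lact_ract: "a \<in> Cl n \<Longrightarrow> b \<in> Cl n \<Longrightarrow> ract (lact a x) b = lact a (ract x b)"
    and act_bounded: "\<exists>C>0. \<forall>x. \<forall>a\<in>Cl n. norm (ract x a) \<le> C * norm x * cl_norm a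
      \<and> norm (lact a x) \<le> C * norm x * cl_norm a"

definition right_ops :: "nat \<Rightarrow> ('v::banach \<Rightarrow> clifford \<Rightarrow> 'v) \<Rightarrow> ('v \<Rightarrow>\<^sub>L 'v) set" where
  "right_ops n ract = {T :: 'v \<Rightarrow>\<^sub>L 'v. \<forall>a\<in>Cl n. \<forall>x. T (ract x a) = ract (T x) a}"

primrec op_power :: "('v::banach \<Rightarrow>\<^sub>L 'v) \<Rightarrow> nat \<Rightarrow> 'v \<Rightarrow>\<^sub>L 'v" where
  "op_power T 0 = id_blinfun"
| "op_power T (Suc k) = T o\<^sub>L op_power T k"


section \<open>Complexification\<close>

text \<open>
  The complexification of \<open>'v\<close> is the real Banach space \<open>'v \<times> 'v\<close>, where \<open>(x, y)\<close> stands for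
  \<open>x + \<i> y\<close>, with the multiplication by complex numbers \<open>cscale\<close>. The product norm is equivalent
  to any of the usual complex norms on it; only the topology matters below.
\<close>

definition cscale :: "complex \<Rightarrow> 'v::real_vector \<times> 'v \<Rightarrow> 'v \<times> 'v" where
  "cscale z p = (Re z *\<^sub>R fst p - Im z *\<^sub>R snd p, Im z *\<^sub>R fst p + Re z *\<^sub>R snd p)"

type_synonym 'v cop = "('v \<times> 'v) \<Rightarrow>\<^sub>L ('v \<times> 'v)"

definition clinear_ops :: "'v::banach cop set" where
  "clinear_ops = {S :: 'v cop. \<forall>z p. S (cscale z p) = cscale z (S p)}"

lemma bounded_linear_cscale: "bounded_linear (cscale z :: 'v::real_normed_vector \<times> 'v \<Rightarrow> _)"
proof -
  have s: "bounded_linear (\<lambda>p. r *\<^sub>R f p)" if "bounded_linear f" for r and f :: "'v \<times> 'v \<Rightarrow> 'v"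
    using bounded_linear_compose[OF bounded_linear_scaleR_right that] .
  show ?thesis
    unfolding cscale_def[abs_def]
    by (rule bounded_linear_Pair, rule bounded_linear_sub, rule s[OF bounded_linear_fst],
      rule s[OF bounded_linear_snd], rule bounded_linear_add, rule s[OF bounded_linear_fst],
      rule s[OF bounded_linear_snd])
qed

lift_definition op_cscale :: "complex \<Rightarrow> 'v::banach cop \<Rightarrow> 'v cop" is
  "\<lambda>z S p. cscale z (S p)"
  using bounded_linear_compose[OF bounded_linear_cscale] .

lift_definition complexify :: "('v::banach \<Rightarrow>\<^sub>L 'v) \<Rightarrow> 'v cop" is
  "\<lambda>T p. (T (fst p), T (snd p))"
  by (rule bounded_linear_Pair, erule bounded_linear_compose[OF _ bounded_linear_fst],
      erule bounded_linear_compose[OF _ bounded_linear_snd])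

text \<open>For complex linear \<open>S\<close>, the operators \<open>T\<^sub>1 = op_Re S\<close>, \<open>T\<^sub>2 = op_Im S\<close> satisfy
  \<open>S = T\<^sub>1 + \<i> T\<^sub>2\<close>; see \<open>clinear_op_decompose\<close>.\<close>

lemma bounded_linear_inl: "bounded_linear (\<lambda>x::'v::real_normed_vector. (x, 0::'v))"
  by (rule bounded_linear_Pair[OF bounded_linear_ident bounded_linear_zero])

lift_definition op_Re :: "'v::banach cop \<Rightarrow> 'v \<Rightarrow>\<^sub>L 'v" is "\<lambda>S x. fst (S (x, 0))"
  by (rule bounded_linear_compose[OF bounded_linear_fst], erule bounded_linear_compose[OF _ bounded_linear_inl])

lift_definition op_Im :: "'v::banach cop \<Rightarrow> 'v \<Rightarrow>\<^sub>L 'v" is "\<lambda>S x. snd (S (x, 0))"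
  by (rule bounded_linear_compose[OF bounded_linear_snd], erule bounded_linear_compose[OF _ bounded_linear_inl])

definition op_cnj :: "'v::banach cop \<Rightarrow> 'v cop" where
  "op_cnj S = complexify (op_Re S) - op_cscale \<i> (complexify (op_Im S))"

lemma op_Re_Im:
  "op_Re (complexify T1 + op_cscale \<i> (complexify T2)) = T1"
  "op_Im (complexify T1 + op_cscale \<i> (complexify T2)) = T2"
  by (rule blinfun_eqI,
      simp add: op_Re.rep_eq op_Im.rep_eq blinfun.add_left op_cscale.rep_eq complexify.rep_eq cscale_def
        blinfun.zero_right)+

lemma clinear_op_decompose:
  assumes "S \<in> clinear_ops"
  shows "S = complexify (op_Re S) + op_cscale \<i> (complexify (op_Im S))"
proof (rule blinfun_eqI)
  fix p :: "'a \<times> 'a"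
  obtain x y where p: "p = (x, y)" by force
  have "S p = S (x, 0) + S (cscale \<i> (y, 0))"
    by (simp add: p cscale_def flip: blinfun.add_right)
  also have "S (cscale \<i> (y, 0)) = cscale \<i> (S (y, 0))" using assms by (simp add: clinear_ops_def)
  finally show "S p = (complexify (op_Re S) + op_cscale \<i> (complexify (op_Im S))) p"
    by (simp add: p op_Re.rep_eq op_Im.rep_eq blinfun.add_left op_cscale.rep_eq complexify.rep_eq cscale_def
        prod_eq_iff)
qed

definition cright_ops :: "nat \<Rightarrow> ('v::banach \<Rightarrow> clifford \<Rightarrow> 'v) \<Rightarrow> 'v cop set" where
  "cright_ops n ract = {S \<in> clinear_ops. \<forall>a\<in>Cl n. \<forall>x y.
     S (ract x a, ract y a) = (ract (fst (S (x, y))) a, ract (snd (S (x, y))) a)}"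

lemma (in banach_cl_space) cright_ops_eq:
  "cright_ops n ract =
    {complexify T1 + op_cscale \<i> (complexify T2) | T1 T2. T1 \<in> right_ops n ract \<and> T2 \<in> right_ops n ract}"
proof (intro equalityI subsetI)
  fix S assume S: "S \<in> cright_ops n ract"
  have z: "ract 0 a = 0" if "a \<in> Cl n" for a using linear_0[OF ract_linear[OF that]] .
  have "S (ract x a, 0) = (ract (fst (S (x, 0))) a, ract (snd (S (x, 0))) a)" if "a \<in> Cl n" for a x
  proof -
    have "S (ract x a, ract 0 a) = (ract (fst (S (x, 0))) a, ract (snd (S (x, 0))) a)"
      using S that by (auto simp: cright_ops_def)
    then show ?thesis by (simp add: z that)
  qed
  then have "op_Re S \<in> right_ops n ract" "op_Im S \<in> right_ops n ract"
    by (auto simp: right_ops_def op_Re.rep_eq op_Im.rep_eq)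
  moreover have "S \<in> clinear_ops" using S by (simp add: cright_ops_def)
  ultimately show "S \<in> {complexify T1 + op_cscale \<i> (complexify T2) | T1 T2.
      T1 \<in> right_ops n ract \<and> T2 \<in> right_ops n ract}"
    using clinear_op_decompose by blast
next
  fix S assume "S \<in> {complexify T1 + op_cscale \<i> (complexify T2) | T1 T2.
      T1 \<in> right_ops n ract \<and> T2 \<in> right_ops n ract}"
  then obtain T1 T2 where S: "S = complexify T1 + op_cscale \<i> (complexify T2)"
    and T: "T1 \<in> right_ops n ract" "T2 \<in> right_ops n ract" by blast
  have S': "S p = (T1 (fst p) - T2 (snd p), T2 (fst p) + T1 (snd p))" for p
    by (simp add: S blinfun.add_left op_cscale.rep_eq complexify.rep_eq cscale_def)
  have "S \<in> clinear_ops"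
    by (simp add: clinear_ops_def S' cscale_def blinfun.bilinear_simps algebra_simps)
  moreover have "S (ract x a, ract y a) = (ract (fst (S (x, y))) a, ract (snd (S (x, y))) a)"
    if "a \<in> Cl n" for a x y
    using T that linear_diff[OF ract_linear[OF that]] linear_add[OF ract_linear[OF that]]
    by (simp add: S' right_ops_def)
  ultimately show "S \<in> cright_ops n ract" by (simp add: cright_ops_def)
qed


section \<open>Spectrum and functional calculus\<close>

definition is_resolvent :: "'v::banach cop \<Rightarrow> complex \<Rightarrow> 'v cop \<Rightarrow> bool" where
  "is_resolvent S z R \<longleftrightarrow> R \<in> clinear_ops
     \<and> (op_cscale z id_blinfun - S) o\<^sub>L R = id_blinfun \<and> R o\<^sub>L (op_cscale z id_blinfun - S) = id_blinfun"

definition resolvent :: "'v::banach cop \<Rightarrow> complex \<Rightarrow> 'v cop" where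
  "resolvent S z = (THE R. is_resolvent S z R)"

definition op_spectrum :: "'v::banach cop \<Rightarrow> complex set" where
  "op_spectrum S = {z. \<nexists>R. is_resolvent S z R}"

definition complex_spectrum :: "('v::banach \<Rightarrow>\<^sub>L 'v) \<Rightarrow> complex set" where
  "complex_spectrum T = op_spectrum (complexify T)"

definition conj_symmetric :: "complex set \<Rightarrow> bool" where
  "conj_symmetric U \<longleftrightarrow> (\<forall>z. z \<in> U \<longleftrightarrow> cnj z \<in> U)"

text \<open>Analyticity of operator-valued functions, on open sets \<open>U\<close>, is complex differentiability.\<close>

definition op_analytic_on :: "(complex \<Rightarrow> 'v::banach cop) \<Rightarrow> complex set \<Rightarrow> bool" where
  "op_analytic_on F U \<longleftrightarrow> (\<forall>z\<in>U. \<exists>D. (F has_derivative (\<lambda>h. op_cscale h D)) (at z))"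

definition stem_op_functions ::
    "nat \<Rightarrow> ('v::banach \<Rightarrow> clifford \<Rightarrow> 'v) \<Rightarrow> complex set \<Rightarrow> (complex \<Rightarrow> 'v cop) set" where
  "stem_op_functions n ract U = {F. op_analytic_on F U \<and> (\<forall>z\<in>U. F z \<in> cright_ops n ract)
     \<and> (\<forall>z\<in>U. F (cnj z) = op_cnj (F z))}"

definition stem_functions :: "complex set \<Rightarrow> (complex \<Rightarrow> complex) set" where
  "stem_functions U = {f. f analytic_on U \<and> (\<forall>z\<in>U. f (cnj z) = cnj (f z))}"

definition scalar_op :: "(complex \<Rightarrow> complex) \<Rightarrow> complex \<Rightarrow> 'v::banach cop" where
  "scalar_op f z = op_cscale (f z) id_blinfun"

text \<open>
  \<open>\<Gamma>\<close> is the set of boundary curves of \<open>\<Delta>\<close>. Positive orientation of the boundary is expressed by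
  its total winding number, which is \<open>1\<close> about the points of \<open>\<Delta>\<close> and \<open>0\<close> about the points outside
  its closure.
\<close>

definition cauchy_domain :: "complex set \<Rightarrow> complex set \<Rightarrow> (real \<Rightarrow> complex) set \<Rightarrow> bool" where
  "cauchy_domain U \<Delta> \<Gamma> \<longleftrightarrow> bounded \<Delta> \<and> open \<Delta> \<and> closure \<Delta> \<subseteq> U
     \<and> finite \<Gamma> \<and> (\<forall>\<gamma>\<in>\<Gamma>. valid_path \<gamma> \<and> pathfinish \<gamma> = pathstart \<gamma>)
     \<and> frontier \<Delta> = (\<Union>\<gamma>\<in>\<Gamma>. path_image \<gamma>)
     \<and> (\<forall>z\<in>\<Delta>. (\<Sum>\<gamma>\<in>\<Gamma>. winding_number \<gamma> z) = 1)
     \<and> (\<forall>z. z \<notin> closure \<Delta> \<longrightarrow> (\<Sum>\<gamma>\<in>\<Gamma>. winding_number \<gamma> z) = 0)"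

definition op_contour_integral :: "(real \<Rightarrow> complex) \<Rightarrow> (complex \<Rightarrow> 'v::banach cop) \<Rightarrow> 'v cop" where
  "op_contour_integral \<gamma> F =
     integral {0..1} (\<lambda>t. op_cscale (vector_derivative \<gamma> (at t within {0..1})) (F (\<gamma> t)))"

text \<open>
  The contour is an argument: the value is the same for all Cauchy domains in \<open>U\<close> containing the
  spectrum. The embedding \<open>complexify\<close> identifies real operators with elements of \<open>'v cop\<close>.
\<close>

definition fun_calc :: "(real \<Rightarrow> complex) set \<Rightarrow> ('v::banach \<Rightarrow>\<^sub>L 'v) \<Rightarrow> (complex \<Rightarrow> 'v cop) \<Rightarrow> 'v cop" where
  "fun_calc \<Gamma> T F = op_cscale (1 / (2 * of_real pi * \<i>))
     (\<Sum>\<gamma>\<in>\<Gamma>. op_contour_integral \<gamma> (\<lambda>z. F z o\<^sub>L resolvent (complexify T) z))"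

end

theory Submission
  imports Defs
begin

text \<open>
  Vector-valued contour integrals are reduced to scalar ones by continuous complex-linear
  functionals, which separate points by the Hahn--Banach theorem. Curves of a Cauchy domain need
  not be rectifiable, so integrability comes from local primitives and not from
  continuity. The contour independence is the homology form of Cauchy's theorem for weighted
  families of loops (Dixon's argument).

  Reality of \<open>F(T)\<close>: complex conjugation maps \<open>\<Gamma>\<close> to a contour homologous to \<open>-\<Gamma>\<close> off the spectrum.

  Multiplicativity needs only one contour. Put \<open>q(z, w) = (f(w) - f(z)) / (w - z)\<close>. By the resolvent
  identity, \<open>(f(z) - f(w)) R(z) R(w) = q(z, w) (R(w) - R(z))\<close>, which stays regular on the diagonal.
  Since \<open>q(z, w) R(z)\<close> is analytic in \<open>w \<in> U\<close> and integrates to zero over \<open>\<Gamma>\<close>, the difference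
  \<open>(Ff)(T) - F(T) f(T)\<close> is, up to a constant, the integral of \<open>q(z, w) F(z) R(w)\<close> over \<open>\<Gamma> \<times> \<Gamma>\<close>. For
  fixed \<open>w\<close> the integrand is analytic in \<open>z \<in> U\<close>, so this vanishes after exchanging the order.
\<close>

section \<open>Cauchy's theorem for families of loops\<close>

text \<open>Curves of infinite length also block continuity of integrals in a parameter and Fubini's
  theorem, on which both Dixon's argument and the product rule rest. The remedy is to replace a loop
  by a nearby polynomial loop: no integral of a holomorphic function changes, and the derivative
  becomes continuous. For this reason the integrands with a parameter are kept holomorphic in each
  variable and not merely continuous.

  Only the sum of the winding numbers over \<open>\<Gamma>\<close> is known; a single curve of
  \<open>\<Gamma>\<close> need not be null-homologous. Cauchy's theorem is therefore stated for
  whole families, and with weights, because comparing two contours gives one of them the weight -1.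
  The families are indexed instead of being sets of curves, since
  \<open>cnj \<circ> \<gamma>\<close> may coincide with another member of \<open>\<Gamma>\<close>,
  and a curve may belong to both of two contours.\<close>

definition diff_quotient :: "(complex \<Rightarrow> complex) \<Rightarrow> complex \<Rightarrow> complex \<Rightarrow> complex" where
  "diff_quotient f z w = (if w = z then deriv f z else (f w - f z) / (w - z))"

section \<open>Difference quotients of holomorphic functions\<close>

lemma diff_quotient_commute: "diff_quotient f z w = diff_quotient f w z"
  by (simp add: diff_quotient_def divide_simps) (simp add: algebra_simps)

lemma diff_quotient_mult: "diff_quotient f z w * (w - z) = f w - f z"
  by (simp add: diff_quotient_def)

text \<open>The singularity at \<open>w = z\<close> is removable, since the numerator vanishes
  there, and \<open>deriv f z\<close> is the missing value.\<close>

lemma holomorphic_on_diff_quotient: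
  assumes "f holomorphic_on U" "open U"
  shows "diff_quotient f z holomorphic_on U"
  using pole_lemma_open[OF assms, of z] by (simp add: diff_quotient_def[abs_def])

text \<open>Along the segment, \<open>f w - f z\<close> is \<open>w - z\<close> times the mean of
  \<open>deriv f\<close>. The formula contains no division, so it survives at \<open>w = z\<close>
  and yields joint continuity there.\<close>

lemma diff_quotient_eq_integral:
  assumes hol: "f holomorphic_on U" and op: "open U" and seg: "closed_segment z w \<subseteq> U"
  shows "diff_quotient f z w = integral {0..1} (\<lambda>t. deriv f (linepath z w t))"
proof (cases "w = z")
  case False
  have "(deriv f has_contour_integral f (pathfinish (linepath z w)) - f (pathstart (linepath z w))) (linepath z w)"
    by (rule contour_integral_primitive[where S = U])
      (use assms in \<open>auto intro: has_field_derivative_at_within holomorphic_derivI\<close>)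
  then have "((\<lambda>t. deriv f (linepath z w t) * (w - z)) has_integral (f w - f z)) {0..1}"
    by (simp add: has_contour_integral_linepath)
  then have "((\<lambda>t. deriv f (linepath z w t) * (w - z) * (1 / (w - z))) has_integral (f w - f z) * (1 / (w - z))) {0..1}"
    by (rule has_integral_mult_left)
  with False have "((\<lambda>t. deriv f (linepath z w t)) has_integral (f w - f z) / (w - z)) {0..1}"
    by simp
  then show ?thesis using False by (simp add: diff_quotient_def integral_unique)
qed (simp add: diff_quotient_def)

text \<open>Near a diagonal point both variables lie in a ball inside \<open>U\<close>. Its
  convexity permits the mean value formula, which is a parameter integral with continuous integrand.
  Off the diagonal the quotient itself is continuous.\<close>

lemma continuous_on_diff_quotient:
  assumes hol: "f holomorphic_on U" and op: "open U"
  shows "continuous_on (U \<times> U) (\<lambda>(z, w). diff_quotient f z w)"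
proof -
  have "isCont (\<lambda>(z, w). diff_quotient f z w) (a, b)" if ab: "a \<in> U" "b \<in> U" for a b
  proof (cases "a = b")
    case True
    obtain r where r: "r > 0" "ball a r \<subseteq> U" using ab op openE by blast
    have seg: "closed_segment z w \<subseteq> ball a r" if "z \<in> ball a r" "w \<in> ball a r" for z w
      using that by (simp add: closed_segment_subset)
    have lin: "linepath z w t \<in> U" if "z \<in> ball a r" "w \<in> ball a r" "t \<in> {0..1}" for z w t
      using seg[OF that(1,2)] linepath_in_path[OF that(3), of z w] r(2) by blast
    have cf: "continuous_on U (deriv f)"
      using hol op by (intro holomorphic_on_imp_continuous_on holomorphic_deriv)
    have "continuous_on ((ball a r \<times> ball a r) \<times> cbox 0 1) (\<lambda>x. deriv f (linepath (fst (fst x)) (snd (fst x)) (snd x)))"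
    proof (rule continuous_on_compose2[OF cf])
      show "continuous_on ((ball a r \<times> ball a r) \<times> cbox 0 1) (\<lambda>x. linepath (fst (fst x)) (snd (fst x)) (snd x :: real))"
        unfolding linepath_def by (intro continuous_intros)
      show "(\<lambda>x. linepath (fst (fst x)) (snd (fst x)) (snd x)) ` ((ball a r \<times> ball a r) \<times> cbox 0 1) \<subseteq> U"
        using lin by (auto simp del: mem_ball)
    qed
    then have "continuous_on ((ball a r \<times> ball a r) \<times> cbox 0 1) (\<lambda>(p, t). deriv f (linepath (fst p) (snd p) t))"
      by (simp add: split_beta)
    then have "continuous_on (ball a r \<times> ball a r) (\<lambda>p. integral (cbox 0 1) (\<lambda>t. deriv f (linepath (fst p) (snd p) t)))"
      by (rule integral_continuous_on_param)
    then have "continuous_on (ball a r \<times> ball a r) (\<lambda>(z, w). diff_quotient f z w)"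
    proof (rule continuous_on_eq)
      fix p assume p: "p \<in> ball a r \<times> ball a r"
      then have "closed_segment (fst p) (snd p) \<subseteq> U"
        using seg[of "fst p" "snd p"] r(2) by (simp add: mem_Times_iff subset_trans)
      from diff_quotient_eq_integral[OF hol op this]
      show "integral (cbox 0 1) (\<lambda>t. deriv f (linepath (fst p) (snd p) t)) = (case p of (z, w) \<Rightarrow> diff_quotient f z w)"
        by (simp add: split_beta)
    qed
    then show ?thesis
      using True r by (auto simp: continuous_on_eq_continuous_at open_Times)
  next
    case False
    define W where "W = (U \<times> U) \<inter> {p. fst p \<noteq> (snd p :: complex)}"
    have "open W" unfolding W_def by (intro open_Int open_Times op open_Collect_neq continuous_intros)
    have "continuous_on U f" using hol holomorphic_on_imp_continuous_on by blast
    then have "continuous_on W (\<lambda>p. f (fst p))" "continuous_on W (\<lambda>p. f (snd p))"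
      by (rule continuous_on_compose2; use W_def in \<open>auto intro: continuous_intros\<close>)+
    then have "continuous_on W (\<lambda>p. (f (snd p) - f (fst p)) / (snd p - fst p))"
      by (intro continuous_on_divide continuous_on_diff continuous_on_fst continuous_on_snd continuous_on_id)
        (auto simp: W_def)
    then have "continuous_on W (\<lambda>(z, w). diff_quotient f z w)"
      by (rule continuous_on_eq) (auto simp: W_def diff_quotient_def)
    then show ?thesis using \<open>open W\<close> ab False by (auto simp: continuous_on_eq_continuous_at W_def)
  qed
  then show ?thesis by (auto intro!: continuous_at_imp_continuous_on)
qed

section \<open>Contour integrals depending on a parameter\<close>

lemma contour_integral_param_continuous:
  assumes con: "continuous_on (U \<times> path_image \<gamma>) (\<lambda>(z, w). K z w)"
    and vp: "valid_path \<gamma>" and cd: "continuous_on {0..1} (\<lambda>t. vector_derivative \<gamma> (at t))"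
  shows "continuous_on U (\<lambda>z. contour_integral \<gamma> (K z))"
proof -
  have g: "continuous_on {0..1} \<gamma>" using vp by (simp add: valid_path_def piecewise_C1_differentiable_on_def)
  have "continuous_on (U \<times> {0..1}) (\<lambda>p. (\<lambda>(z, w). K z w) (fst p, \<gamma> (snd p)))"
    by (rule continuous_on_compose2[OF con])
      (auto simp: path_image_def intro!: continuous_intros continuous_on_compose2[OF g])
  moreover have "continuous_on (U \<times> {0..1}) (\<lambda>p. vector_derivative \<gamma> (at (snd p)))"
    by (rule continuous_on_compose2[OF cd]) (auto intro!: continuous_intros)
  \<comment> \<open>The hypothesis \<open>cd\<close> enters here: the velocity must be continuous on
    the whole closed interval for the integrand to be jointly continuous.\<close>
  ultimately have "continuous_on (U \<times> cbox 0 1) (\<lambda>(z, t). K z (\<gamma> t) * vector_derivative \<gamma> (at t))"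
    by (simp add: split_beta continuous_on_mult)
  from integral_continuous_on_param[OF this] show ?thesis
    by (simp add: contour_integral_integral)
qed

text \<open>Morera's theorem: along the sides of a triangle the order of integration may be
  exchanged, and the inner triangle integrals vanish because \<open>K\<close> is holomorphic in
  \<open>z\<close> for each \<open>w\<close> on the path.\<close>

lemma contour_integral_param_holomorphic:
  assumes op: "open U" and con: "continuous_on (U \<times> path_image \<gamma>) (\<lambda>(z, w). K z w)"
    and vp: "valid_path \<gamma>" and cd: "continuous_on {0..1} (\<lambda>t. vector_derivative \<gamma> (at t))"
    and hol: "\<And>w. w \<in> path_image \<gamma> \<Longrightarrow> (\<lambda>z. K z w) holomorphic_on U"
  shows "(\<lambda>z. contour_integral \<gamma> (K z)) holomorphic_on U"
proof -
  have tri: "contour_integral (linepath a b) (\<lambda>z. contour_integral \<gamma> (K z)) +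
      contour_integral (linepath b c) (\<lambda>z. contour_integral \<gamma> (K z)) +
      contour_integral (linepath c a) (\<lambda>z. contour_integral \<gamma> (K z)) = 0"
    if hull: "convex hull {a, b, c} \<subseteq> U" for a b c
  proof -
    have seg: "closed_segment a b \<subseteq> U" "closed_segment b c \<subseteq> U" "closed_segment c a \<subseteq> U"
      by (rule subset_trans[OF _ hull], rule segments_subset_convex_hull)+
    have sw: "contour_integral (linepath x y) (\<lambda>z. contour_integral \<gamma> (K z)) =
        contour_integral \<gamma> (\<lambda>w. contour_integral (linepath x y) (\<lambda>z. K z w))"
      if "closed_segment x y \<subseteq> U" for x y
    proof (rule contour_integral_swap)
      show "continuous_on (path_image (linepath x y) \<times> path_image \<gamma>) (\<lambda>(z, w). K z w)"
        by (rule continuous_on_subset[OF con]) (use that in auto)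
    qed (use vp cd in simp_all)
    have ci: "(\<lambda>w. contour_integral (linepath x y) (\<lambda>z. K z w)) contour_integrable_on \<gamma>"
      if "closed_segment x y \<subseteq> U" for x y
    proof -
      have "continuous_on (path_image \<gamma> \<times> path_image (linepath x y)) (\<lambda>(w, z). K z w)"
        by (rule continuous_on_swap_args, rule continuous_on_subset[OF con]) (use that in auto)
      then have "continuous_on (path_image \<gamma>) (\<lambda>w. contour_integral (linepath x y) (\<lambda>z. K z w))"
        by (rule contour_integral_param_continuous) simp_all
      moreover have "continuous_on {0..1} \<gamma>" using vp by (simp add: valid_path_def piecewise_C1_differentiable_on_def)
      ultimately show ?thesis
        unfolding contour_integrable_on using cd
        by (intro integrable_continuous_real continuous_on_mult, elim continuous_on_compose2)
          (simp_all add: path_image_def)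
    qed
    have "contour_integral (linepath a b) (\<lambda>z. K z w) + contour_integral (linepath b c) (\<lambda>z. K z w)
        + contour_integral (linepath c a) (\<lambda>z. K z w) = 0" if w: "w \<in> path_image \<gamma>" for w
    proof -
      have h: "(\<lambda>z. K z w) holomorphic_on convex hull {a, b, c}"
        using hol[OF w] hull by (rule holomorphic_on_subset)
      have "((\<lambda>z. K z w) has_contour_integral 0) (linepath a b +++ linepath b c +++ linepath c a)"
        by (rule Cauchy_theorem_triangle[OF h])
      moreover have "(\<lambda>z. K z w) contour_integrable_on linepath x y" if "closed_segment x y \<subseteq> U" for x y
        by (intro contour_integrable_continuous_linepath continuous_on_subset[OF _ that]
            holomorphic_on_imp_continuous_on[OF hol[OF w]])
      ultimately show ?thesis using seg
        by (metis contour_integral_unique has_chain_integral_chain_integral3)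
    qed
    then have "contour_integral \<gamma> (\<lambda>w. contour_integral (linepath a b) (\<lambda>z. K z w)
        + contour_integral (linepath b c) (\<lambda>z. K z w) + contour_integral (linepath c a) (\<lambda>z. K z w))
        = contour_integral \<gamma> (\<lambda>w. 0)"
      by (intro contour_integral_eq)
    then show ?thesis
      by (simp add: sw[OF seg(1)] sw[OF seg(2)] sw[OF seg(3)] ci[OF seg(1)] ci[OF seg(2)] ci[OF seg(3)]
          contour_integral_add contour_integrable_add)
  qed
  have "(\<lambda>z. contour_integral \<gamma> (K z)) analytic_on U"
    by (rule Morera_triangle[OF contour_integral_param_continuous[OF con vp cd] op]) (use tri in blast)
  then show ?thesis by (rule analytic_imp_holomorphic)
qed

section \<open>Replacing loops by polynomial ones\<close>

lemma polynomial_function_contour_deriv: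
  assumes "polynomial_function (\<gamma> :: real \<Rightarrow> complex)"
  shows "continuous_on {0..1} (\<lambda>t. vector_derivative \<gamma> (at t))"
proof -
  obtain g where g: "polynomial_function g" "\<And>x. (\<gamma> has_vector_derivative g x) (at x)"
    using has_vector_derivative_polynomial_function[OF assms] by blast
  then show ?thesis by (simp add: continuous_on_polymonial_function vector_derivative_at[OF g(2)])
qed

text \<open>A polynomial approximation with the same ends, close enough to \<open>\<gamma>\<close>,
  stays in \<open>S\<close> and gives the same integrals of holomorphic functions. What is gained is
  a continuous derivative.\<close>

lemma polynomial_path_replacement:
  assumes "open S" "valid_path \<gamma>" "path_image \<gamma> \<subseteq> S" "pathfinish \<gamma> = pathstart \<gamma>"
  obtains p where "polynomial_function p" "path_image p \<subseteq> S" "pathfinish p = pathstart p"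
    "\<And>f. f holomorphic_on S \<Longrightarrow> contour_integral p f = contour_integral \<gamma> f"
proof -
  have "path \<gamma>" using assms valid_path_imp_path by blast
  obtain d where "d > 0" and d: "\<And>g h. \<lbrakk>valid_path g; valid_path h; \<forall>t\<in>{0..1}. cmod (g t - \<gamma> t) < d \<and> cmod (h t - \<gamma> t) < d;
      pathstart h = pathstart g \<and> pathfinish h = pathfinish g\<rbrakk>
      \<Longrightarrow> path_image h \<subseteq> S \<and> (\<forall>f. f holomorphic_on S \<longrightarrow> contour_integral h f = contour_integral g f)"
    using contour_integral_nearby_ends[OF assms(1) \<open>path \<gamma>\<close> assms(3)] by metis
  obtain p where p: "polynomial_function p" "pathstart p = pathstart \<gamma>" "pathfinish p = pathfinish \<gamma>"
    "\<forall>t\<in>{0..1}. cmod (p t - \<gamma> t) < d"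
    using path_approx_polynomial_function[OF \<open>path \<gamma>\<close> \<open>d > 0\<close>] by metis
  show ?thesis
    using that[OF p(1)] d[of \<gamma> p] assms p \<open>d > 0\<close> by (simp add: valid_path_polynomial_function)
qed

text \<open>For \<open>w\<close> outside \<open>S\<close> the kernel \<open>1 / (v - w)\<close> is
  holomorphic on \<open>S\<close>, so it is among the functions whose integrals agree.\<close>

lemma winding_number_eq_of_contour_integral:
  assumes "valid_path p" "valid_path \<gamma>" "path_image p \<subseteq> S" "path_image \<gamma> \<subseteq> S" "w \<notin> S"
    "\<And>f. f holomorphic_on S \<Longrightarrow> contour_integral p f = contour_integral \<gamma> f"
  shows "winding_number p w = winding_number \<gamma> w"
proof -
  have "(\<lambda>v. 1 / (v - w)) holomorphic_on S" using assms(5) by (auto intro!: holomorphic_intros)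
  moreover have "w \<notin> path_image p" "w \<notin> path_image \<gamma>" using assms by auto
  ultimately show ?thesis using assms by (simp add: winding_number_valid_path)
qed

text \<open>\<open>hd\<close>, the chain integral of the difference quotient, is holomorphic on
  \<open>U\<close>; \<open>hc\<close>, the Cauchy transform of the chain, is holomorphic on
  \<open>V\<close>. They agree on \<open>U \<inter> V\<close>, where the winding term drops out, and
  the hypothesis \<open>zero\<close> makes the two sets cover the plane. The glued function is
  entire and tends to 0 at infinity, so it vanishes by Liouville's theorem.\<close>

lemma Cauchy_theorem_chain_polynomial:
  fixes c :: "'i \<Rightarrow> complex" and p :: "'i \<Rightarrow> real \<Rightarrow> complex"
  assumes op: "open U" and hol: "f holomorphic_on U" and fin: "finite I"
    and poly: "\<And>i. i \<in> I \<Longrightarrow> polynomial_function (p i)"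
    and img: "\<And>i. i \<in> I \<Longrightarrow> path_image (p i) \<subseteq> U"
    and loop: "\<And>i. i \<in> I \<Longrightarrow> pathfinish (p i) = pathstart (p i)"
    and zero: "\<And>w. w \<notin> U \<Longrightarrow> (\<Sum>i\<in>I. c i * winding_number (p i) w) = 0"
  shows "(\<Sum>i\<in>I. c i * contour_integral (p i) f) = 0"
proof (cases "I = {}")
  case False
  have vp: "valid_path (p i)" and pp: "path (p i)"
    and cd: "continuous_on {0..1} (\<lambda>t. vector_derivative (p i) (at t))" if "i \<in> I" for i
    using poly[OF that] by (simp_all add: valid_path_polynomial_function path_polynomial_function
        polynomial_function_contour_deriv)
  define P where "P = (\<Union>i\<in>I. path_image (p i))"
  have cP: "compact P" unfolding P_def using fin pp by (intro compact_UN compact_path_image) auto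
  have iP: "w \<in> P" if "i \<in> I" "w \<in> path_image (p i)" for i w using that by (auto simp: P_def)
  have PU: "P \<subseteq> U" using img by (auto simp: P_def)
  have "P \<noteq> {}" using False by (auto simp: P_def)
  \<comment> \<open>A nonempty compact subset of the plane is not open, so \<open>U\<close> has a
    point off all the curves.\<close>
  then have "P \<noteq> U" using compact_open cP op by blast
  then obtain z0 where z0: "z0 \<in> U" "z0 \<notin> P" using PU by blast
  \<comment> \<open>The factor \<open>w - z0\<close> turns the Cauchy transform of \<open>g\<close>
    at \<open>z0\<close> into the integral of \<open>f\<close>, and it makes the winding term at
    \<open>z0\<close> vanish.\<close>
  define g where "g w = f w * (w - z0)" for w
  have holg: "g holomorphic_on U" unfolding g_def by (intro holomorphic_intros hol)
  have cong: "continuous_on U g" using holg holomorphic_on_imp_continuous_on by blast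
  define N where "N z = (\<Sum>i\<in>I. c i * winding_number (p i) z)" for z
  define hd where "hd z = (\<Sum>i\<in>I. c i * contour_integral (p i) (diff_quotient g z))" for z
  define hc where "hc z = (\<Sum>i\<in>I. c i * contour_integral (p i) (\<lambda>w. g w / (w - z)))" for z
  define V where "V = {z. z \<notin> P \<and> N z = 0}"
  have key: "hd z = hc z - 2 * pi * \<i> * g z * N z" if z: "z \<in> U" "z \<notin> P" for z
  proof -
    have eq: "contour_integral (p i) (diff_quotient g z)
        = contour_integral (p i) (\<lambda>w. g w / (w - z)) - 2 * pi * \<i> * g z * winding_number (p i) z"
      if i: "i \<in> I" for i
    proof -
      have ne: "z \<notin> path_image (p i)" using z iP[OF i] by blast
      have "(\<lambda>w. g w / (w - z)) contour_integrable_on (p i)"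
        by (rule contour_integrable_holomorphic_simple[where S = "U - {z}"])
          (use ne img[OF i] op vp[OF i] in \<open>auto intro!: holomorphic_intros holomorphic_on_subset[OF holg]\<close>)
      moreover have "((\<lambda>w. g z * (1 / (w - z))) has_contour_integral g z * (2 * pi * \<i> * winding_number (p i) z)) (p i)"
        by (rule has_contour_integral_lmul) (rule has_contour_integral_winding_number[OF vp[OF i] ne])
      ultimately have "((\<lambda>w. g w / (w - z) - g z * (1 / (w - z))) has_contour_integral
          contour_integral (p i) (\<lambda>w. g w / (w - z)) - g z * (2 * pi * \<i> * winding_number (p i) z)) (p i)"
        by (intro has_contour_integral_diff has_contour_integral_integral)
      then have "(diff_quotient g z has_contour_integral
          contour_integral (p i) (\<lambda>w. g w / (w - z)) - g z * (2 * pi * \<i> * winding_number (p i) z)) (p i)"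
        by (rule has_contour_integral_eq) (use ne in \<open>auto simp: diff_quotient_def diff_divide_distrib\<close>)
      then show ?thesis by (simp add: contour_integral_unique)
    qed
    show ?thesis
      unfolding hd_def hc_def N_def sum_distrib_left sum_subtractf[symmetric]
      by (intro sum.cong refl) (simp add: eq right_diff_distrib mult_ac del: diff_eq_eq)
  qed
  define h where "h z = (if z \<in> U then hd z else hc z)" for z
  have hV: "h z = hc z" if "z \<in> V" for z
    using key[of z] that by (simp add: h_def V_def)
  have oV: "open V"
  proof (rule openI)
    fix a assume a: "a \<in> V"
    \<comment> \<open>Winding numbers of loops are locally constant off the curves, so
      \<open>N\<close> keeps the value \<open>N a\<close> on \<open>W\<close>.\<close>
    define W where "W = (\<Inter>i\<in>I. {z. z \<notin> path_image (p i) \<and> winding_number (p i) z = winding_number (p i) a})"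
    have "open W" unfolding W_def
      using fin by (intro open_INT ballI open_winding_number_levelsets) (auto simp: pp loop)
    moreover have "a \<in> W" using a by (auto simp: W_def V_def P_def)
    moreover have "W \<subseteq> V"
    proof
      fix z assume z: "z \<in> W"
      then have "N z = N a" unfolding N_def by (intro sum.cong refl) (auto simp: W_def)
      then show "z \<in> V" using z a by (auto simp: V_def W_def P_def)
    qed
    ultimately show "\<exists>e>0. ball a e \<subseteq> V" by (meson openE subset_trans)
  qed
  have UV: "U \<union> V = UNIV" using zero PU by (auto simp: V_def N_def)
  have "hd holomorphic_on U" unfolding hd_def[abs_def]
  proof (intro holomorphic_on_sum holomorphic_on_mult holomorphic_on_const contour_integral_param_holomorphic[OF op _ vp cd])
    fix i assume i: "i \<in> I"
    show "continuous_on (U \<times> path_image (p i)) (\<lambda>(z, w). diff_quotient g z w)"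
      by (rule continuous_on_subset[OF continuous_on_diff_quotient[OF holg op]]) (use img[OF i] in auto)
    fix w
    have "(\<lambda>z. diff_quotient g z w) = diff_quotient g w" by (rule ext) (rule diff_quotient_commute)
    then show "(\<lambda>z. diff_quotient g z w) holomorphic_on U"
      using holomorphic_on_diff_quotient[OF holg op] by simp
  qed
  then have "h holomorphic_on U" by (rule holomorphic_transform) (simp add: h_def)
  moreover have "hc holomorphic_on V" unfolding hc_def[abs_def]
  proof (intro holomorphic_on_sum holomorphic_on_mult holomorphic_on_const contour_integral_param_holomorphic[OF oV _ vp cd])
    fix i assume i: "i \<in> I"
    have ne: "w \<noteq> z" if "z \<in> V" "w \<in> path_image (p i)" for z w
      using that iP[OF i] by (auto simp: V_def)
    have "continuous_on (V \<times> path_image (p i)) (\<lambda>q. g (snd q))"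
      by (rule continuous_on_compose2[OF cong continuous_on_snd[OF continuous_on_id]]) (use img[OF i] in auto)
    then have "continuous_on (V \<times> path_image (p i)) (\<lambda>q. g (snd q) / (snd q - fst q))"
      by (intro continuous_on_divide continuous_on_diff continuous_on_fst continuous_on_snd continuous_on_id)
        (use ne in auto)
    then show "continuous_on (V \<times> path_image (p i)) (\<lambda>(z, w). g w / (w - z))" by (simp add: split_beta)
    fix w assume "w \<in> path_image (p i)"
    then show "(\<lambda>z. g w / (w - z)) holomorphic_on V"
      using ne by (intro holomorphic_intros) auto
  qed
  then have "h holomorphic_on V" by (rule holomorphic_transform) (simp add: hV)
  ultimately have holh: "h holomorphic_on UNIV"
    using holomorphic_on_Un[OF _ _ op oV] UV by metis
  obtain C where C: "C > 0" "\<And>w. w \<in> P \<Longrightarrow> norm w \<le> C"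
    using cP compact_imp_bounded bounded_pos by metis
  \<comment> \<open>This is \<open>hc\<close> in the coordinate \<open>u = 1 / z\<close>:
    multiplying numerator and denominator of \<open>g w / (w - z)\<close> by \<open>u\<close> gives
    a form that makes sense at \<open>u = 0\<close>, with value 0. The radius \<open>1 / C\<close>
    used below keeps \<open>u * w\<close> away from 1.\<close>
  define k where "k u = (\<Sum>i\<in>I. c i * contour_integral (p i) (\<lambda>w. g w * u / (u * w - 1)))" for u
  have "continuous_on (ball 0 (1 / C)) k" unfolding k_def[abs_def]
  proof (intro continuous_on_sum continuous_on_mult continuous_on_const contour_integral_param_continuous[OF _ vp cd])
    fix i assume i: "i \<in> I"
    have ne: "u * w - 1 \<noteq> 0" if "u \<in> ball 0 (1 / C)" "w \<in> path_image (p i)" for u w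
    proof
      assume "u * w - 1 = 0"
      then have "norm u * norm w = 1" by (metis eq_iff_diff_eq_0 norm_mult norm_one)
      moreover have "norm u * C < 1" using that(1) C(1) by (simp add: field_simps)
      moreover have "norm w \<le> C" using C(2) iP[OF i that(2)] .
      ultimately show False by (smt (verit) mult_left_mono norm_ge_zero)
    qed
    have "continuous_on (ball 0 (1 / C) \<times> path_image (p i)) (\<lambda>q. g (snd q))"
      by (rule continuous_on_compose2[OF cong continuous_on_snd[OF continuous_on_id]]) (use img[OF i] in auto)
    then have "continuous_on (ball 0 (1 / C) \<times> path_image (p i)) (\<lambda>q. g (snd q) * fst q / (fst q * snd q - 1))"
      by (intro continuous_on_divide continuous_on_mult continuous_on_diff continuous_on_fst continuous_on_snd
          continuous_on_id continuous_on_const) (use ne in auto)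
    then show "continuous_on (ball 0 (1 / C) \<times> path_image (p i)) (\<lambda>(u, w). g w * u / (u * w - 1))"
      by (simp add: split_beta)
  qed
  then have "isCont k 0" using C(1) by (auto simp: continuous_on_eq_continuous_at)
  from isCont_tendsto_compose[OF this tendsto_inverse_0]
  have "((\<lambda>z. k (inverse z)) \<longlongrightarrow> 0) at_infinity" by (simp add: k_def)
  moreover have "h z = k (inverse z)" if z: "norm z > C" for z
  proof -
    have "z \<notin> P" using C(2) z by fastforce
    \<comment> \<open>All curves lie in the disc \<open>cball 0 C\<close>, which is convex and does
      not contain \<open>z\<close>.\<close>
    have "winding_number (p i) z = 0" if "i \<in> I" for i
      by (rule winding_number_zero_outside[OF pp[OF that], of "cball 0 C"])
        (use that z loop C(2) iP[OF that] in auto)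
    then have "z \<in> V" using \<open>z \<notin> P\<close> by (simp add: V_def N_def)
    moreover have "g w / (w - z) = g w * inverse z / (inverse z * w - 1)" if "w \<in> P" for w
    proof -
      have "z \<noteq> 0" "w \<noteq> z" using z C(1) that \<open>z \<notin> P\<close> by auto
      then show ?thesis by (simp add: field_simps)
    qed
    ultimately show ?thesis unfolding hV[OF \<open>z \<in> V\<close>] hc_def k_def
      by (intro sum.cong refl arg_cong2[where f = "(*)"] contour_integral_eq) (use iP in auto)
  qed
  then have "\<forall>\<^sub>F z in at_infinity. k (inverse z) = h z"
    unfolding eventually_at_infinity by (intro exI[of _ "C + 1"]) auto
  ultimately have "(h \<longlongrightarrow> 0) at_infinity" by (rule Lim_transform_eventually)
  then have "h z0 = 0" by (rule Liouville_weak[OF holh])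
  then have "hc z0 = 0" using key[OF z0] z0 by (simp add: h_def g_def)
  moreover have "hc z0 = (\<Sum>i\<in>I. c i * contour_integral (p i) f)"
    unfolding hc_def g_def
    by (intro sum.cong refl arg_cong2[where f = "(*)"] contour_integral_eq) (use iP z0 in auto)
  ultimately show ?thesis by simp
qed simp

text \<open>The hypothesis involves winding numbers about points outside \<open>U\<close> only.
  These, like the integral of \<open>f\<close>, are preserved when the loops are replaced by
  polynomial ones.\<close>

theorem Cauchy_theorem_chain:
  fixes c :: "'i \<Rightarrow> complex" and \<gamma> :: "'i \<Rightarrow> real \<Rightarrow> complex"
  assumes op: "open U" and hol: "f holomorphic_on U" and fin: "finite I"
    and vp: "\<And>i. i \<in> I \<Longrightarrow> valid_path (\<gamma> i)"
    and img: "\<And>i. i \<in> I \<Longrightarrow> path_image (\<gamma> i) \<subseteq> U"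
    and loop: "\<And>i. i \<in> I \<Longrightarrow> pathfinish (\<gamma> i) = pathstart (\<gamma> i)"
    and zero: "\<And>w. w \<notin> U \<Longrightarrow> (\<Sum>i\<in>I. c i * winding_number (\<gamma> i) w) = 0"
  shows "(\<Sum>i\<in>I. c i * contour_integral (\<gamma> i) f) = 0"
proof -
  have "\<forall>i\<in>I. \<exists>p. polynomial_function p \<and> path_image p \<subseteq> U \<and> pathfinish p = pathstart p \<and>
      (\<forall>f. f holomorphic_on U \<longrightarrow> contour_integral p f = contour_integral (\<gamma> i) f)"
    using polynomial_path_replacement[OF op vp img loop] by metis
  then obtain p where p: "\<And>i. i \<in> I \<Longrightarrow> polynomial_function (p i) \<and> path_image (p i) \<subseteq> U \<and>
      pathfinish (p i) = pathstart (p i) \<and>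
      (\<forall>f. f holomorphic_on U \<longrightarrow> contour_integral (p i) f = contour_integral (\<gamma> i) f)"
    by metis
  have "winding_number (p i) w = winding_number (\<gamma> i) w" if "i \<in> I" "w \<notin> U" for i w
    by (rule winding_number_eq_of_contour_integral[of _ _ U])
      (use p[OF that(1)] vp img that in \<open>auto simp: valid_path_polynomial_function\<close>)
  then have "(\<Sum>i\<in>I. c i * contour_integral (p i) f) = 0"
    using p zero by (intro Cauchy_theorem_chain_polynomial[OF op hol fin]) simp_all
  then show ?thesis using p hol by simp
qed

text \<open>Each \<open>m z\<close> is holomorphic on \<open>V\<close>, so a polynomial loop yields
  the same values as \<open>\<delta>\<close>, and for that loop the velocity is continuous.\<close>

lemma contour_integral_param_holomorphic_loop:
  assumes op: "open V" and con: "continuous_on (V \<times> V) (\<lambda>(z, w). m z w)"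
    and hol1: "\<And>z. z \<in> V \<Longrightarrow> m z holomorphic_on V" and hol2: "\<And>w. w \<in> V \<Longrightarrow> (\<lambda>z. m z w) holomorphic_on V"
    and \<delta>: "valid_path \<delta>" "path_image \<delta> \<subseteq> V" "pathfinish \<delta> = pathstart \<delta>"
  shows "(\<lambda>z. contour_integral \<delta> (m z)) holomorphic_on V"
proof -
  obtain p where p: "polynomial_function p" "path_image p \<subseteq> V"
    "\<And>f. f holomorphic_on V \<Longrightarrow> contour_integral p f = contour_integral \<delta> f"
    using polynomial_path_replacement[OF op \<delta>] by metis
  have "(\<lambda>z. contour_integral p (m z)) holomorphic_on V"
  proof (rule contour_integral_param_holomorphic[OF op])
    show "continuous_on (V \<times> path_image p) (\<lambda>(z, w). m z w)"
      by (rule continuous_on_subset[OF con]) (use p(2) in auto)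
    show "(\<lambda>z. m z w) holomorphic_on V" if "w \<in> path_image p" for w
      using that p(2) hol2 by blast
  qed (rule valid_path_polynomial_function[OF p(1)] polynomial_function_contour_deriv[OF p(1)])+
  then show ?thesis by (rule holomorphic_transform) (simp add: p(3) hol1)
qed

text \<open>Fubini's theorem is applied to polynomial loops. Replacing an outer loop is legitimate
  because the inner integral is holomorphic in the remaining variable, replacing an inner loop
  because \<open>m\<close> is holomorphic in the variable of integration.\<close>

lemma contour_integral_swap_loops:
  assumes op: "open V" and con: "continuous_on (V \<times> V) (\<lambda>(z, w). m z w)"
    and hol1: "\<And>z. z \<in> V \<Longrightarrow> m z holomorphic_on V" and hol2: "\<And>w. w \<in> V \<Longrightarrow> (\<lambda>z. m z w) holomorphic_on V"
    and \<gamma>: "valid_path \<gamma>" "path_image \<gamma> \<subseteq> V" "pathfinish \<gamma> = pathstart \<gamma>"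
    and \<delta>: "valid_path \<delta>" "path_image \<delta> \<subseteq> V" "pathfinish \<delta> = pathstart \<delta>"
  shows "contour_integral \<gamma> (\<lambda>z. contour_integral \<delta> (m z)) = contour_integral \<delta> (\<lambda>w. contour_integral \<gamma> (\<lambda>z. m z w))"
proof -
  obtain p where p: "polynomial_function p" "path_image p \<subseteq> V"
    "\<And>f. f holomorphic_on V \<Longrightarrow> contour_integral p f = contour_integral \<gamma> f"
    using polynomial_path_replacement[OF op \<gamma>] by metis
  obtain q where q: "polynomial_function q" "path_image q \<subseteq> V"
    "\<And>f. f holomorphic_on V \<Longrightarrow> contour_integral q f = contour_integral \<delta> f"
    using polynomial_path_replacement[OF op \<delta>] by metis
  have con': "continuous_on (V \<times> V) (\<lambda>(w, z). m z w)"
    by (rule continuous_on_swap_args[OF con])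
  have "contour_integral \<gamma> (\<lambda>z. contour_integral \<delta> (m z)) = contour_integral p (\<lambda>z. contour_integral \<delta> (m z))"
    by (rule p(3)[symmetric]) (rule contour_integral_param_holomorphic_loop[OF op con hol1 hol2 \<delta>])
  also have "\<dots> = contour_integral p (\<lambda>z. contour_integral q (m z))"
    by (rule contour_integral_eq) (use p(2) q(3)[OF hol1] in auto)
  also have "\<dots> = contour_integral q (\<lambda>w. contour_integral p (\<lambda>z. m z w))"
  proof (rule contour_integral_swap)
    show "continuous_on (path_image p \<times> path_image q) (\<lambda>(z, w). m z w)"
      by (rule continuous_on_subset[OF con]) (use p(2) q(2) in auto)
  qed (rule valid_path_polynomial_function[OF p(1)] polynomial_function_contour_deriv[OF p(1)]
      valid_path_polynomial_function[OF q(1)] polynomial_function_contour_deriv[OF q(1)])+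
  also have "\<dots> = contour_integral q (\<lambda>w. contour_integral \<gamma> (\<lambda>z. m z w))"
    by (rule contour_integral_eq) (use q(2) p(3)[OF hol2] in auto)
  also have "\<dots> = contour_integral \<delta> (\<lambda>w. contour_integral \<gamma> (\<lambda>z. m z w))"
    by (rule q(3)) (rule contour_integral_param_holomorphic_loop[OF op con' hol2 hol1 \<gamma>])
  finally show ?thesis .
qed

section \<open>The Hahn--Banach theorem\<close>

text \<open>
  Graphs of linear functionals on subspaces that are bounded by the norm; the bound at \<open>x = 0\<close>
  makes such a graph single-valued.
\<close>

definition dominated_graph :: "('a::real_normed_vector \<times> real) set \<Rightarrow> bool" where
  "dominated_graph G \<longleftrightarrow> subspace G \<and> (\<forall>(x, r)\<in>G. r \<le> norm x)"

text \<open>Extension by one vector: any value between the lower bounds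
  \<open>r - norm (y - x)\<close> and the upper bounds \<open>norm (z + x) - s\<close> will do, and
  the triangle inequality separates the two families. If \<open>x\<close> already lies in the
  domain, the bounds pinch \<open>a\<close> to the old value, so this is no special case.\<close>

lemma dominated_graph_extend:
  assumes G: "dominated_graph G"
  obtains H r where "dominated_graph H" "G \<subseteq> H" "(x, r) \<in> H"
proof -
  have sub: "subspace G" and dom: "\<And>y r. (y, r) \<in> G \<Longrightarrow> r \<le> norm y"
    using G by (auto simp: dominated_graph_def)
  define L where "L = {r - norm (y - x) | y r. (y, r) \<in> G}"
  have cross: "r - norm (y - x) \<le> norm (z + x) - s" if "(y, r) \<in> G" "(z, s) \<in> G" for y r z s
  proof -
    have "(y + z, r + s) \<in> G" using subspace_add[OF sub that] by simp
    then have "r + s \<le> norm (y + z)" by (rule dom)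
    also have "\<dots> \<le> norm (y - x) + norm (z + x)"
      using norm_triangle_ineq[of "y - x" "z + x"] by simp
    finally show ?thesis by simp
  qed
  have "(0, 0) \<in> G" using subspace_0[OF sub] by (simp add: zero_prod_def)
  then have "L \<noteq> {}" and bdd: "bdd_above L"
    using cross unfolding L_def bdd_above_def by blast+
  define a where "a = Sup L"
  have lower: "r - norm (y - x) \<le> a" if "(y, r) \<in> G" for y r
    unfolding a_def by (rule cSup_upper[OF _ bdd]) (use that in \<open>auto simp: L_def\<close>)
  have upper: "a \<le> norm (z + x) - s" if "(z, s) \<in> G" for z s
    unfolding a_def by (rule cSup_least[OF \<open>L \<noteq> {}\<close>]) (use cross that in \<open>auto simp: L_def\<close>)
  define H where "H = {u + v | u v. u \<in> G \<and> v \<in> span {(x, a)}}"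
  have "subspace H" unfolding H_def by (rule subspace_sums[OF sub subspace_span])
  moreover have "r \<le> norm y" if "(y, r) \<in> H" for y r
  proof -
    obtain z s t where zs: "(z, s) \<in> G" and eq: "y = z + t *\<^sub>R x" "r = s + t * a"
      using \<open>(y, r) \<in> H\<close> by (auto simp: H_def span_singleton)
    have sc: "(c *\<^sub>R z, c * s) \<in> G" for c using subspace_scale[OF sub zs, of c] by simp
    \<comment> \<open>After rescaling, the coefficient of \<open>x\<close> is 1 or -1; the sign of
      \<open>t\<close> decides whether the upper or the lower bound on \<open>a\<close>
      applies.\<close>
    consider "t = 0" | "t > 0" | "t < 0" by linarith
    then show ?thesis
    proof cases
      case 1
      then show ?thesis using dom[OF zs] eq by simp
    next
      case 2
      have "t * a \<le> t * (norm ((1 / t) *\<^sub>R z + x) - (1 / t) * s)"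
        using upper[OF sc[of "1 / t"]] 2 by (intro mult_left_mono) auto
      also have "\<dots> = norm (t *\<^sub>R ((1 / t) *\<^sub>R z + x)) - s"
        using 2 by (simp add: right_diff_distrib)
      also have "t *\<^sub>R ((1 / t) *\<^sub>R z + x) = y" using 2 eq by (simp add: scaleR_right_distrib)
      finally show ?thesis using eq by simp
    next
      case 3
      define q where "q = - t"
      have q: "q > 0" using 3 by (simp add: q_def)
      have "q * ((1 / q) * s - norm ((1 / q) *\<^sub>R z - x)) \<le> q * a"
        using lower[OF sc[of "1 / q"]] q by (intro mult_left_mono) auto
      moreover have "q * ((1 / q) * s - norm ((1 / q) *\<^sub>R z - x)) = s - norm (q *\<^sub>R ((1 / q) *\<^sub>R z - x))"
        using q by (simp add: right_diff_distrib)
      moreover have "q *\<^sub>R ((1 / q) *\<^sub>R z - x) = y"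
        using q eq by (simp add: scaleR_right_diff_distrib) (simp add: q_def)
      moreover have "r = s - q * a" using eq by (simp add: q_def)
      ultimately show ?thesis by (simp only:)
    qed
  qed
  moreover have "G \<subseteq> H"
  proof
    fix u assume "u \<in> G"
    then have "u + 0 \<in> H" unfolding H_def using span_zero by blast
    then show "u \<in> H" by simp
  qed
  moreover have "(x, a) \<in> H"
  proof -
    have "(0, 0) + (x, a) \<in> H"
      unfolding H_def using \<open>(0, 0) \<in> G\<close> span_base[of "(x, a)" "{(x, a)}"] by blast
    then show ?thesis by simp
  qed
  ultimately show ?thesis using that[of H a] by (auto simp: dominated_graph_def)
qed

text \<open>Zorn's lemma on the dominated graphs through \<open>(x, norm x)\<close>: unions of
  chains are again dominated, and a maximal graph has full domain by the extension step. Applying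
  the one-sided bound to \<open>- y\<close> as well gives the absolute value.\<close>

theorem exists_norming_functional:
  fixes x :: "'a::real_normed_vector"
  shows "\<exists>f. bounded_linear f \<and> f x = norm x \<and> (\<forall>y. \<bar>f y\<bar> \<le> norm y)"
proof -
  define \<A> where "\<A> = {G. dominated_graph G \<and> (x, norm x) \<in> G}"
  have "span {(x, norm x)} \<in> \<A>"
  proof -
    have "r \<le> norm y" if "(y, r) \<in> span {(x, norm x)}" for y r
      using that by (auto simp: span_singleton mult_right_mono)
    then show ?thesis by (auto simp: \<A>_def dominated_graph_def span_base)
  qed
  moreover have "\<Union>C \<in> \<A>" if C: "C \<noteq> {}" "subset.chain \<A> C" for C
  proof -
    have sub: "subspace G" if "G \<in> C" for G
      using C that by (auto simp: \<A>_def dominated_graph_def subset.chain_def)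
    have "subspace (\<Union>C)"
    proof (rule subspaceI)
      show "0 \<in> \<Union>C" using C(1) sub subspace_0 by blast
      fix u v assume "u \<in> \<Union>C" "v \<in> \<Union>C"
      then obtain G H where GH: "u \<in> G" "G \<in> C" "v \<in> H" "H \<in> C" by blast
      then have "G \<subseteq> H \<or> H \<subseteq> G" using C(2) by (auto simp: subset.chain_def)
      then show "u + v \<in> \<Union>C" using GH sub subspace_add by (metis UnionI subsetD)
    next
      fix c u assume "u \<in> \<Union>C"
      then show "c *\<^sub>R u \<in> \<Union>C" using sub subspace_scale by blast
    qed
    then show ?thesis using C by (fastforce simp: \<A>_def dominated_graph_def subset.chain_def)
  qed
  ultimately obtain M where M: "M \<in> \<A>" and max: "\<And>X. X \<in> \<A> \<Longrightarrow> M \<subseteq> X \<Longrightarrow> X = M"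
    using subset_Zorn_nonempty[of \<A>] by blast
  have sub: "subspace M" and dom: "\<And>y r. (y, r) \<in> M \<Longrightarrow> r \<le> norm y" and xM: "(x, norm x) \<in> M"
    using M by (auto simp: \<A>_def dominated_graph_def)
  have total: "\<exists>r. (y, r) \<in> M" for y
  proof -
    obtain H r where H: "dominated_graph H" "M \<subseteq> H" "(y, r) \<in> H"
      using dominated_graph_extend[of M y thesis] M by (auto simp: \<A>_def)
    then have "H = M" using max xM by (auto simp: \<A>_def)
    then show ?thesis using H by blast
  qed
  have unique: "r = s" if "(y, r) \<in> M" "(y, s) \<in> M" for y r s
    using dom[of 0 "r - s"] dom[of 0 "s - r"] subspace_diff[OF sub that] subspace_diff[OF sub that(2,1)] by simp
  define f where "f y = (THE r. (y, r) \<in> M)" for y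
  have f: "(y, f y) \<in> M" for y
    unfolding f_def using total unique by (metis theI')
  have fI: "f y = r" if "(y, r) \<in> M" for y r using unique f that by blast
  have bound: "\<bar>f y\<bar> \<le> norm y" for y
    using dom[OF f] dom[of "- y" "- f y"] subspace_neg[OF sub f[of y]] by (simp add: abs_le_iff)
  have "bounded_linear f"
  proof (rule bounded_linear_intro[where K = 1])
    fix y z c
    show "f (y + z) = f y + f z" using subspace_add[OF sub f f] by (intro fI) simp
    show "f (c *\<^sub>R y) = c *\<^sub>R f y" using subspace_scale[OF sub f] by (intro fI) simp
    show "norm (f y) \<le> norm y * 1" using bound by simp
  qed
  then show ?thesis using fI[OF xM] bound by blast
qed

section \<open>Contour integrals in complex Banach spaces\<close>

text \<open>In the product norm, multiplication by a unimodular number need not be isometric, so the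
  scaling is only required to be bounded bilinear, with an unspecified constant.\<close>

locale complex_scaling = bounded_bilinear sc for sc :: "complex \<Rightarrow> 'a::banach \<Rightarrow> 'a" +
  assumes sc_sc: "sc a (sc b x) = sc (a * b) x"
    and sc_of_real: "sc (of_real r) x = r *\<^sub>R x"
begin

definition complex_functional :: "('a \<Rightarrow> complex) \<Rightarrow> bool" where
  "complex_functional \<Phi> \<longleftrightarrow> bounded_linear \<Phi> \<and> (\<forall>a x. \<Phi> (sc a x) = a * \<Phi> x)"

definition complex_differentiable_on :: "(complex \<Rightarrow> 'a) \<Rightarrow> complex set \<Rightarrow> bool" where
  "complex_differentiable_on F W \<longleftrightarrow> (\<forall>z\<in>W. \<exists>D. (F has_derivative (\<lambda>h. sc h D)) (at z))"

definition path_integral :: "(real \<Rightarrow> complex) \<Rightarrow> (complex \<Rightarrow> 'a) \<Rightarrow> 'a" where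
  "path_integral \<gamma> F = integral {0..1} (\<lambda>t. sc (vector_derivative \<gamma> (at t within {0..1})) (F (\<gamma> t)))"

text \<open>\<open>integrable_on\<close> refers to the gauge integral, which need not converge
  absolutely; this is what admits curves of infinite length.\<close>

definition path_integrable :: "(real \<Rightarrow> complex) \<Rightarrow> (complex \<Rightarrow> 'a) \<Rightarrow> bool" where
  "path_integrable \<gamma> F \<longleftrightarrow> (\<lambda>t. sc (vector_derivative \<gamma> (at t within {0..1})) (F (\<gamma> t))) integrable_on {0..1}"

section \<open>Testing by complex-linear functionals\<close>

lemma sc_one [simp]: "sc 1 x = x" using sc_of_real[of 1 x] by simp

text \<open>A real norming functional \<open>f\<close> of \<open>x - y\<close> is the real part of a
  complex-linear one, whose imaginary part at \<open>u\<close> is forced to be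
  \<open>- f (sc \<i> u)\<close>. Its value at \<open>x - y\<close> is then nonzero.\<close>

lemma complex_functionals_separate:
  assumes "\<And>\<Phi>. complex_functional \<Phi> \<Longrightarrow> \<Phi> x = \<Phi> y"
  shows "x = y"
proof (rule ccontr)
  assume "x \<noteq> y"
  obtain f where f: "bounded_linear f" "f (x - y) = norm (x - y)"
    using exists_norming_functional by blast
  interpret f: bounded_linear f by fact
  define \<Phi> where "\<Phi> u = of_real (f u) - \<i> * of_real (f (sc \<i> u))" for u
  have blsc: "bounded_linear (\<lambda>u. f (sc \<i> u))"
    by (rule bounded_linear_compose[OF f(1) bounded_linear_right])
  have "bounded_linear \<Phi>" unfolding \<Phi>_def
    by (intro bounded_linear_sub bounded_linear_compose[OF bounded_linear_of_real] f(1) blsc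
        bounded_linear_compose[OF bounded_linear_mult_right])
  moreover have "\<Phi> (sc a u) = a * \<Phi> u" for a u
  proof -
    have a: "a = of_real (Re a) + of_real (Im a) * \<i>" by (simp add: complex_eq mult.commute)
    have re: "sc a u = Re a *\<^sub>R u + Im a *\<^sub>R sc \<i> u"
      by (subst a) (simp add: add_left sc_of_real flip: sc_sc)
    have "sc \<i> (sc \<i> u) = - u" using sc_of_real[of "-1" u] by (simp add: sc_sc)
    then have im: "sc \<i> (sc a u) = Re a *\<^sub>R sc \<i> u - Im a *\<^sub>R u"
      unfolding re by (simp add: add_right scaleR_right)
    have "\<Phi> (sc a u) = (Re a * f u + Im a * f (sc \<i> u)) - \<i> * (Re a * f (sc \<i> u) - Im a * f u)"
      unfolding \<Phi>_def im unfolding re by (simp add: f.add f.diff f.scaleR)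
    also have "\<dots> = a * \<Phi> u" by (simp add: \<Phi>_def complex_eq_iff algebra_simps)
    finally show ?thesis .
  qed
  ultimately have "\<Phi> x = \<Phi> y" by (intro assms) (simp add: complex_functional_def)
  then have "Re (\<Phi> x) = Re (\<Phi> y)" by simp
  then show False using f(2) \<open>x \<noteq> y\<close> by (simp add: \<Phi>_def f.diff)
qed

lemma complex_differentiable_on_subset:
  "complex_differentiable_on F W \<Longrightarrow> V \<subseteq> W \<Longrightarrow> complex_differentiable_on F V"
  by (auto simp: complex_differentiable_on_def)

lemma complex_differentiable_on_imp_continuous:
  "complex_differentiable_on F W \<Longrightarrow> continuous_on W F"
  by (auto simp: complex_differentiable_on_def intro!: continuous_at_imp_continuous_on dest!: has_derivative_continuous)

lemma holomorphic_on_functional: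
  assumes "complex_differentiable_on F W" "complex_functional \<Phi>"
  shows "(\<lambda>z. \<Phi> (F z)) holomorphic_on W"
proof (rule holomorphic_onI)
  fix z assume "z \<in> W"
  then obtain D where D: "(F has_derivative (\<lambda>h. sc h D)) (at z)"
    using assms by (auto simp: complex_differentiable_on_def)
  have \<Phi>: "bounded_linear \<Phi>" "\<Phi> (sc h x) = h * \<Phi> x" for h x
    using assms(2) by (auto simp: complex_functional_def)
  have "((\<lambda>z. \<Phi> (F z)) has_derivative (\<lambda>h. \<Phi> D * h)) (at z)"
    using bounded_linear.has_derivative[OF \<Phi>(1) D] by (simp add: \<Phi>(2) mult.commute)
  then show "(\<lambda>z. \<Phi> (F z)) field_differentiable at z within W"
    by (meson field_differentiable_def has_field_derivative_def field_differentiable_at_within)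
qed

lemma has_contour_integral_functional:
  assumes "path_integrable \<gamma> F" "complex_functional \<Phi>"
  shows "((\<lambda>z. \<Phi> (F z)) has_contour_integral \<Phi> (path_integral \<gamma> F)) \<gamma>"
proof -
  have \<Phi>: "bounded_linear \<Phi>" "\<Phi> (sc h x) = h * \<Phi> x" for h x
    using assms(2) by (auto simp: complex_functional_def)
  have "((\<lambda>t. \<Phi> (sc (vector_derivative \<gamma> (at t within {0..1})) (F (\<gamma> t)))) has_integral \<Phi> (path_integral \<gamma> F)) {0..1}"
    using has_integral_linear[OF integrable_integral \<Phi>(1)] assms(1)
    by (simp add: path_integrable_def path_integral_def o_def)
  then show ?thesis by (simp add: has_contour_integral_def \<Phi>(2) mult.commute)
qed

section \<open>Local primitives and integrability along paths\<close>

lemma path_integrable_linepath: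
  assumes "continuous_on (closed_segment a b) F"
  shows "path_integrable (linepath a b) F"
proof -
  have "continuous_on {0..1} (\<lambda>t. F (linepath a b t))"
    by (rule continuous_on_compose2[OF assms]) (auto simp: linepath_in_path intro: continuous_on_linepath)
  then have "(\<lambda>t. sc (b - a) (F (linepath a b t))) integrable_on {0..1}"
    by (intro integrable_continuous_real continuous_on continuous_on_const)
  then show ?thesis unfolding path_integrable_def
    by (rule integrable_eq) (simp add: vector_derivative_linepath_within)
qed

text \<open>Every functional turns the claim into Cauchy's theorem for a triangle. In this form it
  says that increments of the segment integral from a fixed point are segment integrals
  again.\<close>

lemma path_integral_triangle:
  assumes F: "complex_differentiable_on F W" and hull: "convex hull {a, b, c} \<subseteq> W"
  shows "path_integral (linepath a b) F + path_integral (linepath b c) F = path_integral (linepath a c) F"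
proof (rule complex_functionals_separate)
  fix \<Phi> assume \<Phi>: "complex_functional \<Phi>"
  interpret \<Phi>: bounded_linear \<Phi> using \<Phi> by (simp add: complex_functional_def)
  have seg: "closed_segment a b \<subseteq> W" "closed_segment b c \<subseteq> W" "closed_segment a c \<subseteq> W"
    by (rule subset_trans[OF _ hull], rule segments_subset_convex_hull)+
  have eq: "\<Phi> (path_integral (linepath x y) F) = contour_integral (linepath x y) (\<lambda>z. \<Phi> (F z))"
    if "closed_segment x y \<subseteq> W" for x y
    using has_contour_integral_functional[OF path_integrable_linepath \<Phi>]
      continuous_on_subset[OF complex_differentiable_on_imp_continuous[OF F] that]
    by (metis contour_integral_unique)
  have "(\<lambda>z. \<Phi> (F z)) holomorphic_on convex hull {a, b, c}"
    using holomorphic_on_functional[OF F \<Phi>] hull holomorphic_on_subset by blast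
  then have "((\<lambda>z. \<Phi> (F z)) has_contour_integral 0) (linepath a b +++ linepath b c +++ linepath c a)"
    by (rule Cauchy_theorem_triangle)
  then have "contour_integral (linepath a b) (\<lambda>z. \<Phi> (F z)) + contour_integral (linepath b c) (\<lambda>z. \<Phi> (F z))
      + contour_integral (linepath c a) (\<lambda>z. \<Phi> (F z)) = 0"
    by (rule has_chain_integral_chain_integral3)
  moreover have "contour_integral (linepath c a) (\<lambda>z. \<Phi> (F z)) = - contour_integral (linepath a c) (\<lambda>z. \<Phi> (F z))"
    by (rule contour_integral_reverse_linepath)
      (use holomorphic_on_functional[OF F \<Phi>] seg holomorphic_on_imp_continuous_on continuous_on_subset
        closed_segment_commute in metis)
  ultimately show "\<Phi> (path_integral (linepath a b) F + path_integral (linepath b c) F) = \<Phi> (path_integral (linepath a c) F)"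
    by (simp add: \<Phi>.add eq[OF seg(1)] eq[OF seg(2)] eq[OF seg(3)])
qed

lemma path_integral_linepath_approx:
  assumes con: "continuous_on (closed_segment z w) F"
    and e: "\<And>u. u \<in> closed_segment z w \<Longrightarrow> norm (F u - y) \<le> e"
    and K: "\<And>a x. norm (sc a x) \<le> norm a * norm x * K" "K \<ge> 0"
  shows "norm (path_integral (linepath z w) F - sc (w - z) y) \<le> norm (w - z) * e * K"
proof -
  have int: "(\<lambda>t. sc (w - z) (F (linepath z w t))) integrable_on {0..1}"
    using path_integrable_linepath[OF con] unfolding path_integrable_def
    by (rule integrable_eq) (simp add: vector_derivative_linepath_within)
  have "path_integral (linepath z w) F = integral {0..1} (\<lambda>t. sc (w - z) (F (linepath z w t)))"
    unfolding path_integral_def by (rule integral_cong) (simp add: vector_derivative_linepath_within)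
  then have "((\<lambda>t. sc (w - z) (F (linepath z w t)) - sc (w - z) y) has_integral
      path_integral (linepath z w) F - sc (w - z) y) {0..1}"
    using has_integral_diff[OF integrable_integral[OF int] has_integral_const_real[of "sc (w - z) y" 0 1]] by simp
  then have "norm (path_integral (linepath z w) F - sc (w - z) y) \<le> norm (w - z) * e * K * measure lborel (cbox 0 (1::real))"
  proof (intro has_integral_bound)
    have "0 \<le> e" using e[of z] norm_ge_zero order_trans by (metis ends_in_segment(1))
    then show "0 \<le> norm (w - z) * e * K" using K by simp
    fix t :: real assume t: "t \<in> cbox 0 1"
    have "norm (sc (w - z) (F (linepath z w t) - y)) \<le> norm (w - z) * norm (F (linepath z w t) - y) * K"
      by (rule K)
    also have "\<dots> \<le> norm (w - z) * e * K"
      using t K(2) by (intro mult_right_mono mult_left_mono e) (auto intro: linepath_in_path)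
    finally show "norm (sc (w - z) (F (linepath z w t)) - sc (w - z) y) \<le> norm (w - z) * e * K"
      by (simp add: diff_right)
  qed simp
  then show ?thesis by simp
qed

text \<open>The primitive is the integral along the segment from the centre. Convexity keeps the
  triangles inside the ball, and continuity of \<open>F\<close> at \<open>z\<close> identifies the
  derivative.\<close>

lemma local_primitive:
  assumes F: "complex_differentiable_on F (ball a r)"
  obtains G where "\<And>z. z \<in> ball a r \<Longrightarrow> (G has_derivative (\<lambda>h. sc h (F z))) (at z)"
proof
  fix z assume z: "z \<in> ball a r"
  have a: "a \<in> ball a r" using z by (metis centre_in_ball mem_ball dist_self le_less_trans zero_le_dist)
  obtain K where K: "K > 0" "\<And>a x. norm (sc a x) \<le> norm a * norm x * K" using pos_bounded by blast
  have con: "continuous_on (ball a r) F" by (rule complex_differentiable_on_imp_continuous[OF F])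
  show "((\<lambda>w. path_integral (linepath a w) F) has_derivative (\<lambda>h. sc h (F z))) (at z)"
    unfolding has_derivative_at_alt
  proof (intro conjI allI impI bounded_linear_left)
    fix e :: real assume "e > 0"
    \<comment> \<open>Dividing by \<open>K\<close> cancels the bilinear constant in the segment
      estimate.\<close>
    then have "e / K > 0" using K by simp
    then obtain d1 where d1: "d1 > 0" "\<And>u. u \<in> ball a r \<Longrightarrow> dist u z < d1 \<Longrightarrow> dist (F u) (F z) < e / K"
      using con z unfolding continuous_on_iff by meson
    obtain d2 where d2: "d2 > 0" "ball z d2 \<subseteq> ball a r" using openE[OF open_ball z] by blast
    have "norm (path_integral (linepath a w) F - path_integral (linepath a z) F - sc (w - z) (F z)) \<le> e * norm (w - z)"
      if w: "norm (w - z) < min d1 d2" for w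
    proof -
      have "w \<in> ball z d2" using w by (simp add: dist_norm norm_minus_commute)
      then have wb: "w \<in> ball a r" using d2 by blast
      have "convex hull {a, z, w} \<subseteq> ball a r" using a z wb by (intro hull_minimal) auto
      then have "path_integral (linepath a w) F - path_integral (linepath a z) F = path_integral (linepath z w) F"
        using path_integral_triangle[OF F, of a z w] by (simp add: algebra_simps)
      moreover have "norm (path_integral (linepath z w) F - sc (w - z) (F z)) \<le> norm (w - z) * (e / K) * K"
      proof (rule path_integral_linepath_approx)
        have seg: "closed_segment z w \<subseteq> ball a r" using z wb by (simp add: closed_segment_subset)
        then show "continuous_on (closed_segment z w) F" using con continuous_on_subset by blast
        fix u assume u: "u \<in> closed_segment z w"
        then have "dist u z < d1" using segment_bound(1)[OF u] w by (simp add: dist_norm)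
        then show "norm (F u - F z) \<le> e / K" using d1(2)[of u] seg u by (force simp: dist_norm)
      qed (use K in auto)
      ultimately show ?thesis using K by (simp add: mult.commute)
    qed
    then show "\<exists>d>0. \<forall>w. norm (w - z) < d \<longrightarrow>
        norm (path_integral (linepath a w) F - path_integral (linepath a z) F - sc (w - z) (F z)) \<le> e * norm (w - z)"
      using d1(1) d2(1) by (intro exI[of _ "min d1 d2"]) auto
  qed
qed

text \<open>Near each parameter \<open>t0\<close> the curve stays in a ball on which
  \<open>F\<close> has a primitive \<open>G\<close>, so \<open>G \<circ> \<gamma>\<close> is an
  antiderivative of the integrand off a finite set. The fundamental theorem for the gauge integral
  then gives integrability without any bound on the velocity, and integrability on small
  subintervals implies it on \<open>{0..1}\<close>.\<close>

lemma path_integrable_valid_path: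
  assumes F: "complex_differentiable_on F W" and op: "open W"
    and vp: "valid_path \<gamma>" and img: "path_image \<gamma> \<subseteq> W"
  shows "path_integrable \<gamma> F"
proof -
  obtain S where S: "finite S" "\<gamma> C1_differentiable_on {0..1} - S" and con: "continuous_on {0..1} \<gamma>"
    using vp by (auto simp: valid_path_def piecewise_C1_differentiable_on_def)
  let ?f = "\<lambda>t. sc (vector_derivative \<gamma> (at t within {0..1})) (F (\<gamma> t))"
  have "\<exists>d>0. \<forall>u v. t0 \<in> cbox u v \<and> cbox u v \<subseteq> ball t0 d \<and> cbox u v \<subseteq> cbox 0 1 \<longrightarrow> ?f integrable_on cbox u v"
    if t0: "t0 \<in> cbox 0 1" for t0
  proof -
    have "\<gamma> t0 \<in> W" using t0 img by (auto simp: path_image_def)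
    then obtain r where r: "r > 0" "ball (\<gamma> t0) r \<subseteq> W" using openE[OF op] by blast
    obtain G where G: "\<And>z. z \<in> ball (\<gamma> t0) r \<Longrightarrow> (G has_derivative (\<lambda>h. sc h (F z))) (at z)"
      using local_primitive[OF complex_differentiable_on_subset[OF F r(2)]] by blast
    obtain d where d: "d > 0" "\<And>t. t \<in> {0..1} \<Longrightarrow> dist t t0 < d \<Longrightarrow> dist (\<gamma> t) (\<gamma> t0) < r"
      using con t0 r(1) unfolding continuous_on_iff by (metis box_real(2))
    have "?f integrable_on {u..v}" if uv: "t0 \<in> {u..v}" "{u..v} \<subseteq> ball t0 d" "{u..v} \<subseteq> {0..1}" for u v
    proof -
      have ball: "\<gamma> t \<in> ball (\<gamma> t0) r" if "t \<in> {u..v}" for t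
        using d(2)[of t] uv(2,3) that by (force simp: dist_commute)
      have cG: "continuous_on (ball (\<gamma> t0) r) G"
        using G has_derivative_continuous by (blast intro: continuous_at_imp_continuous_on)
      have "(?f has_integral (G (\<gamma> v) - G (\<gamma> u))) {u..v}"
      proof (rule fundamental_theorem_of_calculus_interior_strong[OF S(1)])
        show "u \<le> v" using uv(1) by simp
        show "continuous_on {u..v} (\<lambda>t. G (\<gamma> t))"
          by (rule continuous_on_compose2[OF cG continuous_on_subset[OF con uv(3)]]) (use ball in blast)
        fix t assume t: "t \<in> {u<..<v} - S"
        have t01: "0 < t" "t < 1"
          using t uv by (auto dest!: atLeastatMost_subset_iff[THEN iffD1])
        then have "\<gamma> differentiable at t" using S(2) t by (auto simp: C1_differentiable_on_eq)
        then have "(\<gamma> has_vector_derivative vector_derivative \<gamma> (at t)) (at t)"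
          by (simp add: vector_derivative_works)
        then have "(\<gamma> has_derivative (\<lambda>h. h *\<^sub>R vector_derivative \<gamma> (at t))) (at t)"
          by (simp add: has_vector_derivative_def)
        from has_derivative_compose[OF this G[OF ball]] t
        have "((\<lambda>t. G (\<gamma> t)) has_derivative (\<lambda>h. sc (h *\<^sub>R vector_derivative \<gamma> (at t)) (F (\<gamma> t)))) (at t)"
          by simp
        then show "((\<lambda>t. G (\<gamma> t)) has_vector_derivative ?f t) (at t)"
          using t01 by (simp add: has_vector_derivative_def scaleR_left at_within_Icc_at)
      qed
      then show ?thesis by blast
    qed
    then show ?thesis using d(1) by (intro exI[of _ d]) auto
  qed
  then show ?thesis unfolding path_integrable_def
    using integrable_on_little_subintervals[of 0 1 ?f] by simp
qed

theorem path_integral_chain_zero: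
  fixes c :: "'i \<Rightarrow> complex" and \<gamma> :: "'i \<Rightarrow> real \<Rightarrow> complex"
  assumes op: "open W" and F: "complex_differentiable_on F W" and fin: "finite I"
    and vp: "\<And>i. i \<in> I \<Longrightarrow> valid_path (\<gamma> i)"
    and img: "\<And>i. i \<in> I \<Longrightarrow> path_image (\<gamma> i) \<subseteq> W"
    and loop: "\<And>i. i \<in> I \<Longrightarrow> pathfinish (\<gamma> i) = pathstart (\<gamma> i)"
    and zero: "\<And>w. w \<notin> W \<Longrightarrow> (\<Sum>i\<in>I. c i * winding_number (\<gamma> i) w) = 0"
  shows "(\<Sum>i\<in>I. sc (c i) (path_integral (\<gamma> i) F)) = 0"
proof (rule complex_functionals_separate)
  fix \<Phi> assume \<Phi>: "complex_functional \<Phi>"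
  interpret \<Phi>: bounded_linear \<Phi> using \<Phi> by (simp add: complex_functional_def)
  have "\<Phi> (\<Sum>i\<in>I. sc (c i) (path_integral (\<gamma> i) F)) = (\<Sum>i\<in>I. c i * contour_integral (\<gamma> i) (\<lambda>z. \<Phi> (F z)))"
    unfolding \<Phi>.sum
  proof (intro sum.cong refl)
    fix i assume i: "i \<in> I"
    have "contour_integral (\<gamma> i) (\<lambda>z. \<Phi> (F z)) = \<Phi> (path_integral (\<gamma> i) F)"
      by (intro contour_integral_unique has_contour_integral_functional path_integrable_valid_path[OF F op] vp img i \<Phi>)
    then show "\<Phi> (sc (c i) (path_integral (\<gamma> i) F)) = c i * contour_integral (\<gamma> i) (\<lambda>z. \<Phi> (F z))"
      using \<Phi> by (simp add: complex_functional_def)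
  qed
  also have "\<dots> = 0"
    by (rule Cauchy_theorem_chain[OF op holomorphic_on_functional[OF F \<Phi>] fin vp img loop zero])
  finally show "\<Phi> (\<Sum>i\<in>I. sc (c i) (path_integral (\<gamma> i) F)) = \<Phi> 0" by (simp add: \<Phi>.zero)
qed

lemma path_integral_chain_eq:
  fixes c :: "'i \<Rightarrow> complex" and \<gamma> :: "'i \<Rightarrow> real \<Rightarrow> complex"
    and d :: "'j \<Rightarrow> complex" and \<delta> :: "'j \<Rightarrow> real \<Rightarrow> complex"
  assumes op: "open W" and F: "complex_differentiable_on F W" and fin: "finite I" "finite J"
    and \<gamma>: "\<And>i. i \<in> I \<Longrightarrow> valid_path (\<gamma> i) \<and> path_image (\<gamma> i) \<subseteq> W \<and> pathfinish (\<gamma> i) = pathstart (\<gamma> i)"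
    and \<delta>: "\<And>j. j \<in> J \<Longrightarrow> valid_path (\<delta> j) \<and> path_image (\<delta> j) \<subseteq> W \<and> pathfinish (\<delta> j) = pathstart (\<delta> j)"
    and eq: "\<And>w. w \<notin> W \<Longrightarrow>
      (\<Sum>i\<in>I. c i * winding_number (\<gamma> i) w) = (\<Sum>j\<in>J. d j * winding_number (\<delta> j) w)"
  shows "(\<Sum>i\<in>I. sc (c i) (path_integral (\<gamma> i) F)) = (\<Sum>j\<in>J. sc (d j) (path_integral (\<delta> j) F))"
proof -
  \<comment> \<open>The disjoint sum of the index sets keeps a curve that occurs in both families as
    two separate entries.\<close>
  define k where "k = case_sum c (\<lambda>j. - d j)"
  define \<eta> where "\<eta> = case_sum \<gamma> \<delta>"
  have "(\<Sum>i\<in>I <+> J. sc (k i) (path_integral (\<eta> i) F)) = 0"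
  proof (rule path_integral_chain_zero[OF op F])
    fix i assume "i \<in> I <+> J"
    then show "valid_path (\<eta> i)" "path_image (\<eta> i) \<subseteq> W" "pathfinish (\<eta> i) = pathstart (\<eta> i)"
      using \<gamma> \<delta> by (elim PlusE; simp add: \<eta>_def)+
  qed (use eq fin in \<open>simp_all add: k_def \<eta>_def sum.Plus sum_negf\<close>)
  then show ?thesis using fin by (simp add: k_def \<eta>_def sum.Plus minus_left sum_negf)
qed

section \<open>Path integrals under linear and conjugate-linear maps\<close>

lemma path_integral_add:
  assumes "path_integrable \<gamma> F" "path_integrable \<gamma> G"
  shows "path_integral \<gamma> (\<lambda>z. F z + G z) = path_integral \<gamma> F + path_integral \<gamma> G"
  using assms by (simp add: path_integral_def path_integrable_def add_right integral_add)

lemma path_integral_linear: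
  assumes L: "bounded_linear L" "\<And>a x. L (sc a x) = sc a (L x)" and F: "path_integrable \<gamma> F"
  shows "path_integral \<gamma> (\<lambda>z. L (F z)) = L (path_integral \<gamma> F)"
  using integral_linear[OF F[unfolded path_integrable_def] L(1)]
  by (simp add: path_integral_def o_def L(2))

text \<open>This transfers a linear condition from the values of \<open>F\<close> to the integral.
  Since \<open>L\<close> need not commute with \<open>sc\<close>, the condition is asked for all
  multiples \<open>sc a (F z)\<close>, with \<open>a\<close> in the role of the velocity.\<close>

lemma path_integral_in_kernel:
  assumes L: "bounded_linear L" and F: "path_integrable \<gamma> F"
    and zero: "\<And>a z. z \<in> path_image \<gamma> \<Longrightarrow> L (sc a (F z)) = 0"
  shows "L (path_integral \<gamma> F) = 0"
proof -
  have "L (path_integral \<gamma> F) = integral {0..1} (\<lambda>t. L (sc (vector_derivative \<gamma> (at t within {0..1})) (F (\<gamma> t))))"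
    using integral_linear[OF F[unfolded path_integrable_def] L] by (simp add: path_integral_def o_def)
  also have "\<dots> = integral {0..1} (\<lambda>t::real. 0)"
    by (rule integral_cong) (simp add: zero path_image_def)
  finally show ?thesis by simp
qed

lemma path_integral_cong:
  assumes "\<And>z. z \<in> path_image \<gamma> \<Longrightarrow> F z = G z"
  shows "path_integral \<gamma> F = path_integral \<gamma> G"
  unfolding path_integral_def by (rule integral_cong) (simp add: assms path_image_def)

text \<open>Reflecting the curve conjugates its velocity, and a conjugate-linear \<open>L\<close>
  produces the same conjugate when it is moved under the integral.\<close>

lemma path_integral_conjugate:
  assumes vp: "valid_path \<gamma>" and F: "path_integrable \<gamma> F"
    and L: "bounded_linear L" "\<And>a x. L (sc a x) = sc (cnj a) (L x)"
    and G: "\<And>z. z \<in> path_image \<gamma> \<Longrightarrow> G (cnj z) = L (F z)"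
  shows "path_integral (cnj \<circ> \<gamma>) G = L (path_integral \<gamma> F)"
proof -
  obtain S where S: "finite S" "\<gamma> C1_differentiable_on {0..1} - S"
    using vp by (auto simp: valid_path_def piecewise_C1_differentiable_on_def)
  have "L (path_integral \<gamma> F) = integral {0..1} (\<lambda>t. L (sc (vector_derivative \<gamma> (at t within {0..1})) (F (\<gamma> t))))"
    using integral_linear[OF F[unfolded path_integrable_def] L(1)] by (simp add: path_integral_def o_def)
  also have "\<dots> = integral {0..1} (\<lambda>t. sc (vector_derivative (cnj \<circ> \<gamma>) (at t within {0..1})) (G ((cnj \<circ> \<gamma>) t)))"
  \<comment> \<open>Discarded are the parameters where \<open>\<gamma>\<close> may fail to be
    differentiable and the end points, where the derivative is one-sided.\<close>
  proof (rule integral_spike[of "S \<union> {0, 1}"])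
    show "negligible (S \<union> {0, 1})" using S(1) by (simp add: negligible_finite)
    fix t assume t: "t \<in> {0..1} - (S \<union> {0, 1})"
    then have "\<gamma> differentiable at t" using S(2) by (auto simp: C1_differentiable_on_eq)
    then have "vector_derivative (\<lambda>x. cnj (\<gamma> x)) (at t) = cnj (vector_derivative \<gamma> (at t))"
      by (rule vector_derivative_cnj)
    moreover have "at t within {0..1} = at t" using t by (intro at_within_Icc_at) auto
    ultimately show "sc (vector_derivative (cnj \<circ> \<gamma>) (at t within {0..1})) (G ((cnj \<circ> \<gamma>) t))
        = L (sc (vector_derivative \<gamma> (at t within {0..1})) (F (\<gamma> t)))"
      using G[of "\<gamma> t"] t by (simp add: L(2) o_def path_image_def)
  qed
  finally show ?thesis by (simp add: path_integral_def)
qed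

end

section \<open>The complex Banach space of operators\<close>

text \<open>Multiplication by \<open>\<i>\<close> is the isometry
  \<open>(x, y) \<mapsto> (- y, x)\<close> of the product norm, so the factor is
  \<open>\<bar>Re z\<bar> + \<bar>Im z\<bar>\<close>. The crude bound \<open>2 * norm z\<close> for
  it is the source of the constant 2 in the operator estimates.\<close>

lemma norm_cscale_le: "norm (cscale z p) \<le> 2 * norm z * norm p"
proof -
  have "cscale z p = Re z *\<^sub>R p + Im z *\<^sub>R (- snd p, fst p)"
    by (simp add: cscale_def prod_eq_iff)
  also have "norm \<dots> \<le> \<bar>Re z\<bar> * norm p + \<bar>Im z\<bar> * norm (- snd p, fst p)"
    using norm_triangle_ineq[of "Re z *\<^sub>R p" "Im z *\<^sub>R (- snd p, fst p)"] by (simp only: norm_scaleR)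
  also have "norm (- snd p, fst p) = norm p" by (simp add: norm_prod_def add.commute)
  also have "\<bar>Re z\<bar> * norm p + \<bar>Im z\<bar> * norm p \<le> norm z * norm p + norm z * norm p"
    by (intro add_mono mult_right_mono abs_Re_le_cmod abs_Im_le_cmod norm_ge_zero)
  finally show ?thesis by simp
qed

lemma norm_op_cscale_le: "norm (op_cscale z S) \<le> norm z * norm S * 2"
proof (rule norm_blinfun_bound)
  fix p
  have "norm (cscale z (S p)) \<le> 2 * norm z * norm (S p)" by (rule norm_cscale_le)
  also have "\<dots> \<le> 2 * norm z * (norm S * norm p)" by (intro mult_left_mono norm_blinfun) simp
  finally show "norm (blinfun_apply (op_cscale z S) p) \<le> norm z * norm S * 2 * norm p"
    by (simp add: op_cscale.rep_eq mult_ac)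
qed simp

interpretation cop: complex_scaling "op_cscale :: complex \<Rightarrow> 'v::banach cop \<Rightarrow> 'v cop"
proof
  fix a b r and S R :: "'v cop"
  show "op_cscale (a + b) S = op_cscale a S + op_cscale b S"
    "op_cscale a (S + R) = op_cscale a S + op_cscale a R"
    "op_cscale (r *\<^sub>R a) S = r *\<^sub>R op_cscale a S"
    "op_cscale a (r *\<^sub>R S) = r *\<^sub>R op_cscale a S"
    "op_cscale a (op_cscale b S) = op_cscale (a * b) S"
    "op_cscale (of_real r) S = r *\<^sub>R S"
    by (rule blinfun_eqI; simp add: op_cscale.rep_eq cscale_def blinfun.bilinear_simps prod_eq_iff algebra_simps)+
  show "\<exists>K. \<forall>a (S :: 'v cop). norm (op_cscale a S) \<le> norm a * norm S * K"
    using norm_op_cscale_le by blast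
qed

lemma op_analytic_on_eq: "op_analytic_on = cop.complex_differentiable_on"
  by (intro ext) (simp add: op_analytic_on_def cop.complex_differentiable_on_def)

lemma op_contour_integral_eq: "op_contour_integral = cop.path_integral"
  by (intro ext) (simp add: op_contour_integral_def cop.path_integral_def)

lemma op_cscale_compose_left: "op_cscale z A o\<^sub>L B = op_cscale z (A o\<^sub>L B)"
  by (rule blinfun_eqI) (simp add: op_cscale.rep_eq)

lemma clinear_ops_apply: "A \<in> clinear_ops \<Longrightarrow> A (cscale z p) = cscale z (A p)"
  unfolding clinear_ops_def by blast

lemma op_cscale_compose_right: "A \<in> clinear_ops \<Longrightarrow> A o\<^sub>L op_cscale z B = op_cscale z (A o\<^sub>L B)"
  by (rule blinfun_eqI) (simp add: op_cscale.rep_eq clinear_ops_apply)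

lemma complexify_compose: "complexify (A o\<^sub>L B) = complexify A o\<^sub>L complexify B"
  by (rule blinfun_eqI) (simp add: complexify.rep_eq)

lemma complexify_id: "complexify id_blinfun = id_blinfun"
  by (rule blinfun_eqI) (simp add: complexify.rep_eq)

lemma complexify_add: "complexify (A + B) = complexify A + complexify B"
  by (rule blinfun_eqI) (simp add: complexify.rep_eq blinfun.add_left)

lemma complexify_clinear: "complexify A \<in> clinear_ops"
  by (simp add: clinear_ops_def complexify.rep_eq cscale_def blinfun.bilinear_simps)

lemma id_clinear: "id_blinfun \<in> clinear_ops"
  by (simp add: clinear_ops_def)

lemma cscale_add: "cscale z (p + q) = cscale z p + cscale z q"
  by (simp add: cscale_def algebra_simps)

lemma cscale_cscale: "cscale a (cscale b p) = cscale (a * b) p"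
  by (simp add: cscale_def algebra_simps)

lemma clinear_ops_compose: "A \<in> clinear_ops \<Longrightarrow> B \<in> clinear_ops \<Longrightarrow> A o\<^sub>L B \<in> clinear_ops"
  by (simp add: clinear_ops_def del: split_paired_All)

lemma clinear_ops_cscale: "A \<in> clinear_ops \<Longrightarrow> op_cscale z A \<in> clinear_ops"
  by (simp add: clinear_ops_def op_cscale.rep_eq cscale_cscale mult.commute)

lemma clinear_ops_diff: "A \<in> clinear_ops \<Longrightarrow> B \<in> clinear_ops \<Longrightarrow> A - B \<in> clinear_ops"
  by (simp add: clinear_ops_def blinfun.diff_left cscale_def algebra_simps)

section \<open>Resolvents\<close>

lemma id_blinfun_compose [simp]: "id_blinfun o\<^sub>L A = A" "A o\<^sub>L id_blinfun = A"
  by (rule blinfun_eqI; simp)+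

lemma blinfun_compose_assoc: "A o\<^sub>L B o\<^sub>L C = A o\<^sub>L (B o\<^sub>L C)"
  by (rule blinfun_eqI) simp

lemma norm_op_power_le: "norm (op_power E k) \<le> norm E ^ k"
proof (induction k)
  case 0
  show ?case by (simp add: norm_blinfun_id_le)
next
  case (Suc k)
  have "norm (E o\<^sub>L op_power E k) \<le> norm E * norm (op_power E k)" by (rule norm_blinfun_compose)
  also have "\<dots> \<le> norm E * norm E ^ k" using Suc by (intro mult_left_mono) auto
  finally show ?case by simp
qed

lemma op_power_commute: "op_power E k o\<^sub>L E = E o\<^sub>L op_power E k"
  by (induction k) (simp_all add: blinfun_compose_assoc)

text \<open>Splitting off the first term of the Neumann series gives
  \<open>C = id_blinfun + (E o\<^sub>L C)\<close>, and the same with \<open>E\<close> on the right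
  because \<open>E\<close> commutes with its powers.\<close>

lemma neumann_inverse:
  fixes E :: "'a::banach \<Rightarrow>\<^sub>L 'a"
  assumes "norm E < 1"
  obtains C where "(id_blinfun - E) o\<^sub>L C = id_blinfun" "C o\<^sub>L (id_blinfun - E) = id_blinfun"
    "norm C \<le> 1 / (1 - norm E)"
proof
  define C where "C = (\<Sum>k. op_power E k)"
  have geo: "summable (\<lambda>k. norm E ^ k)" using assms by (simp add: summable_geometric)
  have nsum: "summable (\<lambda>k. norm (op_power E k))"
    by (rule summable_comparison_test'[OF geo, of 0]) (simp add: norm_op_power_le)
  then have sum: "summable (op_power E)" by (rule summable_norm_cancel)
  have split: "C = id_blinfun + (\<Sum>k. op_power E (Suc k))"
    unfolding C_def using suminf_split_head[OF sum] by simp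
  have "(\<Sum>k. op_power E (Suc k)) = E o\<^sub>L C" unfolding C_def
    using bounded_linear.suminf[OF bounded_bilinear.bounded_linear_right[OF bounded_bilinear_blinfun_compose] sum, of E]
    by simp
  then show "(id_blinfun - E) o\<^sub>L C = id_blinfun"
    using split by (simp add: bounded_bilinear.diff_left[OF bounded_bilinear_blinfun_compose])
  have "(\<Sum>k. op_power E (Suc k)) = C o\<^sub>L E" unfolding C_def
    using bounded_linear.suminf[OF bounded_bilinear.bounded_linear_left[OF bounded_bilinear_blinfun_compose] sum, of E]
    by (simp add: op_power_commute)
  then show "C o\<^sub>L (id_blinfun - E) = id_blinfun"
    using split by (simp add: bounded_bilinear.diff_right[OF bounded_bilinear_blinfun_compose])
  have "norm C \<le> (\<Sum>k. norm (op_power E k))" unfolding C_def by (rule summable_norm[OF nsum])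
  also have "\<dots> \<le> (\<Sum>k. norm E ^ k)" by (rule suminf_le[OF norm_op_power_le nsum geo])
  also have "\<dots> = 1 / (1 - norm E)" using assms by (simp add: suminf_geometric)
  finally show "norm C \<le> 1 / (1 - norm E)" .
qed

text \<open>\<open>A - E\<close> factors as
  \<open>A o\<^sub>L (id_blinfun - (B o\<^sub>L E))\<close>; as \<open>B o\<^sub>L E\<close> has
  norm at most 1/2, the second factor has a Neumann inverse of norm at most 2.\<close>

lemma neumann_perturbation:
  fixes A B E :: "'a::banach \<Rightarrow>\<^sub>L 'a"
  assumes AB: "A o\<^sub>L B = id_blinfun" "B o\<^sub>L A = id_blinfun" and small: "norm B * norm E \<le> 1 / 2"
  obtains C where "(A - E) o\<^sub>L C = id_blinfun" "C o\<^sub>L (A - E) = id_blinfun" "norm C \<le> 2 * norm B"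
proof -
  interpret comp: bounded_bilinear "(o\<^sub>L) :: ('a \<Rightarrow>\<^sub>L 'a) \<Rightarrow> _" by (rule bounded_bilinear_blinfun_compose)
  have BE: "norm (B o\<^sub>L E) \<le> 1 / 2" using norm_blinfun_compose[of B E] small by linarith
  then obtain C where C: "(id_blinfun - (B o\<^sub>L E)) o\<^sub>L C = id_blinfun" "C o\<^sub>L (id_blinfun - (B o\<^sub>L E)) = id_blinfun"
    "norm C \<le> 1 / (1 - norm (B o\<^sub>L E))" using neumann_inverse[of "B o\<^sub>L E"] by auto
  have fac: "A - E = A o\<^sub>L (id_blinfun - (B o\<^sub>L E))"
    using AB by (simp add: comp.diff_right blinfun_compose_assoc[symmetric])
  have "1 / (1 - norm (B o\<^sub>L E)) \<le> 2" using BE by (simp add: field_simps)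
  then have "norm C \<le> 2" using C(3) by linarith
  then have "norm (C o\<^sub>L B) \<le> 2 * norm B"
    using norm_blinfun_compose[of C B] mult_right_mono[of "norm C" 2 "norm B"] by force
  moreover have "(A - E) o\<^sub>L (C o\<^sub>L B) = A o\<^sub>L ((id_blinfun - (B o\<^sub>L E)) o\<^sub>L C) o\<^sub>L B"
    unfolding fac by (simp add: blinfun_compose_assoc)
  then have "(A - E) o\<^sub>L (C o\<^sub>L B) = id_blinfun" using C(1) AB by simp
  moreover have "(C o\<^sub>L B) o\<^sub>L (A - E) = C o\<^sub>L (B o\<^sub>L A) o\<^sub>L (id_blinfun - (B o\<^sub>L E))"
    unfolding fac by (simp add: blinfun_compose_assoc)
  then have "(C o\<^sub>L B) o\<^sub>L (A - E) = id_blinfun" using C(2) AB by simp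
  ultimately show ?thesis using that by blast
qed

text \<open>With \<open>Y\<close> a complex scaling this makes resolvents complex linear, with
  \<open>Y\<close> a right multiplication it makes them right linear.\<close>

lemma inverse_commutes:
  assumes "A o\<^sub>L R = id_blinfun" "R o\<^sub>L A = id_blinfun" "\<And>p. A (Y p) = Y (A p)"
  shows "R (Y p) = Y (R p)"
proof -
  have "A (R q) = q" "R (A q) = q" for q
    using assms(1,2) by (metis blinfun_apply_blinfun_compose blinfun_apply_id_blinfun id_apply)+
  then show ?thesis using assms(3) by metis
qed

lemma is_resolvent_iff:
  assumes "S \<in> clinear_ops"
  shows "is_resolvent S z R \<longleftrightarrow> (op_cscale z id_blinfun - S) o\<^sub>L R = id_blinfun \<and> R o\<^sub>L (op_cscale z id_blinfun - S) = id_blinfun"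
proof -
  have "op_cscale z id_blinfun - S \<in> clinear_ops"
    by (intro clinear_ops_diff clinear_ops_cscale id_clinear assms)
  then show ?thesis using inverse_commutes[of "op_cscale z id_blinfun - S" R "cscale _"]
    unfolding is_resolvent_def clinear_ops_def by auto
qed

section \<open>The resolvent set and analyticity of the resolvent\<close>

lemma is_resolvent_unique:
  assumes "is_resolvent S z R" "is_resolvent S z R'"
  shows "R = R'"
proof -
  let ?A = "op_cscale z id_blinfun - S"
  have "R = R o\<^sub>L (?A o\<^sub>L R')" using assms by (simp add: is_resolvent_def)
  also have "\<dots> = R o\<^sub>L ?A o\<^sub>L R'" by (simp add: blinfun_compose_assoc)
  also have "\<dots> = R'" using assms by (simp add: is_resolvent_def)
  finally show ?thesis .
qed

lemma resolvent_eqI: "is_resolvent S z R \<Longrightarrow> resolvent S z = R"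
  unfolding resolvent_def using is_resolvent_unique by blast

lemma is_resolvent_resolvent: "z \<notin> op_spectrum S \<Longrightarrow> is_resolvent S z (resolvent S z)"
  using resolvent_eqI by (auto simp: op_spectrum_def)

text \<open>Passing from \<open>z\<close> to \<open>w\<close> perturbs the operator by the
  multiplication with \<open>z - w\<close>. The threshold 1/4 is the 1/2 of
  \<open>neumann_perturbation\<close> divided by the constant 2 of
  \<open>norm_op_cscale_le\<close>.\<close>

lemma op_spectrum_perturbation:
  assumes S: "S \<in> clinear_ops" and z: "z \<notin> op_spectrum S" and w: "norm (resolvent S z) * norm (z - w) \<le> 1 / 4"
  shows "w \<notin> op_spectrum S" "norm (resolvent S w) \<le> 2 * norm (resolvent S z)"
proof -
  let ?R = "resolvent S z" and ?E = "op_cscale (z - w) id_blinfun :: 'a cop"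
  have R: "is_resolvent S z ?R" by (rule is_resolvent_resolvent[OF z])
  have "norm ?E \<le> norm (z - w) * norm (id_blinfun :: 'a cop) * 2" by (rule norm_op_cscale_le)
  also have "\<dots> \<le> norm (z - w) * 1 * 2" by (intro mult_right_mono mult_left_mono norm_blinfun_id_le) auto
  finally have "norm ?R * norm ?E \<le> norm ?R * (norm (z - w) * 1 * 2)" by (intro mult_left_mono) auto
  then have small: "norm ?R * norm ?E \<le> 1 / 2" using w by simp
  have R': "(op_cscale z id_blinfun - S) o\<^sub>L ?R = id_blinfun" "?R o\<^sub>L (op_cscale z id_blinfun - S) = id_blinfun"
    using R by (auto simp: is_resolvent_def)
  have "op_cscale z id_blinfun - S - ?E = op_cscale w id_blinfun - S" by (simp add: cop.diff_left)
  then obtain C where "is_resolvent S w C" "norm C \<le> 2 * norm ?R"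
    using neumann_perturbation[OF R' small] is_resolvent_iff[OF S] by metis
  then show "w \<notin> op_spectrum S" "norm (resolvent S w) \<le> 2 * norm ?R"
    using resolvent_eqI by (auto simp: op_spectrum_def)
qed

lemma op_spectrum_perturbation_ball:
  assumes "S \<in> clinear_ops" "z \<notin> op_spectrum S"
  obtains d where "d > 0" "\<And>w. norm (w - z) < d \<Longrightarrow>
    w \<notin> op_spectrum S \<and> norm (resolvent S w) \<le> 2 * norm (resolvent S z)"
proof
  let ?M = "norm (resolvent S z)"
  \<comment> \<open>The added 1 avoids a zero denominator when the resolvent is 0, as on the trivial
    space.\<close>
  show "1 / (4 * (?M + 1)) > 0" by (simp add: add_nonneg_pos)
  fix w assume w: "norm (w - z) < 1 / (4 * (?M + 1))"
  have "?M * norm (z - w) \<le> (?M + 1) * (1 / (4 * (?M + 1)))"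
    using w by (intro mult_mono) (auto simp: norm_minus_commute)
  also have "\<dots> = 1 / 4" by (simp add: add_nonneg_eq_0_iff)
  finally show "w \<notin> op_spectrum S \<and> norm (resolvent S w) \<le> 2 * ?M"
    using op_spectrum_perturbation[OF assms] by blast
qed

lemma closed_op_spectrum:
  assumes "S \<in> clinear_ops"
  shows "closed (op_spectrum S)"
proof -
  have "open (- op_spectrum S)"
  proof (rule openI)
    fix z assume "z \<in> - op_spectrum S"
    then obtain d where "d > 0" "\<And>w. norm (w - z) < d \<Longrightarrow> w \<notin> op_spectrum S"
      using op_spectrum_perturbation_ball[OF assms] by (metis ComplD)
    then show "\<exists>e>0. ball z e \<subseteq> - op_spectrum S"
      by (intro exI[of _ d]) (auto simp: dist_norm norm_minus_commute)
  qed
  then show ?thesis by (simp add: closed_def)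
qed

text \<open>The scalar \<open>w - z\<close> is the difference of the two operators that are
  inverted; it appears sandwiched between the two resolvents.\<close>

lemma resolvent_identity:
  assumes S: "S \<in> clinear_ops" and z: "z \<notin> op_spectrum S" and w: "w \<notin> op_spectrum S"
  shows "resolvent S z - resolvent S w = op_cscale (w - z) (resolvent S z o\<^sub>L resolvent S w)"
proof -
  interpret comp: bounded_bilinear "(o\<^sub>L) :: 'a cop \<Rightarrow> 'a cop \<Rightarrow> 'a cop" by (rule bounded_bilinear_blinfun_compose)
  let ?A = "\<lambda>z. op_cscale z id_blinfun - S"
  let ?R = "resolvent S"
  have Rz: "?R z o\<^sub>L ?A z = id_blinfun" "?R z \<in> clinear_ops" and Rw: "?A w o\<^sub>L ?R w = id_blinfun"
    using is_resolvent_resolvent[OF z] is_resolvent_resolvent[OF w] by (auto simp: is_resolvent_def)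
  have "?R z - ?R w = (?R z o\<^sub>L (?A w o\<^sub>L ?R w)) - (?R z o\<^sub>L ?A z o\<^sub>L ?R w)" by (simp add: Rz Rw)
  also have "\<dots> = ?R z o\<^sub>L (?A w - ?A z) o\<^sub>L ?R w"
    unfolding comp.diff_right[of "?R z" "?A w" "?A z"] comp.diff_left[of "?R z o\<^sub>L ?A w"] blinfun_compose_assoc ..
  also have "?A w - ?A z = op_cscale (w - z) id_blinfun" by (simp add: cop.diff_left)
  finally show ?thesis by (simp add: op_cscale_compose_right[OF Rz(2)] op_cscale_compose_left)
qed

text \<open>The derivative at \<open>z\<close> is minus the square of the resolvent. Using the
  resolvent identity twice leaves a remainder with the factor \<open>(z - w)^2\<close>, whose
  operator part is bounded near \<open>z\<close>.\<close>

lemma op_analytic_on_resolvent: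
  assumes S: "S \<in> clinear_ops"
  shows "op_analytic_on (resolvent S) (- op_spectrum S)"
  unfolding op_analytic_on_def
proof
  interpret comp: bounded_bilinear "(o\<^sub>L) :: 'a cop \<Rightarrow> 'a cop \<Rightarrow> 'a cop" by (rule bounded_bilinear_blinfun_compose)
  fix z assume "z \<in> - op_spectrum S"
  then have z: "z \<notin> op_spectrum S" by simp
  let ?R = "resolvent S"
  obtain d where d: "d > 0" "\<And>w. norm (w - z) < d \<Longrightarrow>
      w \<notin> op_spectrum S \<and> norm (?R w) \<le> 2 * norm (?R z)"
    using op_spectrum_perturbation_ball[OF S z] by metis
  \<comment> \<open>The remainder is at most \<open>4 * norm (?R z) ^ 3\<close> times the square of
    \<open>norm (w - z)\<close>: one factor 2 comes from the bound on \<open>?R w\<close>, one from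
    \<open>norm_op_cscale_le\<close>. \<open>M\<close> dominates this coefficient and stays positive
    when the resolvent is 0.\<close>
  define M where "M = 8 * norm (?R z) ^ 3 + 1"
  have M: "M > 0" by (simp add: M_def add_nonneg_pos)
  have "(?R has_derivative (\<lambda>h. op_cscale h (- (?R z o\<^sub>L ?R z)))) (at z)"
    unfolding has_derivative_at_alt
  proof (intro conjI allI impI cop.bounded_linear_left)
    fix e :: real assume "e > 0"
    have "norm (?R w - ?R z - op_cscale (w - z) (- (?R z o\<^sub>L ?R z))) \<le> e * norm (w - z)"
      if w: "norm (w - z) < min d (e / M)" for w
    proof -
      have w': "w \<notin> op_spectrum S" "norm (?R w) \<le> 2 * norm (?R z)" using d(2)[of w] w by auto
      have id: "?R w - ?R z = op_cscale (z - w) (?R w o\<^sub>L ?R z)" by (rule resolvent_identity[OF S w'(1) z])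
      have "?R w - ?R z - op_cscale (w - z) (- (?R z o\<^sub>L ?R z)) = op_cscale (z - w) ((?R w - ?R z) o\<^sub>L ?R z)"
        by (subst id) (simp add: comp.diff_left cop.diff_right cop.diff_left cop.minus_right)
      also have "\<dots> = op_cscale ((z - w)^2) (?R w o\<^sub>L ?R z o\<^sub>L ?R z)"
        by (simp add: id op_cscale_compose_left cop.sc_sc power2_eq_square)
      also have "norm \<dots> \<le> norm ((z - w)^2) * norm (?R w o\<^sub>L ?R z o\<^sub>L ?R z) * 2" by (rule norm_op_cscale_le)
      also have "norm (?R w o\<^sub>L ?R z o\<^sub>L ?R z) \<le> norm (?R w o\<^sub>L ?R z) * norm (?R z)" by (rule norm_blinfun_compose)
      also have "norm (?R w o\<^sub>L ?R z) \<le> norm (?R w) * norm (?R z)" by (rule norm_blinfun_compose)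
      also have "norm (?R w) \<le> 2 * norm (?R z)" by (rule w')
      finally have "norm (?R w - ?R z - op_cscale (w - z) (- (?R z o\<^sub>L ?R z)))
          \<le> norm ((z - w)^2) * (2 * norm (?R z) * norm (?R z) * norm (?R z)) * 2"
        by (simp add: mult_left_mono mult_right_mono)
      also have "\<dots> = norm (w - z) * (norm (w - z) * (4 * norm (?R z) ^ 3))"
        by (simp add: norm_mult norm_minus_commute[of z w] power2_eq_square power3_eq_cube)
      also have "\<dots> \<le> norm (w - z) * (e / M * M)"
        using w M \<open>e > 0\<close> by (intro mult_left_mono mult_mono) (auto simp: M_def)
      also have "\<dots> = e * norm (w - z)" using M by simp
      finally show ?thesis .
    qed
    then show "\<exists>d>0. \<forall>w. norm (w - z) < d \<longrightarrow>
        norm (?R w - ?R z - op_cscale (w - z) (- (?R z o\<^sub>L ?R z))) \<le> e * norm (w - z)"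
      using d(1) M \<open>e > 0\<close> by (intro exI[of _ "min d (e / M)"]) auto
  qed
  then show "\<exists>D. (?R has_derivative (\<lambda>h. op_cscale h D)) (at z)" by blast
qed

lemma cscale_resolvent:
  assumes S: "S \<in> clinear_ops" and z: "z \<notin> op_spectrum S"
  shows "op_cscale z (resolvent S z) = id_blinfun + (S o\<^sub>L resolvent S z)"
proof -
  interpret comp: bounded_bilinear "(o\<^sub>L) :: 'a cop \<Rightarrow> 'a cop \<Rightarrow> 'a cop" by (rule bounded_bilinear_blinfun_compose)
  have "(op_cscale z id_blinfun - S) o\<^sub>L resolvent S z = id_blinfun"
    using is_resolvent_resolvent[OF z] by (simp add: is_resolvent_def)
  then show ?thesis by (simp add: comp.diff_left op_cscale_compose_left algebra_simps)
qed

text \<open>The resolvent is \<open>1 / z\<close> times the Neumann inverse of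
  \<open>id_blinfun - op_cscale (1 / z) S\<close>. The 4 in the hypothesis makes the perturbation at
  most 1/2 in norm; the 4 in the conclusion is the bound 2 on the inverse times the scaling constant
  2.\<close>

lemma resolvent_large:
  assumes S: "S \<in> clinear_ops" and z: "norm z > 4 * norm S"
  shows "z \<notin> op_spectrum S" "norm (resolvent S z) \<le> 4 / norm z"
proof -
  have z0: "z \<noteq> 0" using z by auto
  let ?I = "id_blinfun :: 'a cop"
  let ?E = "op_cscale (1 / z) S"
  have "norm ?E \<le> norm (1 / z) * norm S * 2" by (rule norm_op_cscale_le)
  also have "\<dots> \<le> 1 / 2" using z z0 by (simp add: norm_divide field_simps)
  finally have "norm ?E \<le> 1 / 2" .
  moreover have "norm ?I * norm ?E \<le> 1 * norm ?E" by (intro mult_right_mono norm_blinfun_id_le) auto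
  ultimately have "norm ?I * norm ?E \<le> 1 / 2" by simp
  then obtain C where C: "(?I - ?E) o\<^sub>L C = ?I" "C o\<^sub>L (?I - ?E) = ?I" "norm C \<le> 2 * norm ?I"
    using neumann_perturbation[of ?I ?I ?E] by auto
  have fac: "op_cscale z ?I - S = op_cscale z (?I - ?E)"
    using z0 by (simp add: cop.diff_right cop.sc_sc)
  have clin: "?I - ?E \<in> clinear_ops" by (intro clinear_ops_diff id_clinear clinear_ops_cscale S)
  have Cclin: "C \<in> clinear_ops"
    using inverse_commutes[OF C(1,2), of "cscale _"] clin by (simp add: clinear_ops_def del: split_paired_All)
  have "is_resolvent S z (op_cscale (1 / z) C)"
    unfolding is_resolvent_iff[OF S] fac
    using C(1,2) z0 by (simp add: op_cscale_compose_left op_cscale_compose_right clin Cclin clinear_ops_cscale cop.sc_sc)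
  then show "z \<notin> op_spectrum S" and eq: "norm (resolvent S z) \<le> 4 / norm z"
  proof -
    assume R: "is_resolvent S z (op_cscale (1 / z) C)"
    then show "z \<notin> op_spectrum S" by (auto simp: op_spectrum_def)
    have "norm (op_cscale (1 / z) C) \<le> norm (1 / z) * norm C * 2" by (rule norm_op_cscale_le)
    also have "\<dots> \<le> norm (1 / z) * 2 * 2"
      using C(3) norm_blinfun_id_le[where 'a = "'a \<times> 'a"] by (intro mult_right_mono mult_left_mono) auto
    finally show "norm (resolvent S z) \<le> 4 / norm z" by (simp add: resolvent_eqI[OF R] norm_divide)
  qed
qed

section \<open>Conjugation of operators\<close>

lift_definition conj_map :: "('v::banach \<times> 'v) \<Rightarrow>\<^sub>L ('v \<times> 'v)" is "\<lambda>p. (fst p, - snd p)"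
  by (intro bounded_linear_Pair bounded_linear_fst bounded_linear_minus bounded_linear_snd)

text \<open>As a two-sided composition with the reflection, conjugation is visibly bounded linear
  and multiplicative on all real-linear operators; on the complex-linear ones it is
  \<open>op_cnj\<close>.\<close>

definition conj_op :: "'v::banach cop \<Rightarrow> 'v cop" where
  "conj_op A = conj_map o\<^sub>L A o\<^sub>L conj_map"

lemma bounded_linear_conj_op: "bounded_linear conj_op"
  unfolding conj_op_def
  by (intro bounded_linear_compose[OF bounded_bilinear.bounded_linear_left[OF bounded_bilinear_blinfun_compose]]
      bounded_bilinear.bounded_linear_right[OF bounded_bilinear_blinfun_compose])

lemma conj_op_apply: "conj_op A p = (fst (A (fst p, - snd p)), - snd (A (fst p, - snd p)))"
  by (simp add: conj_op_def conj_map.rep_eq)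

lemma conj_op_compose: "conj_op (A o\<^sub>L B) = conj_op A o\<^sub>L conj_op B"
  by (rule blinfun_eqI) (simp add: conj_op_apply)

lemma conj_op_cscale: "conj_op (op_cscale a A) = op_cscale (cnj a) (conj_op A)"
  by (rule blinfun_eqI) (simp add: conj_op_apply op_cscale.rep_eq cscale_def)

lemma conj_op_complexify: "conj_op (complexify A) = complexify A"
  by (rule blinfun_eqI) (simp add: conj_op_apply complexify.rep_eq blinfun.minus_right)

lemma conj_op_id: "conj_op id_blinfun = id_blinfun"
  by (rule blinfun_eqI) (simp add: conj_op_apply)

lemma conj_op_eq_op_cnj:
  assumes "A \<in> clinear_ops"
  shows "conj_op A = op_cnj A"
proof -
  interpret conj: bounded_linear conj_op by (rule bounded_linear_conj_op)
  have "conj_op A = conj_op (complexify (op_Re A) + op_cscale \<i> (complexify (op_Im A)))"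
    using clinear_op_decompose[OF assms] by simp
  then show ?thesis
    by (simp add: op_cnj_def conj.add conj_op_cscale conj_op_complexify cop.minus_left)
qed

lemma conj_op_fixed:
  assumes "A \<in> clinear_ops" "conj_op A = A"
  shows "A = complexify (op_Re A)"
proof -
  have A: "A = complexify (op_Re A) + op_cscale \<i> (complexify (op_Im A))"
    by (rule clinear_op_decompose[OF assms(1)])
  have "A = complexify (op_Re A) - op_cscale \<i> (complexify (op_Im A))"
    using conj_op_eq_op_cnj[OF assms(1)] assms(2) by (simp add: op_cnj_def)
  then have "A + A = (complexify (op_Re A) + op_cscale \<i> (complexify (op_Im A)))
      + (complexify (op_Re A) - op_cscale \<i> (complexify (op_Im A)))"
    using A by metis
  then have "2 *\<^sub>R A = 2 *\<^sub>R complexify (op_Re A)" by (simp add: scaleR_2)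
  then show ?thesis by simp
qed

lemma is_resolvent_conj:
  assumes "is_resolvent (complexify T) z R"
  shows "is_resolvent (complexify T) (cnj z) (conj_op R)"
proof -
  interpret conj: bounded_linear conj_op by (rule bounded_linear_conj_op)
  have eq: "op_cscale (cnj z) id_blinfun - complexify T = conj_op (op_cscale z id_blinfun - complexify T)"
    by (simp add: conj.diff conj_op_cscale conj_op_id conj_op_complexify)
  show ?thesis
    using assms unfolding is_resolvent_iff[OF complexify_clinear] eq conj_op_compose[symmetric]
    by (simp add: conj_op_id)
qed

lemma complex_spectrum_cnj: "cnj z \<in> complex_spectrum T \<longleftrightarrow> z \<in> complex_spectrum T"
  using is_resolvent_conj[of T] by (auto simp: complex_spectrum_def op_spectrum_def) (metis complex_cnj_cnj)

lemma resolvent_cnj: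
  assumes "z \<notin> complex_spectrum T"
  shows "resolvent (complexify T) (cnj z) = conj_op (resolvent (complexify T) z)"
  using assms is_resolvent_resolvent is_resolvent_conj resolvent_eqI by (metis complex_spectrum_def)

section \<open>Analytic operator functions\<close>

lemma op_analytic_on_add:
  assumes "op_analytic_on F U" "op_analytic_on G U"
  shows "op_analytic_on (\<lambda>z. F z + G z) U"
  unfolding op_analytic_on_def
proof
  fix z assume "z \<in> U"
  then obtain D E where "(F has_derivative (\<lambda>h. op_cscale h D)) (at z)" "(G has_derivative (\<lambda>h. op_cscale h E)) (at z)"
    using assms unfolding op_analytic_on_def by blast
  then have "((\<lambda>z. F z + G z) has_derivative (\<lambda>h. op_cscale h (D + E))) (at z)"
    by (auto simp: cop.add_right intro: has_derivative_add)
  then show "\<exists>D. ((\<lambda>z. F z + G z) has_derivative (\<lambda>h. op_cscale h D)) (at z)" by blast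
qed

lemma op_analytic_on_linear:
  assumes L: "bounded_linear L" "\<And>a A. L (op_cscale a A) = op_cscale a (L A)" and F: "op_analytic_on F U"
  shows "op_analytic_on (\<lambda>z. L (F z)) U"
  unfolding op_analytic_on_def
proof
  fix z assume "z \<in> U"
  then obtain D where "(F has_derivative (\<lambda>h. op_cscale h D)) (at z)"
    using F by (auto simp: op_analytic_on_def)
  then have "((\<lambda>z. L (F z)) has_derivative (\<lambda>h. op_cscale h (L D))) (at z)"
    using bounded_linear.has_derivative[OF L(1)] by (force simp: L(2))
  then show "\<exists>D. ((\<lambda>z. L (F z)) has_derivative (\<lambda>h. op_cscale h D)) (at z)" by blast
qed

lemma op_analytic_on_cscale:
  assumes f: "f holomorphic_on U" "open U" and F: "op_analytic_on F U"
  shows "op_analytic_on (\<lambda>z. op_cscale (f z) (F z)) U"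
  unfolding op_analytic_on_def
proof
  fix z assume z: "z \<in> U"
  then obtain D where D: "(F has_derivative (\<lambda>h. op_cscale h D)) (at z)"
    using F by (auto simp: op_analytic_on_def)
  have "(f has_derivative (\<lambda>h. deriv f z * h)) (at z)"
    using holomorphic_derivI[OF f z] by (simp add: has_field_derivative_def)
  from cop.FDERIV[OF this D]
  have "((\<lambda>z. op_cscale (f z) (F z)) has_derivative (\<lambda>h. op_cscale h (op_cscale (f z) D + op_cscale (deriv f z) (F z)))) (at z)"
    by (simp add: cop.sc_sc cop.add_right mult.commute)
  then show "\<exists>D. ((\<lambda>z. op_cscale (f z) (F z)) has_derivative (\<lambda>h. op_cscale h D)) (at z)" by blast
qed

text \<open>Complex linearity of \<open>F z\<close> lets the increment \<open>h\<close> pass through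
  \<open>F z\<close> in the product rule; in general the derivative of the product would only be
  real linear.\<close>

lemma op_analytic_on_compose:
  assumes F: "op_analytic_on F U" "\<And>z. z \<in> U \<Longrightarrow> F z \<in> clinear_ops" and G: "op_analytic_on G U"
  shows "op_analytic_on (\<lambda>z. F z o\<^sub>L G z) U"
  unfolding op_analytic_on_def
proof
  fix z assume z: "z \<in> U"
  then obtain D E where D: "(F has_derivative (\<lambda>h. op_cscale h D)) (at z)" "(G has_derivative (\<lambda>h. op_cscale h E)) (at z)"
    using F G unfolding op_analytic_on_def by blast
  from bounded_bilinear.FDERIV[OF bounded_bilinear_blinfun_compose this]
  have "((\<lambda>z. F z o\<^sub>L G z) has_derivative (\<lambda>h. op_cscale h ((F z o\<^sub>L E) + (D o\<^sub>L G z)))) (at z)"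
    by (simp add: cop.add_right op_cscale_compose_left op_cscale_compose_right[OF F(2)[OF z]])
  then show "\<exists>D. ((\<lambda>z. F z o\<^sub>L G z) has_derivative (\<lambda>h. op_cscale h D)) (at z)" by blast
qed

lemma op_analytic_on_const: "op_analytic_on (\<lambda>z. A) U"
  unfolding op_analytic_on_def by (intro ballI exI[of _ 0]) (simp add: cop.zero_right)

lemma op_analytic_on_subset: "op_analytic_on F U \<Longrightarrow> V \<subseteq> U \<Longrightarrow> op_analytic_on F V"
  by (auto simp: op_analytic_on_def)

section \<open>The functional calculus\<close>

lemma stem_functions_iff:
  "open U \<Longrightarrow> f \<in> stem_functions U \<longleftrightarrow> f holomorphic_on U \<and> (\<forall>z\<in>U. f (cnj z) = cnj (f z))"
  by (simp add: stem_functions_def analytic_on_open)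

lemma scalar_op_compose: "scalar_op f z o\<^sub>L A = op_cscale (f z) A"
  by (simp add: scalar_op_def op_cscale_compose_left)

context banach_cl_space
begin

section \<open>Right linear operators on the complexification\<close>

lemma bounded_linear_ract:
  assumes "a \<in> Cl n"
  shows "bounded_linear (\<lambda>x. ract x a)"
proof -
  obtain C where "\<And>x. norm (ract x a) \<le> C * norm x * cl_norm a"
    using act_bounded assms by blast
  then have "norm (ract x a) \<le> norm x * (C * cl_norm a)" for x by (simp add: mult_ac)
  with ract_linear[OF assms] show ?thesis
    by (auto simp: bounded_linear_def bounded_linear_axioms_def)
qed

definition pair_ract :: "clifford \<Rightarrow> 'v \<times> 'v \<Rightarrow> 'v \<times> 'v" where
  "pair_ract a p = (ract (fst p) a, ract (snd p) a)"

lemma cright_ops_iff: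
  "A \<in> cright_ops n ract \<longleftrightarrow> A \<in> clinear_ops \<and> (\<forall>a\<in>Cl n. \<forall>p. A (pair_ract a p) = pair_ract a (A p))"
  by (auto simp: cright_ops_def pair_ract_def)

lemma bounded_linear_pair_ract: "a \<in> Cl n \<Longrightarrow> bounded_linear (pair_ract a)"
  unfolding pair_ract_def
  by (intro bounded_linear_Pair bounded_linear_compose[OF bounded_linear_ract]
      bounded_linear_fst bounded_linear_snd)

lemma pair_ract_cscale:
  assumes "a \<in> Cl n"
  shows "pair_ract a (cscale z p) = cscale z (pair_ract a p)"
proof -
  interpret bounded_linear "\<lambda>x. ract x a" by (rule bounded_linear_ract[OF assms])
  show ?thesis by (simp add: pair_ract_def cscale_def add diff scaleR)
qed

lemma cright_ops_clinear: "A \<in> cright_ops n ract \<Longrightarrow> A \<in> clinear_ops"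
  by (simp add: cright_ops_def)

lemma cright_ops_add:
  assumes "A \<in> cright_ops n ract" "B \<in> cright_ops n ract"
  shows "A + B \<in> cright_ops n ract"
  using assms bounded_linear.linear[OF bounded_linear_pair_ract]
  by (auto simp: cright_ops_iff clinear_ops_def blinfun.add_left cscale_add linear_add simp del: split_paired_All)

lemma cright_ops_cscale: "A \<in> cright_ops n ract \<Longrightarrow> op_cscale z A \<in> cright_ops n ract"
  by (auto simp: cright_ops_iff clinear_ops_cscale op_cscale.rep_eq pair_ract_cscale simp del: split_paired_All)

lemma cright_ops_scaleR: "A \<in> cright_ops n ract \<Longrightarrow> r *\<^sub>R A \<in> cright_ops n ract"
  using cright_ops_cscale[of A "of_real r"] by (simp add: cop.sc_of_real)

lemma cright_ops_compose: "A \<in> cright_ops n ract \<Longrightarrow> B \<in> cright_ops n ract \<Longrightarrow> A o\<^sub>L B \<in> cright_ops n ract"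
  by (auto simp: cright_ops_iff clinear_ops_compose simp del: split_paired_All)

lemma cright_ops_id: "id_blinfun \<in> cright_ops n ract"
  by (simp add: cright_ops_iff id_clinear)

lemma complexify_cright_ops: "A \<in> right_ops n ract \<Longrightarrow> complexify A \<in> cright_ops n ract"
  by (simp add: cright_ops_iff complexify_clinear complexify.rep_eq pair_ract_def right_ops_def)

lemma op_Re_right_ops:
  assumes "A \<in> cright_ops n ract"
  shows "op_Re A \<in> right_ops n ract"
proof -
  obtain T1 T2 where "A = complexify T1 + op_cscale \<i> (complexify T2)" "T1 \<in> right_ops n ract"
    using assms unfolding cright_ops_eq by blast
  then show ?thesis by (simp add: op_Re_Im)
qed

lemma right_ops_op_power: "A \<in> right_ops n ract \<Longrightarrow> op_power A k \<in> right_ops n ract"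
  by (induction k) (simp_all add: right_ops_def)

lemma right_ops_sum:
  assumes "\<And>i. i \<in> I \<Longrightarrow> A i \<in> right_ops n ract"
  shows "(\<Sum>i\<in>I. A i) \<in> right_ops n ract"
  using assms
proof (induction I rule: infinite_finite_induct)
  case (insert i I)
  then show ?case using linear_add[OF ract_linear] by (simp add: right_ops_def blinfun.add_left)
qed (simp_all add: right_ops_def linear_0[OF ract_linear])

text \<open>Each defining condition says that a bounded real-linear map
  \<open>A \<mapsto> A (Y p) - Y (A p)\<close> vanishes, with \<open>Y\<close> a scaling or a right
  multiplication, and \<open>path_integral_in_kernel\<close> applies to such maps.\<close>

lemma cright_ops_path_integral:
  assumes int: "cop.path_integrable \<gamma> H" and H: "\<And>z. z \<in> path_image \<gamma> \<Longrightarrow> H z \<in> cright_ops n ract"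
  shows "cop.path_integral \<gamma> H \<in> cright_ops n ract"
proof -
  have H': "op_cscale a (H z) \<in> cright_ops n ract" if "z \<in> path_image \<gamma>" for a z
    using H[OF that] by (rule cright_ops_cscale)
  have "cop.path_integral \<gamma> H (cscale a p) - cscale a (cop.path_integral \<gamma> H p) = 0" for a p
    by (rule cop.path_integral_in_kernel[OF _ int, where L = "\<lambda>A. A (cscale a p) - cscale a (A p)"])
      (use clinear_ops_apply[OF cright_ops_clinear[OF H']] in
        \<open>auto intro!: bounded_linear_sub blinfun.bounded_linear_left
          bounded_linear_compose[OF bounded_linear_cscale blinfun.bounded_linear_left]\<close>)
  moreover have "cop.path_integral \<gamma> H (pair_ract a p) - pair_ract a (cop.path_integral \<gamma> H p) = 0"
    if "a \<in> Cl n" for a p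
    by (rule cop.path_integral_in_kernel[OF _ int, where L = "\<lambda>A. A (pair_ract a p) - pair_ract a (A p)"])
      (use H' that in \<open>auto simp: cright_ops_iff simp del: split_paired_All intro!: bounded_linear_sub blinfun.bounded_linear_left
          bounded_linear_compose[OF bounded_linear_pair_ract blinfun.bounded_linear_left]\<close>)
  ultimately show ?thesis by (simp add: cright_ops_iff clinear_ops_def del: split_paired_All)
qed

lemma resolvent_cright_ops:
  assumes T: "T \<in> right_ops n ract" and z: "z \<notin> complex_spectrum T"
  shows "resolvent (complexify T) z \<in> cright_ops n ract"
proof -
  let ?R = "resolvent (complexify T) z"
  have R: "?R \<in> clinear_ops" "(op_cscale z id_blinfun - complexify T) o\<^sub>L ?R = id_blinfun"
    "?R o\<^sub>L (op_cscale z id_blinfun - complexify T) = id_blinfun"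
    using is_resolvent_resolvent z by (auto simp: is_resolvent_def complex_spectrum_def)
  have "op_cscale z id_blinfun - complexify T = op_cscale z id_blinfun + (-1) *\<^sub>R complexify T" by simp
  also have "\<dots> \<in> cright_ops n ract"
    by (intro cright_ops_add cright_ops_scaleR cright_ops_cscale cright_ops_id complexify_cright_ops T)
  finally show ?thesis
    using inverse_commutes[OF R(2,3)] R(1) by (simp add: cright_ops_iff del: split_paired_All)
qed

section \<open>Closure properties of stem functions\<close>

lemma stem_op_add:
  assumes "F \<in> stem_op_functions n ract U" "G \<in> stem_op_functions n ract U"
  shows "(\<lambda>z. F z + G z) \<in> stem_op_functions n ract U"
proof -
  interpret conj: bounded_linear conj_op by (rule bounded_linear_conj_op)
  have "op_cnj (A + B) = op_cnj A + op_cnj B" if "A \<in> cright_ops n ract" "B \<in> cright_ops n ract" for A B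
    using that cright_ops_add[OF that] by (simp add: conj_op_eq_op_cnj[symmetric] cright_ops_clinear conj.add)
  then show ?thesis
    using assms by (simp add: stem_op_functions_def op_analytic_on_add cright_ops_add)
qed

lemma stem_op_cscale:
  assumes "open U" "F \<in> stem_op_functions n ract U" "f \<in> stem_functions U"
  shows "(\<lambda>z. op_cscale (f z) (F z)) \<in> stem_op_functions n ract U"
proof -
  have "op_cnj (op_cscale a A) = op_cscale (cnj a) (op_cnj A)" if "A \<in> cright_ops n ract" for a A
    using that cright_ops_cscale[OF that]
    by (simp add: conj_op_eq_op_cnj[symmetric] cright_ops_clinear conj_op_cscale)
  then show ?thesis
    using assms stem_functions_iff[OF assms(1)]
    by (simp add: stem_op_functions_def op_analytic_on_cscale cright_ops_cscale)
qed

lemma stem_op_const: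
  assumes "A \<in> right_ops n ract"
  shows "(\<lambda>z. complexify A) \<in> stem_op_functions n ract U"
  using conj_op_eq_op_cnj[OF complexify_clinear, of A]
  by (simp add: stem_op_functions_def op_analytic_on_const complexify_cright_ops[OF assms] conj_op_complexify)

lemma stem_const: "(\<lambda>z. of_real r) \<in> stem_functions U"
  by (simp add: stem_functions_def)

lemma stem_op_scaleR:
  assumes "open U" "F \<in> stem_op_functions n ract U"
  shows "(\<lambda>z. r *\<^sub>R F z) \<in> stem_op_functions n ract U"
  using stem_op_cscale[OF assms stem_const[of r]] by (simp add: cop.sc_of_real)

lemma stem_op_scalar:
  assumes "open U" "f \<in> stem_functions U"
  shows "scalar_op f \<in> stem_op_functions n ract U"
proof -
  have "id_blinfun \<in> right_ops n ract" by (simp add: right_ops_def)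
  from stem_op_cscale[OF assms(1) stem_op_const[OF this] assms(2)]
  show ?thesis by (simp add: complexify_id scalar_op_def[abs_def])
qed

end

locale riesz_contour = banach_cl_space n lact ract
  for n and lact :: "clifford \<Rightarrow> 'v::banach \<Rightarrow> 'v" and ract :: "'v \<Rightarrow> clifford \<Rightarrow> 'v" +
  fixes U \<Delta> :: "complex set" and \<Gamma> :: "(real \<Rightarrow> complex) set" and T :: "'v \<Rightarrow>\<^sub>L 'v"
  assumes open_U: "open U" and conj_U: "conj_symmetric U" and T: "T \<in> right_ops n ract"
    and contour: "cauchy_domain U \<Delta> \<Gamma>" and spectrum: "complex_spectrum T \<subseteq> \<Delta>"
begin

abbreviation "R \<equiv> resolvent (complexify T)"
abbreviation "\<sigma> \<equiv> complex_spectrum T"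
abbreviation "V \<equiv> U - \<sigma>"

section \<open>A fixed contour around the spectrum\<close>

lemma finite_\<Gamma>: "finite \<Gamma>"
  and \<Gamma>_valid: "\<gamma> \<in> \<Gamma> \<Longrightarrow> valid_path \<gamma>"
  and \<Gamma>_loop: "\<gamma> \<in> \<Gamma> \<Longrightarrow> pathfinish \<gamma> = pathstart \<gamma>"
  using contour by (auto simp: cauchy_domain_def)

text \<open>The curves run in the frontier of \<open>\<Delta>\<close>, which the open set
  \<open>\<Delta>\<close> does not meet, while the spectrum lies inside
  \<open>\<Delta>\<close>.\<close>

lemma \<Gamma>_image: "\<gamma> \<in> \<Gamma> \<Longrightarrow> path_image \<gamma> \<subseteq> V"
proof -
  assume "\<gamma> \<in> \<Gamma>"
  then have "path_image \<gamma> \<subseteq> frontier \<Delta>" using contour by (auto simp: cauchy_domain_def)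
  moreover have "frontier \<Delta> \<subseteq> U" "frontier \<Delta> \<inter> \<Delta> = {}"
    using contour by (auto simp: cauchy_domain_def frontier_def interior_open)
  ultimately show ?thesis using spectrum by blast
qed

lemma \<Gamma>_image_U: "\<gamma> \<in> \<Gamma> \<Longrightarrow> path_image \<gamma> \<subseteq> U"
  using \<Gamma>_image by blast

lemma winding_outside: "w \<notin> U \<Longrightarrow> (\<Sum>\<gamma>\<in>\<Gamma>. winding_number \<gamma> w) = 0"
  and winding_spectrum: "w \<in> \<sigma> \<Longrightarrow> (\<Sum>\<gamma>\<in>\<Gamma>. winding_number \<gamma> w) = 1"
  using contour spectrum by (auto simp: cauchy_domain_def)

lemma closed_\<sigma>: "closed \<sigma>"
  unfolding complex_spectrum_def by (rule closed_op_spectrum[OF complexify_clinear])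

lemma open_V: "open V"
  using open_U closed_\<sigma> by (rule open_Diff)

lemma R_clinear: "z \<notin> \<sigma> \<Longrightarrow> R z \<in> clinear_ops"
  using is_resolvent_resolvent by (auto simp: is_resolvent_def complex_spectrum_def)

lemma R_analytic: "op_analytic_on R (- \<sigma>)"
  unfolding complex_spectrum_def by (rule op_analytic_on_resolvent[OF complexify_clinear])

lemma Cauchy_U: "g holomorphic_on U \<Longrightarrow> (\<Sum>\<gamma>\<in>\<Gamma>. contour_integral \<gamma> g) = 0"
  using Cauchy_theorem_chain[OF open_U _ finite_\<Gamma>, of g "\<lambda>\<gamma>. \<gamma>" "\<lambda>\<gamma>. 1"]
  by (simp add: \<Gamma>_valid \<Gamma>_image_U \<Gamma>_loop winding_outside)

text \<open>The part of the stem conditions that makes the integrand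
  \<open>F z o\<^sub>L R z\<close> complex differentiable; it also admits constants without a real
  structure.\<close>

definition admissible :: "(complex \<Rightarrow> 'v cop) \<Rightarrow> bool" where
  "admissible F \<longleftrightarrow> op_analytic_on F U \<and> (\<forall>z\<in>U. F z \<in> clinear_ops)"

lemma stem_admissible: "F \<in> stem_op_functions n ract U \<Longrightarrow> admissible F"
  by (simp add: stem_op_functions_def admissible_def cright_ops_clinear)

lemma integrand_analytic:
  assumes "admissible F"
  shows "op_analytic_on (\<lambda>z. F z o\<^sub>L R z) V"
  using assms by (intro op_analytic_on_compose)
    (auto simp: admissible_def intro: op_analytic_on_subset[OF R_analytic] op_analytic_on_subset[of F U])

lemma V_integrable: "op_analytic_on H V \<Longrightarrow> \<gamma> \<in> \<Gamma> \<Longrightarrow> cop.path_integrable \<gamma> H"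
  using cop.path_integrable_valid_path[OF _ open_V \<Gamma>_valid \<Gamma>_image] by (simp add: op_analytic_on_eq)

definition cycle_integral :: "(complex \<Rightarrow> 'v cop) \<Rightarrow> 'v cop" where
  "cycle_integral H = (\<Sum>\<gamma>\<in>\<Gamma>. cop.path_integral \<gamma> H)"

lemma fun_calc_eq: "fun_calc \<Gamma> T F = op_cscale (1 / (2 * of_real pi * \<i>)) (cycle_integral (\<lambda>z. F z o\<^sub>L R z))"
  by (simp add: fun_calc_def cycle_integral_def op_contour_integral_eq)

lemma cycle_integral_add:
  assumes "op_analytic_on H V" "op_analytic_on K V"
  shows "cycle_integral (\<lambda>z. H z + K z) = cycle_integral H + cycle_integral K"
  unfolding cycle_integral_def sum.distrib[symmetric]
  by (intro sum.cong refl cop.path_integral_add V_integrable assms)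

lemma cycle_integral_linear:
  assumes L: "bounded_linear L" "\<And>a A. L (op_cscale a A) = op_cscale a (L A)" and H: "op_analytic_on H V"
  shows "cycle_integral (\<lambda>z. L (H z)) = L (cycle_integral H)"
  unfolding cycle_integral_def linear_sum[OF bounded_linear.linear[OF L(1)]]
  by (intro sum.cong refl cop.path_integral_linear L V_integrable[OF H])

lemma cycle_integral_cong:
  assumes "\<And>z. z \<in> V \<Longrightarrow> H z = K z"
  shows "cycle_integral H = cycle_integral K"
  unfolding cycle_integral_def
  by (intro sum.cong refl cop.path_integral_cong assms) (use \<Gamma>_image in blast)

lemma cycle_integral_U: "op_analytic_on H U \<Longrightarrow> cycle_integral H = 0"
  using cop.path_integral_chain_zero[OF open_U _ finite_\<Gamma>, of H "\<lambda>\<gamma>. \<gamma>" "\<lambda>\<gamma>. 1"]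
  by (simp add: cycle_integral_def op_analytic_on_eq \<Gamma>_valid \<Gamma>_image_U \<Gamma>_loop winding_outside)

lemma functional_cycle_integral:
  assumes \<Phi>: "cop.complex_functional \<Phi>" and H: "op_analytic_on H V"
  shows "\<Phi> (cycle_integral H) = (\<Sum>\<gamma>\<in>\<Gamma>. contour_integral \<gamma> (\<lambda>z. \<Phi> (H z)))"
proof -
  have "linear \<Phi>" using \<Phi> by (simp add: cop.complex_functional_def bounded_linear.linear)
  then show ?thesis unfolding cycle_integral_def
    by (simp add: linear_sum
        contour_integral_unique[OF cop.has_contour_integral_functional[OF V_integrable[OF H] \<Phi>]])
qed

lemma bounded_linear_compose_left: "bounded_linear (\<lambda>B. A o\<^sub>L B :: 'v cop)"
  by (rule bounded_bilinear.bounded_linear_right[OF bounded_bilinear_blinfun_compose])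

lemma bounded_linear_compose_right: "bounded_linear (\<lambda>A. A o\<^sub>L B :: 'v cop)"
  by (rule bounded_bilinear.bounded_linear_left[OF bounded_bilinear_blinfun_compose])

section \<open>Linearity, contour independence and reality\<close>

lemma fun_calc_add:
  assumes "admissible F" "admissible G"
  shows "fun_calc \<Gamma> T (\<lambda>z. F z + G z) = fun_calc \<Gamma> T F + fun_calc \<Gamma> T G"
  using cycle_integral_add[OF integrand_analytic[OF assms(1)] integrand_analytic[OF assms(2)]]
  by (simp add: fun_calc_eq bounded_bilinear.add_left[OF bounded_bilinear_blinfun_compose] cop.add_right)

lemma fun_calc_scaleR:
  assumes "admissible F"
  shows "fun_calc \<Gamma> T (\<lambda>z. r *\<^sub>R F z) = r *\<^sub>R fun_calc \<Gamma> T F"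
  using cycle_integral_linear[OF bounded_linear_scaleR_right _ integrand_analytic[OF assms], of r]
  by (simp add: fun_calc_eq bounded_bilinear.scaleR_left[OF bounded_bilinear_blinfun_compose] cop.scaleR_right)

lemma fun_calc_left_compose:
  assumes A: "A \<in> clinear_ops" and F: "admissible F"
  shows "fun_calc \<Gamma> T (\<lambda>z. A o\<^sub>L F z) = A o\<^sub>L fun_calc \<Gamma> T F"
  using cycle_integral_linear[OF bounded_linear_compose_left _ integrand_analytic[OF F], of A]
  by (simp add: fun_calc_eq blinfun_compose_assoc op_cscale_compose_right[OF A])

text \<open>The points off \<open>V\<close> lie outside \<open>U\<close>, where both contours have
  total winding number 0, or in the spectrum, where both have 1. So the contours are homologous in
  the set where the integrand is analytic.\<close>

lemma fun_calc_contour_independent: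
  assumes F: "admissible F" and "cauchy_domain U \<Delta>' \<Gamma>'" "\<sigma> \<subseteq> \<Delta>'"
  shows "fun_calc \<Gamma>' T F = fun_calc \<Gamma> T F"
proof -
  interpret other: riesz_contour n lact ract U \<Delta>' \<Gamma>' T
    by unfold_locales (use assms open_U conj_U T in auto)
  have "(\<Sum>\<gamma>\<in>\<Gamma>'. 1 * winding_number \<gamma> w) = (\<Sum>\<gamma>\<in>\<Gamma>. 1 * winding_number \<gamma> w)" if "w \<notin> V" for w
    using that winding_outside[of w] winding_spectrum[of w] other.winding_outside[of w] other.winding_spectrum[of w]
    by auto
  from cop.path_integral_chain_eq[OF open_V _ other.finite_\<Gamma> finite_\<Gamma> _ _ this, of "\<lambda>z. F z o\<^sub>L R z"]
  have "other.cycle_integral (\<lambda>z. F z o\<^sub>L R z) = cycle_integral (\<lambda>z. F z o\<^sub>L R z)"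
    using integrand_analytic[OF F]
    by (simp add: op_analytic_on_eq other.cycle_integral_def cycle_integral_def \<Gamma>_valid \<Gamma>_image \<Gamma>_loop
        other.\<Gamma>_valid other.\<Gamma>_image other.\<Gamma>_loop)
  then show ?thesis by (simp add: fun_calc_eq other.fun_calc_eq)
qed

lemma cycle_integral_cright_ops:
  assumes F: "F \<in> stem_op_functions n ract U"
  shows "cycle_integral (\<lambda>z. F z o\<^sub>L R z) \<in> cright_ops n ract"
proof -
  have "F z o\<^sub>L R z \<in> cright_ops n ract" if "z \<in> V" for z
    using that F by (intro cright_ops_compose resolvent_cright_ops T) (auto simp: stem_op_functions_def)
  then have mem: "cop.path_integral \<gamma> (\<lambda>z. F z o\<^sub>L R z) \<in> cright_ops n ract" if "\<gamma> \<in> \<Gamma>" for \<gamma>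
    using \<Gamma>_image[OF that] V_integrable[OF integrand_analytic[OF stem_admissible[OF F]] that]
    by (intro cright_ops_path_integral) auto
  have "(\<Sum>\<gamma>\<in>X. cop.path_integral \<gamma> (\<lambda>z. F z o\<^sub>L R z)) \<in> cright_ops n ract" if "X \<subseteq> \<Gamma>" for X
    using finite_subset[OF that finite_\<Gamma>] that
  proof (induction X rule: finite_induct)
    case empty
    show ?case using cright_ops_scaleR[OF cright_ops_id, of 0] by simp
  qed (simp add: cright_ops_add mem)
  then show ?thesis by (simp add: cycle_integral_def)
qed

lemma fun_calc_cright_ops: "F \<in> stem_op_functions n ract U \<Longrightarrow> fun_calc \<Gamma> T F \<in> cright_ops n ract"
  by (simp add: fun_calc_eq cright_ops_cscale cycle_integral_cright_ops)

lemma fun_calc_real: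
  assumes F: "F \<in> stem_op_functions n ract U"
  shows "fun_calc \<Gamma> T F \<in> complexify ` right_ops n ract"
proof -
  interpret conj: bounded_linear "conj_op :: 'v cop \<Rightarrow> 'v cop" by (rule bounded_linear_conj_op)
  let ?H = "\<lambda>z. F z o\<^sub>L R z"
  have H: "op_analytic_on ?H V" by (rule integrand_analytic[OF stem_admissible[OF F]])
  have cnjV: "cnj z \<in> V \<longleftrightarrow> z \<in> V" for z
    using conj_U complex_spectrum_cnj by (auto simp: conj_symmetric_def)
  have HV: "?H (cnj z) = conj_op (?H z)" if "z \<in> V" for z
  proof -
    have "F z \<in> clinear_ops" "F (cnj z) = op_cnj (F z)"
      using F that cright_ops_clinear by (auto simp: stem_op_functions_def)
    then show ?thesis using that by (simp add: resolvent_cnj conj_op_compose conj_op_eq_op_cnj)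
  qed
  have img: "path_image (cnj \<circ> \<gamma>) = cnj ` path_image \<gamma>" for \<gamma> by (simp add: path_image_compose)
  have conj_int: "cop.path_integral (cnj \<circ> \<gamma>) ?H = conj_op (cop.path_integral \<gamma> ?H)" if "\<gamma> \<in> \<Gamma>" for \<gamma>
    using \<Gamma>_valid[OF that] V_integrable[OF H that] bounded_linear_conj_op conj_op_cscale
    by (rule cop.path_integral_conjugate) (use HV \<Gamma>_image[OF that] in blast)
  \<comment> \<open>Reflection conjugates and negates winding numbers, and the totals 0 and 1 are
    real. The two kinds of points off \<open>V\<close>, outside \<open>U\<close> and in the
    spectrum, are each preserved by conjugation.\<close>
  have wn: "(\<Sum>\<gamma>\<in>\<Gamma>. - 1 * winding_number (cnj \<circ> \<gamma>) w) = (\<Sum>\<gamma>\<in>\<Gamma>. 1 * winding_number \<gamma> w)" if w: "w \<notin> V" for w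
  proof -
    have "winding_number (cnj \<circ> \<gamma>) w = - cnj (winding_number \<gamma> (cnj w))" if "\<gamma> \<in> \<Gamma>" for \<gamma>
    proof -
      have "cnj w \<notin> path_image \<gamma>" using \<Gamma>_image[OF that] w cnjV by blast
      then show ?thesis using winding_number_cnj[of \<gamma> "cnj w"] valid_path_imp_path[OF \<Gamma>_valid[OF that]] by simp
    qed
    then have "(\<Sum>\<gamma>\<in>\<Gamma>. - 1 * winding_number (cnj \<circ> \<gamma>) w) = cnj (\<Sum>\<gamma>\<in>\<Gamma>. winding_number \<gamma> (cnj w))"
      by (simp add: cnj_sum)
    moreover have "cnj w \<in> U \<longleftrightarrow> w \<in> U" using conj_U by (auto simp: conj_symmetric_def)
    moreover have "w \<notin> U \<or> w \<in> \<sigma>" using w by blast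
    ultimately show ?thesis
      using winding_outside[of w] winding_outside[of "cnj w"] winding_spectrum[of w] winding_spectrum[of "cnj w"]
        complex_spectrum_cnj[of w T] by (auto simp del: cnj_sum)
  qed
  have "(\<Sum>\<gamma>\<in>\<Gamma>. op_cscale (- 1) (cop.path_integral (cnj \<circ> \<gamma>) ?H)) = (\<Sum>\<gamma>\<in>\<Gamma>. op_cscale 1 (cop.path_integral \<gamma> ?H))"
  proof (rule cop.path_integral_chain_eq[OF open_V H[unfolded op_analytic_on_eq] finite_\<Gamma> finite_\<Gamma> _ _ wn])
    fix \<gamma> assume g: "\<gamma> \<in> \<Gamma>"
    show "valid_path \<gamma> \<and> path_image \<gamma> \<subseteq> V \<and> pathfinish \<gamma> = pathstart \<gamma>"
      using g by (simp add: \<Gamma>_valid \<Gamma>_image \<Gamma>_loop)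
    show "valid_path (cnj \<circ> \<gamma>) \<and> path_image (cnj \<circ> \<gamma>) \<subseteq> V \<and> pathfinish (cnj \<circ> \<gamma>) = pathstart (cnj \<circ> \<gamma>)"
      using \<Gamma>_valid[OF g] \<Gamma>_image[OF g] \<Gamma>_loop[OF g] cnjV
      by (auto simp: img valid_path_cnj pathfinish_compose pathstart_compose)
  qed
  then have "- conj_op (cycle_integral ?H) = cycle_integral ?H"
    by (simp add: conj_int cycle_integral_def conj.sum cop.minus_left sum_negf)
  \<comment> \<open>The minus sign from the reversed orientation cancels against the one from
    conjugating \<open>1 / (2 * of_real pi * \<i>)\<close>.\<close>
  then have "conj_op (fun_calc \<Gamma> T F) = fun_calc \<Gamma> T F"
    by (simp add: fun_calc_eq conj_op_cscale cop.minus_left flip: cop.minus_right)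
  then have "fun_calc \<Gamma> T F = complexify (op_Re (fun_calc \<Gamma> T F))"
    using fun_calc_cright_ops[OF F] by (intro conj_op_fixed cright_ops_clinear)
  then show ?thesis using op_Re_right_ops[OF fun_calc_cright_ops[OF F]] by blast
qed

text \<open>
  \<open>R(z) = 1/z + T R(z)/z\<close>, and on a circle of radius \<open>r\<close> the last term contributes \<open>O(1/r)\<close>.
\<close>

lemma cycle_integral_resolvent: "cycle_integral R = op_cscale (2 * of_real pi * \<i>) id_blinfun"
proof (rule cop.complex_functionals_separate)
  fix \<Phi> :: "'v cop \<Rightarrow> complex" assume \<Phi>: "cop.complex_functional \<Phi>"
  interpret \<Phi>: bounded_linear \<Phi> using \<Phi> by (simp add: cop.complex_functional_def)
  have \<Phi>sc: "\<Phi> (op_cscale a A) = a * \<Phi> A" for a A using \<Phi> by (simp add: cop.complex_functional_def)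
  obtain K where K: "K > 0" "\<And>A. norm (\<Phi> A) \<le> norm A * K" using \<Phi>.pos_bounded by blast
  let ?S = "complexify T"
  let ?d = "\<Phi> (cycle_integral R) - 2 * of_real pi * \<i> * \<Phi> id_blinfun"
  \<comment> \<open>The 4 comes from the decay bound of \<open>resolvent_large\<close>,
    \<open>norm ?S\<close> from the factor \<open>T\<close> of the error term, and \<open>K\<close>
    bounds \<open>\<Phi>\<close>.\<close>
  define M where "M = 4 * norm ?S * K"
  have M: "M \<ge> 0" using K by (simp add: M_def)
  have bound: "norm ?d \<le> 2 * pi * M / r" if r: "r > 4 * norm ?S" for r
  proof -
    have r0: "r > 0" using r norm_ge_zero[of ?S] by linarith
    have out: "z \<notin> \<sigma> \<and> norm (R z) \<le> 4 / r" if "norm z = r" for z :: complex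
      using resolvent_large[OF complexify_clinear, of T z] that r by (simp add: complex_spectrum_def)
    have ball: "norm w < r" if "w \<in> \<sigma>" for w
    proof (rule ccontr)
      assume "\<not> norm w < r"
      then have "norm w > 4 * norm ?S" using r by linarith
      then show False using resolvent_large(1)[OF complexify_clinear] that by (auto simp: complex_spectrum_def)
    qed
    have cimg: "path_image (circlepath 0 r) \<subseteq> - \<sigma>" using out r0 by auto
    \<comment> \<open>The circle may leave \<open>U\<close>: the resolvent is analytic on the whole
      complement of the spectrum, and there the two cycles are homologous.\<close>
    have "(\<Sum>\<gamma>\<in>\<Gamma>. op_cscale 1 (cop.path_integral \<gamma> R)) = (\<Sum>i\<in>{()}. op_cscale 1 (cop.path_integral (circlepath 0 r) R))"
    proof (rule cop.path_integral_chain_eq[OF _ R_analytic[unfolded op_analytic_on_eq] finite_\<Gamma>])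
      show "open (- \<sigma>)" using closed_\<sigma> by (simp add: open_Compl)
      fix w assume "w \<notin> - \<sigma>"
      then show "(\<Sum>\<gamma>\<in>\<Gamma>. 1 * winding_number \<gamma> w) = (\<Sum>i\<in>{()}. 1 * winding_number (circlepath 0 r) w)"
        using winding_spectrum[of w] ball[of w] by (simp add: winding_number_circlepath)
    qed (use \<Gamma>_valid \<Gamma>_image \<Gamma>_loop cimg in auto)
    then have eq: "cycle_integral R = cop.path_integral (circlepath 0 r) R" by (simp add: cycle_integral_def)
    have "cop.path_integrable (circlepath 0 r) R"
      by (rule cop.path_integrable_valid_path[OF R_analytic[unfolded op_analytic_on_eq]])
        (use cimg closed_\<sigma> in \<open>auto simp: open_Compl\<close>)
    then have 1: "((\<lambda>z. \<Phi> (R z)) has_contour_integral \<Phi> (cycle_integral R)) (circlepath 0 r)"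
      unfolding eq by (rule cop.has_contour_integral_functional[OF _ \<Phi>])
    have "((\<lambda>z. \<Phi> id_blinfun / (z - 0)) has_contour_integral 2 * of_real pi * \<i> * \<Phi> id_blinfun) (circlepath 0 r)"
      by (rule Cauchy_integral_circlepath_simple[of "\<lambda>z. \<Phi> id_blinfun" 0 r 0]) (use r0 in auto)
    from has_contour_integral_diff[OF 1 this]
    have "norm ?d \<le> M / r\<^sup>2 * (2 * pi * r)"
    proof (rule has_contour_integral_bound_circlepath)
      fix z :: complex assume "norm (z - 0) = r"
      then have z: "norm z = r" by simp
      have z0: "z \<noteq> 0" using z r0 by auto
      have "op_cscale z (R z) = id_blinfun + (?S o\<^sub>L R z)"
        using cscale_resolvent[OF complexify_clinear, of z T] out[OF z] by (simp add: complex_spectrum_def)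
      then have "z * \<Phi> (R z) = \<Phi> id_blinfun + \<Phi> (?S o\<^sub>L R z)" by (metis \<Phi>sc \<Phi>.add)
      then have "\<Phi> (R z) - \<Phi> id_blinfun / (z - 0) = \<Phi> (?S o\<^sub>L R z) / z" using z0 by (simp add: field_simps)
      also have "norm \<dots> = norm (\<Phi> (?S o\<^sub>L R z)) / r" by (simp add: norm_divide z)
      also have "\<dots> \<le> norm (?S o\<^sub>L R z) * K / r" using K r0 by (intro divide_right_mono) auto
      also have "\<dots> \<le> norm ?S * norm (R z) * K / r"
        using K r0 by (intro divide_right_mono mult_right_mono norm_blinfun_compose) auto
      also have "\<dots> \<le> norm ?S * (4 / r) * K / r"
        using K r0 out[OF z] by (intro divide_right_mono mult_right_mono mult_left_mono) auto
      also have "\<dots> = M / r\<^sup>2" by (simp add: M_def power2_eq_square)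
      finally show "norm (\<Phi> (R z) - \<Phi> id_blinfun / (z - 0)) \<le> M / r\<^sup>2" .
    qed (use M r0 in auto)
    also have "M / r\<^sup>2 * (2 * pi * r) = 2 * pi * M / r" using r0 by (simp add: power2_eq_square)
    finally show ?thesis .
  qed
  \<comment> \<open>\<open>?d\<close> does not depend on the radius, so the bound may be taken in
    the limit of large \<open>r\<close>.\<close>
  have "norm ?d \<le> 0"
  proof (rule tendsto_lowerbound)
    show "((\<lambda>r. 2 * pi * M / r) \<longlongrightarrow> 0) at_top" by real_asymp
    show "\<forall>\<^sub>F r in at_top. norm ?d \<le> 2 * pi * M / r"
      using eventually_gt_at_top[of "4 * norm ?S"] by eventually_elim (rule bound)
  qed simp
  then show "\<Phi> (cycle_integral R) = \<Phi> (op_cscale (2 * of_real pi * \<i>) id_blinfun)" by (simp add: \<Phi>sc)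
qed

section \<open>Values at constants and at the coordinate function\<close>

lemma fun_calc_one: "fun_calc \<Gamma> T (\<lambda>z. id_blinfun) = id_blinfun"
  by (simp add: fun_calc_eq cycle_integral_resolvent cop.sc_sc)

lemma admissible_const: "A \<in> clinear_ops \<Longrightarrow> admissible (\<lambda>z. A)"
  by (simp add: admissible_def op_analytic_on_const)

lemma fun_calc_const:
  assumes "A \<in> clinear_ops"
  shows "fun_calc \<Gamma> T (\<lambda>z. A) = A"
  using fun_calc_left_compose[OF assms admissible_const[OF id_clinear]] by (simp add: fun_calc_one)

text \<open>By \<open>cscale_resolvent\<close> the integrand is
  \<open>id_blinfun + (?S o\<^sub>L R z)\<close>. The constant integrates to 0, and in the other
  term \<open>?S\<close> comes out of the integral of the resolvent.\<close>

lemma fun_calc_ident: "fun_calc \<Gamma> T (scalar_op (\<lambda>z. z)) = complexify T"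
proof -
  let ?S = "complexify T"
  have RV: "op_analytic_on R V" by (rule op_analytic_on_subset[OF R_analytic]) auto
  have SR: "op_analytic_on (\<lambda>z. ?S o\<^sub>L R z) V"
    by (rule op_analytic_on_linear[OF bounded_linear_compose_left op_cscale_compose_right[OF complexify_clinear] RV])
  have "cycle_integral (\<lambda>z. scalar_op (\<lambda>z. z) z o\<^sub>L R z) = cycle_integral (\<lambda>z. id_blinfun + (?S o\<^sub>L R z))"
    by (rule cycle_integral_cong)
      (simp add: scalar_op_compose cscale_resolvent[OF complexify_clinear] complex_spectrum_def)
  also have "\<dots> = cycle_integral (\<lambda>z. id_blinfun) + cycle_integral (\<lambda>z. ?S o\<^sub>L R z)"
    by (rule cycle_integral_add[OF op_analytic_on_const SR])
  also have "cycle_integral (\<lambda>z. id_blinfun) = 0" by (rule cycle_integral_U[OF op_analytic_on_const])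
  also have "cycle_integral (\<lambda>z. ?S o\<^sub>L R z) = ?S o\<^sub>L cycle_integral R"
    by (rule cycle_integral_linear[OF bounded_linear_compose_left op_cscale_compose_right[OF complexify_clinear] RV])
  finally show ?thesis
    by (simp add: fun_calc_eq cycle_integral_resolvent op_cscale_compose_right[OF complexify_clinear] cop.sc_sc)
qed

section \<open>The product rule\<close>

lemma functional_compose_holomorphic:
  assumes \<Phi>: "cop.complex_functional \<Phi>" and F: "admissible F"
  shows "z \<in> U \<Longrightarrow> (\<lambda>w. \<Phi> (F z o\<^sub>L R w)) holomorphic_on V"
    and "(\<lambda>z. \<Phi> (F z o\<^sub>L A)) holomorphic_on U"
proof -
  show "(\<lambda>w. \<Phi> (F z o\<^sub>L R w)) holomorphic_on V" if "z \<in> U"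
    using that F op_analytic_on_subset[OF R_analytic, of V]
    by (intro cop.holomorphic_on_functional[OF _ \<Phi>], unfold op_analytic_on_eq[symmetric])
      (auto simp: admissible_def intro!: op_analytic_on_compose op_analytic_on_const)
  \<comment> \<open>No resolvent in the variable \<open>z\<close> occurs, so holomorphy extends
    across the spectrum. This is what makes the last integral in the product rule vanish.\<close>
  show "(\<lambda>z. \<Phi> (F z o\<^sub>L A)) holomorphic_on U"
    using F by (intro cop.holomorphic_on_functional[OF _ \<Phi>], unfold op_analytic_on_eq[symmetric])
      (auto simp: admissible_def intro!: op_analytic_on_compose op_analytic_on_const)
qed

text \<open>Only scalars are ever moved past operators, so the order of \<open>F z\<close> and the
  resolvents is kept throughout and no commutation between them is used.\<close>

lemma fun_calc_mult:
  assumes stem: "F \<in> stem_op_functions n ract U" and f: "f holomorphic_on U"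
  shows "fun_calc \<Gamma> T (\<lambda>z. op_cscale (f z) (F z)) = fun_calc \<Gamma> T F o\<^sub>L fun_calc \<Gamma> T (scalar_op f)"
proof -
  interpret comp: bounded_bilinear "(o\<^sub>L) :: 'v cop \<Rightarrow> 'v cop \<Rightarrow> 'v cop" by (rule bounded_bilinear_blinfun_compose)
  have F: "admissible F" by (rule stem_admissible[OF stem])
  let ?c = "2 * of_real pi * \<i> :: complex"
  let ?A = "\<lambda>z. F z o\<^sub>L R z"
  define J where "J = cycle_integral (\<lambda>z. scalar_op f z o\<^sub>L R z)"
  have VU: "V \<subseteq> U" by blast
  have Fcl: "F z \<in> clinear_ops" if "z \<in> U" for z using F that by (simp add: admissible_def)
  have A: "op_analytic_on ?A V" by (rule integrand_analytic[OF F])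
  have fA: "op_analytic_on (\<lambda>z. op_cscale (?c * f z) (?A z)) V"
    by (rule op_analytic_on_cscale[OF _ open_V A]) (intro holomorphic_intros holomorphic_on_subset[OF f VU])
  have AJ: "op_analytic_on (\<lambda>z. ?A z o\<^sub>L J) V"
    by (rule op_analytic_on_linear[OF bounded_linear_compose_right op_cscale_compose_left A])
  have RV: "op_analytic_on R V" by (rule op_analytic_on_subset[OF R_analytic]) auto
  have fR: "op_analytic_on (\<lambda>w. op_cscale (f w) (R w)) V"
    by (rule op_analytic_on_cscale[OF holomorphic_on_subset[OF f VU] open_V RV])
  \<comment> \<open>Both sides are double integrals over \<open>\<Gamma>\<close>: on the left the
    second integration is hidden in \<open>?c\<close>, the scalar value of the integral of the
    resolvent.\<close>
  have key: "cycle_integral (\<lambda>z. op_cscale (?c * f z) (?A z)) = cycle_integral (\<lambda>z. ?A z o\<^sub>L J)"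
  proof (rule cop.complex_functionals_separate)
    fix \<Phi> :: "'v cop \<Rightarrow> complex" assume \<Phi>: "cop.complex_functional \<Phi>"
    interpret \<Phi>: bounded_linear \<Phi> using \<Phi> by (simp add: cop.complex_functional_def)
    have \<Phi>sc: "\<Phi> (op_cscale a A) = a * \<Phi> A" for a A using \<Phi> by (simp add: cop.complex_functional_def)
    \<comment> \<open>The resolvent identity splits the integrand with factor
      \<open>f z - f w\<close> into two terms. This is the one that survives: regular at
      \<open>w = z\<close>, and free of the resolvent in \<open>z\<close>.\<close>
    define m where "m z w = diff_quotient f z w * \<Phi> (F z o\<^sub>L R w)" for z w
    have holq: "diff_quotient f z holomorphic_on U" for z by (rule holomorphic_on_diff_quotient[OF f open_U])
    have holq': "(\<lambda>z. diff_quotient f z w) holomorphic_on U" for w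
      using holq[of w] by (simp add: diff_quotient_commute[of f _ w])
    have m1: "m z holomorphic_on V" if "z \<in> V" for z unfolding m_def
      by (intro holomorphic_on_mult holomorphic_on_subset[OF holq VU] functional_compose_holomorphic(1)[OF \<Phi> F])
        (use that in auto)
    have m2U: "(\<lambda>z. m z w) holomorphic_on U" for w unfolding m_def
      by (intro holomorphic_on_mult holq' functional_compose_holomorphic(2)[OF \<Phi> F])
    have m2: "(\<lambda>z. m z w) holomorphic_on V" for w by (rule holomorphic_on_subset[OF m2U VU])
    have conm: "continuous_on (V \<times> V) (\<lambda>(z, w). m z w)"
    proof -
      have 1: "continuous_on (V \<times> V) (\<lambda>p. F (fst p))" "continuous_on (V \<times> V) (\<lambda>p. R (snd p))"
        using cop.complex_differentiable_on_imp_continuous[of F U] F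
          cop.complex_differentiable_on_imp_continuous[of R V] RV
        by (auto simp: admissible_def op_analytic_on_eq intro!: continuous_on_compose2[of U F] continuous_on_compose2[of V R] continuous_intros)
      have "continuous_on (V \<times> V) (\<lambda>p. F (fst p) o\<^sub>L R (snd p))" by (rule comp.continuous_on[OF 1])
      then have "continuous_on (V \<times> V) (\<lambda>p. \<Phi> (F (fst p) o\<^sub>L R (snd p)))" by (rule \<Phi>.continuous_on)
      moreover have "continuous_on (V \<times> V) (\<lambda>p. diff_quotient f (fst p) (snd p))"
        using continuous_on_subset[OF continuous_on_diff_quotient[OF f open_U], of "V \<times> V"]
        by (auto simp: split_beta)
      ultimately have "continuous_on (V \<times> V) (\<lambda>p. diff_quotient f (fst p) (snd p) * \<Phi> (F (fst p) o\<^sub>L R (snd p)))"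
        by (rule continuous_on_mult[rotated])
      then show ?thesis by (simp add: m_def split_beta)
    qed
    have hol_int: "(\<lambda>z. contour_integral \<gamma> (m z)) holomorphic_on V" if "\<gamma> \<in> \<Gamma>" for \<gamma>
      by (rule contour_integral_param_holomorphic_loop[OF open_V conm m1 m2 \<Gamma>_valid[OF that] \<Gamma>_image[OF that] \<Gamma>_loop[OF that]])
    have point: "\<Phi> (op_cscale (?c * f z) (?A z)) - \<Phi> (?A z o\<^sub>L J) = (\<Sum>\<gamma>\<in>\<Gamma>. contour_integral \<gamma> (m z))"
      if z: "z \<in> V" for z
    proof -
      have Acl: "?A z \<in> clinear_ops"
        using z by (intro clinear_ops_compose Fcl R_clinear) auto
      have rid: "op_cscale (f z - f w) (?A z o\<^sub>L R w) = op_cscale (diff_quotient f z w) ((F z o\<^sub>L R w) - ?A z)" if w: "w \<in> V" for w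
      proof -
        have "op_cscale (w - z) (R z o\<^sub>L R w) = R z - R w"
          using resolvent_identity[OF complexify_clinear, of z T w] z w by (simp add: complex_spectrum_def)
        then have "op_cscale (w - z) (?A z o\<^sub>L R w) = ?A z - (F z o\<^sub>L R w)"
          using Fcl[of z] z by (simp add: blinfun_compose_assoc comp.diff_right[symmetric] op_cscale_compose_right[symmetric])
        moreover have "f z - f w = - diff_quotient f z w * (w - z)"
          using diff_quotient_mult[of f z w] by simp
        ultimately show ?thesis
          by (simp add: cop.sc_sc[symmetric] cop.minus_left cop.diff_right)
      qed
      have cR: "op_analytic_on (\<lambda>w. op_cscale (f z - f w) (R w)) V"
        by (rule op_analytic_on_cscale[OF _ open_V RV]) (intro holomorphic_intros holomorphic_on_subset[OF f VU])
      \<comment> \<open>Writing \<open>?c * f z\<close> as the integral of \<open>f z\<close> times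
        the resolvent brings the difference with \<open>J\<close> under a single integral, with
        factor \<open>f z - f w\<close>.\<close>
      have "op_cscale (?c * f z) id_blinfun = op_cscale (f z) (cycle_integral R)"
        by (simp add: cycle_integral_resolvent cop.sc_sc mult.commute)
      also have "\<dots> = cycle_integral (\<lambda>w. op_cscale (f z) (R w))"
        by (rule cycle_integral_linear[symmetric, OF cop.bounded_linear_right _ RV]) (simp add: cop.sc_sc mult.commute)
      also have "\<dots> = cycle_integral (\<lambda>w. op_cscale (f z - f w) (R w) + op_cscale (f w) (R w))"
        by (simp add: cop.diff_left)
      also have "\<dots> = cycle_integral (\<lambda>w. op_cscale (f z - f w) (R w)) + J"
        unfolding J_def scalar_op_compose by (rule cycle_integral_add[OF cR fR])
      finally have J: "op_cscale (?c * f z) id_blinfun - J = cycle_integral (\<lambda>w. op_cscale (f z - f w) (R w))" by simp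
      have "op_cscale (?c * f z) (?A z) - (?A z o\<^sub>L J) = ?A z o\<^sub>L (op_cscale (?c * f z) id_blinfun - J)"
        by (simp only: comp.diff_right op_cscale_compose_right[OF Acl] id_blinfun_compose)
      also have "\<dots> = cycle_integral (\<lambda>w. ?A z o\<^sub>L op_cscale (f z - f w) (R w))" unfolding J
        by (rule cycle_integral_linear[symmetric, OF bounded_linear_compose_left op_cscale_compose_right[OF Acl] cR])
      finally have diff: "op_cscale (?c * f z) (?A z) - (?A z o\<^sub>L J) = cycle_integral (\<lambda>w. ?A z o\<^sub>L op_cscale (f z - f w) (R w))" .
      have AcR: "op_analytic_on (\<lambda>w. ?A z o\<^sub>L op_cscale (f z - f w) (R w)) V"
        by (rule op_analytic_on_linear[OF bounded_linear_compose_left op_cscale_compose_right[OF Acl] cR])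
      have "\<Phi> (op_cscale (?c * f z) (?A z)) - \<Phi> (?A z o\<^sub>L J)
          = (\<Sum>\<gamma>\<in>\<Gamma>. contour_integral \<gamma> (\<lambda>w. \<Phi> (?A z o\<^sub>L op_cscale (f z - f w) (R w))))"
        unfolding \<Phi>.diff[symmetric] diff by (rule functional_cycle_integral[OF \<Phi> AcR])
      also have "\<dots> = (\<Sum>\<gamma>\<in>\<Gamma>. contour_integral \<gamma> (\<lambda>w. m z w - \<Phi> (?A z) * diff_quotient f z w))"
      proof (intro sum.cong refl contour_integral_eq)
        fix \<gamma> w assume "\<gamma> \<in> \<Gamma>" "w \<in> path_image \<gamma>"
        then have "w \<in> V" using \<Gamma>_image by blast
        then show "\<Phi> (?A z o\<^sub>L op_cscale (f z - f w) (R w)) = m z w - \<Phi> (?A z) * diff_quotient f z w"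
          by (simp add: op_cscale_compose_right[OF Acl] rid \<Phi>sc \<Phi>.diff m_def right_diff_distrib mult.commute)
      qed
      also have "\<dots> = (\<Sum>\<gamma>\<in>\<Gamma>. contour_integral \<gamma> (m z)) - \<Phi> (?A z) * (\<Sum>\<gamma>\<in>\<Gamma>. contour_integral \<gamma> (diff_quotient f z))"
        unfolding sum_distrib_left sum_subtractf[symmetric]
      proof (intro sum.cong refl)
        fix \<gamma> assume g: "\<gamma> \<in> \<Gamma>"
        have "m z contour_integrable_on \<gamma>" "diff_quotient f z contour_integrable_on \<gamma>"
          using contour_integrable_holomorphic_simple[OF _ open_V \<Gamma>_valid[OF g] \<Gamma>_image[OF g]]
            m1[OF z] holomorphic_on_subset[OF holq VU] by blast+
        then show "contour_integral \<gamma> (\<lambda>w. m z w - \<Phi> (?A z) * diff_quotient f z w)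
            = contour_integral \<gamma> (m z) - \<Phi> (?A z) * contour_integral \<gamma> (diff_quotient f z)"
          by (simp add: contour_integral_diff contour_integrable_lmul contour_integral_lmul)
      qed
      also have "\<dots> = (\<Sum>\<gamma>\<in>\<Gamma>. contour_integral \<gamma> (m z))" by (simp add: Cauchy_U[OF holq])
      finally show ?thesis .
    qed
    have int: "h contour_integrable_on \<gamma>" if "h holomorphic_on V" "\<gamma> \<in> \<Gamma>" for h \<gamma>
      by (rule contour_integrable_holomorphic_simple[OF that(1) open_V \<Gamma>_valid[OF that(2)] \<Gamma>_image[OF that(2)]])
    have "\<Phi> (cycle_integral (\<lambda>z. op_cscale (?c * f z) (?A z))) - \<Phi> (cycle_integral (\<lambda>z. ?A z o\<^sub>L J))
        = (\<Sum>\<delta>\<in>\<Gamma>. contour_integral \<delta> (\<lambda>z. \<Phi> (op_cscale (?c * f z) (?A z)) - \<Phi> (?A z o\<^sub>L J)))"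
      unfolding functional_cycle_integral[OF \<Phi> fA] functional_cycle_integral[OF \<Phi> AJ] sum_subtractf[symmetric]
      by (intro sum.cong refl contour_integral_diff[symmetric] int
          cop.holomorphic_on_functional[OF _ \<Phi>] fA[unfolded op_analytic_on_eq] AJ[unfolded op_analytic_on_eq])
    also have "\<dots> = (\<Sum>\<delta>\<in>\<Gamma>. contour_integral \<delta> (\<lambda>z. \<Sum>\<gamma>\<in>\<Gamma>. contour_integral \<gamma> (m z)))"
      by (intro sum.cong refl contour_integral_eq point) (use \<Gamma>_image in blast)
    also have "\<dots> = (\<Sum>\<delta>\<in>\<Gamma>. \<Sum>\<gamma>\<in>\<Gamma>. contour_integral \<delta> (\<lambda>z. contour_integral \<gamma> (m z)))"
      by (intro sum.cong refl contour_integral_sum finite_\<Gamma> int hol_int)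
    also have "\<dots> = (\<Sum>\<delta>\<in>\<Gamma>. \<Sum>\<gamma>\<in>\<Gamma>. contour_integral \<gamma> (\<lambda>w. contour_integral \<delta> (\<lambda>z. m z w)))"
      by (intro sum.cong refl contour_integral_swap_loops[OF open_V conm m1 m2] \<Gamma>_valid \<Gamma>_image \<Gamma>_loop)
    also have "\<dots> = (\<Sum>\<gamma>\<in>\<Gamma>. \<Sum>\<delta>\<in>\<Gamma>. contour_integral \<gamma> (\<lambda>w. contour_integral \<delta> (\<lambda>z. m z w)))"
      by (rule sum.swap)
    \<comment> \<open>The sum over \<open>\<delta>\<close> has to come inside, because the integral
      of \<open>m\<close> in \<open>z\<close> is known to vanish for the whole cycle and not for a
      single curve.\<close>
    also have "\<dots> = (\<Sum>\<gamma>\<in>\<Gamma>. contour_integral \<gamma> (\<lambda>w. \<Sum>\<delta>\<in>\<Gamma>. contour_integral \<delta> (\<lambda>z. m z w)))"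
      by (intro sum.cong refl contour_integral_sum[symmetric] finite_\<Gamma> int
          contour_integral_param_holomorphic_loop[OF open_V continuous_on_swap_args[OF conm] m2 m1] \<Gamma>_valid \<Gamma>_image \<Gamma>_loop)
    also have "\<dots> = 0" by (simp add: Cauchy_U[OF m2U])
    finally show "\<Phi> (cycle_integral (\<lambda>z. op_cscale (?c * f z) (?A z))) = \<Phi> (cycle_integral (\<lambda>z. ?A z o\<^sub>L J))" by simp
  qed
  have ffA: "op_analytic_on (\<lambda>z. op_cscale (f z) (?A z)) V"
    by (rule op_analytic_on_cscale[OF holomorphic_on_subset[OF f VU] open_V A])
  have "op_cscale ?c (cycle_integral (\<lambda>z. op_cscale (f z) (?A z))) = cycle_integral (\<lambda>z. op_cscale (?c * f z) (?A z))"
    using cycle_integral_linear[OF cop.bounded_linear_right _ ffA, of ?c] by (simp add: cop.sc_sc mult.commute)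
  also have "\<dots> = cycle_integral ?A o\<^sub>L J" unfolding key
    by (rule cycle_integral_linear[OF bounded_linear_compose_right op_cscale_compose_left A])
  finally have main: "op_cscale ?c (cycle_integral (\<lambda>z. op_cscale (f z) (?A z))) = cycle_integral ?A o\<^sub>L J" .
  \<comment> \<open>Bringing the scalar of the second factor to the front uses that
    \<open>cycle_integral ?A\<close> is complex linear.\<close>
  have Acl: "cycle_integral ?A o\<^sub>L op_cscale (1 / ?c) J = op_cscale (1 / ?c) (cycle_integral ?A o\<^sub>L J)"
    by (rule op_cscale_compose_right[OF cright_ops_clinear[OF cycle_integral_cright_ops[OF stem]]])
  have "fun_calc \<Gamma> T F o\<^sub>L fun_calc \<Gamma> T (scalar_op f) = op_cscale (1 / ?c) (op_cscale (1 / ?c) (cycle_integral ?A o\<^sub>L J))"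
    unfolding fun_calc_eq J_def[symmetric] by (simp add: op_cscale_compose_left Acl)
  also have "\<dots> = op_cscale (1 / ?c) (cycle_integral (\<lambda>z. op_cscale (f z) (?A z)))"
    unfolding main[symmetric] by (simp add: cop.sc_sc)
  finally show ?thesis by (simp add: fun_calc_eq op_cscale_compose_left)
qed

end

theorem theorem7:
  fixes n :: nat
    and lact :: "clifford \<Rightarrow> 'v::banach \<Rightarrow> 'v"
    and ract :: "'v \<Rightarrow> clifford \<Rightarrow> 'v"
    and U \<Delta> :: "complex set"
    and \<Gamma> :: "(real \<Rightarrow> complex) set"
    and T :: "'v \<Rightarrow>\<^sub>L 'v"
  assumes "banach_cl_space n lact ract"
    and "open U" and "conj_symmetric U"
    and "T \<in> right_ops n ract" and "complex_spectrum T \<subseteq> U"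
    and "cauchy_domain U \<Delta> \<Gamma>" and "complex_spectrum T \<subseteq> \<Delta>"
  shows
    "\<comment> \<open>\<open>F(T)\<close> lies in the real operators and does not depend on the contour\<close>
     (\<forall>F \<in> stem_op_functions n ract U. fun_calc \<Gamma> T F \<in> complexify ` right_ops n ract \<and>
        (\<forall>\<Delta>' \<Gamma>'. cauchy_domain U \<Delta>' \<Gamma>' \<and> complex_spectrum T \<subseteq> \<Delta>' \<longrightarrow> fun_calc \<Gamma>' T F = fun_calc \<Gamma> T F)) \<and>
     \<comment> \<open>real linearity\<close>
     (\<forall>F \<in> stem_op_functions n ract U. \<forall>G \<in> stem_op_functions n ract U.
        (\<lambda>z. F z + G z) \<in> stem_op_functions n ract U \<and>
        fun_calc \<Gamma> T (\<lambda>z. F z + G z) = fun_calc \<Gamma> T F + fun_calc \<Gamma> T G) \<and>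
     (\<forall>r::real. \<forall>F \<in> stem_op_functions n ract U.
        (\<lambda>z. r *\<^sub>R F z) \<in> stem_op_functions n ract U \<and>
        fun_calc \<Gamma> T (\<lambda>z. r *\<^sub>R F z) = r *\<^sub>R fun_calc \<Gamma> T F) \<and>
     \<comment> \<open>unital real algebra morphism on scalar functions\<close>
     (\<forall>f \<in> stem_functions U. scalar_op f \<in> stem_op_functions n ract U \<and>
        fun_calc \<Gamma> T (scalar_op f) \<in> complexify ` right_ops n ract) \<and>
     (\<lambda>z. 1) \<in> stem_functions U \<and>
     fun_calc \<Gamma> T (scalar_op (\<lambda>z. 1)) = complexify id_blinfun \<and>
     (\<forall>f \<in> stem_functions U. \<forall>g \<in> stem_functions U.
        (\<lambda>z. f z + g z) \<in> stem_functions U \<and>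
        fun_calc \<Gamma> T (scalar_op (\<lambda>z. f z + g z)) =
          fun_calc \<Gamma> T (scalar_op f) + fun_calc \<Gamma> T (scalar_op g)) \<and>
     (\<forall>r::real. \<forall>f \<in> stem_functions U.
        (\<lambda>z. r *\<^sub>R f z) \<in> stem_functions U \<and>
        fun_calc \<Gamma> T (scalar_op (\<lambda>z. r *\<^sub>R f z)) = r *\<^sub>R fun_calc \<Gamma> T (scalar_op f)) \<and>
     (\<forall>f \<in> stem_functions U. \<forall>g \<in> stem_functions U.
        (\<lambda>z. f z * g z) \<in> stem_functions U \<and>
        fun_calc \<Gamma> T (scalar_op (\<lambda>z. f z * g z)) =
          fun_calc \<Gamma> T (scalar_op f) o\<^sub>L fun_calc \<Gamma> T (scalar_op g)) \<and>
     \<comment> \<open>(1)\<close>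
     (\<forall>F \<in> stem_op_functions n ract U. \<forall>f \<in> stem_functions U.
        (\<lambda>z. op_cscale (f z) (F z)) \<in> stem_op_functions n ract U \<and>
        fun_calc \<Gamma> T (\<lambda>z. op_cscale (f z) (F z)) =
          fun_calc \<Gamma> T F o\<^sub>L fun_calc \<Gamma> T (scalar_op f)) \<and>
     \<comment> \<open>(2)\<close>
     (\<forall>m. \<forall>A :: nat \<Rightarrow> 'v \<Rightarrow>\<^sub>L 'v. (\<forall>k\<le>m. A k \<in> right_ops n ract) \<longrightarrow>
        (\<lambda>z. \<Sum>k\<le>m. op_cscale (z ^ k) (complexify (A k))) \<in> stem_op_functions n ract U \<and>
        fun_calc \<Gamma> T (\<lambda>z. \<Sum>k\<le>m. op_cscale (z ^ k) (complexify (A k))) =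
          complexify (\<Sum>k\<le>m. A k o\<^sub>L op_power T k) \<and>
        (\<Sum>k\<le>m. A k o\<^sub>L op_power T k) \<in> right_ops n ract)"
proof -
  interpret riesz_contour n lact ract U \<Delta> \<Gamma> T
    using assms by (intro riesz_contour.intro riesz_contour_axioms.intro)
  have real_values: "fun_calc \<Gamma> T F \<in> complexify ` right_ops n ract" if "F \<in> stem_op_functions n ract U" for F
    by (rule fun_calc_real[OF that])
  have indep: "fun_calc \<Gamma>' T F = fun_calc \<Gamma> T F"
    if "F \<in> stem_op_functions n ract U" "cauchy_domain U \<Delta>' \<Gamma>' \<and> complex_spectrum T \<subseteq> \<Delta>'" for F \<Delta>' \<Gamma>'
    using fun_calc_contour_independent[OF stem_admissible[OF that(1)]] that(2) by blast
  have add: "(\<lambda>z. F z + G z) \<in> stem_op_functions n ract U"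
    "fun_calc \<Gamma> T (\<lambda>z. F z + G z) = fun_calc \<Gamma> T F + fun_calc \<Gamma> T G"
    if "F \<in> stem_op_functions n ract U" "G \<in> stem_op_functions n ract U" for F G
    using that by (auto intro: stem_op_add fun_calc_add stem_admissible)
  have scale: "(\<lambda>z. r *\<^sub>R F z) \<in> stem_op_functions n ract U"
    "fun_calc \<Gamma> T (\<lambda>z. r *\<^sub>R F z) = r *\<^sub>R fun_calc \<Gamma> T F"
    if "F \<in> stem_op_functions n ract U" for r F
    using that by (auto intro: stem_op_scaleR open_U fun_calc_scaleR stem_admissible)
  have scalar: "scalar_op f \<in> stem_op_functions n ract U" if "f \<in> stem_functions U" for f
    by (rule stem_op_scalar[OF open_U that])
  have mult: "(\<lambda>z. op_cscale (f z) (F z)) \<in> stem_op_functions n ract U"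
    "fun_calc \<Gamma> T (\<lambda>z. op_cscale (f z) (F z)) = fun_calc \<Gamma> T F o\<^sub>L fun_calc \<Gamma> T (scalar_op f)"
    if "F \<in> stem_op_functions n ract U" "f \<in> stem_functions U" for F f
    using stem_op_cscale[OF open_U that] fun_calc_mult[OF that(1)] that(2) stem_functions_iff[OF open_U] by auto
  have one: "(\<lambda>z. 1) \<in> stem_functions U" "fun_calc \<Gamma> T (scalar_op (\<lambda>z. 1)) = complexify id_blinfun"
    using stem_const[of 1 U] fun_calc_one by (simp_all add: scalar_op_def[abs_def] complexify_id)
  have fadd: "(\<lambda>z. f z + g z) \<in> stem_functions U"
    "fun_calc \<Gamma> T (scalar_op (\<lambda>z. f z + g z)) = fun_calc \<Gamma> T (scalar_op f) + fun_calc \<Gamma> T (scalar_op g)"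
    if "f \<in> stem_functions U" "g \<in> stem_functions U" for f g
  proof -
    show "(\<lambda>z. f z + g z) \<in> stem_functions U"
      using that by (auto simp: stem_functions_iff[OF open_U] intro: holomorphic_on_add)
    have "(scalar_op (\<lambda>z. f z + g z) :: complex \<Rightarrow> 'v cop) = (\<lambda>z. scalar_op f z + scalar_op g z)"
      by (rule ext) (simp add: scalar_op_def cop.add_left)
    then show "fun_calc \<Gamma> T (scalar_op (\<lambda>z. f z + g z)) = fun_calc \<Gamma> T (scalar_op f) + fun_calc \<Gamma> T (scalar_op g)"
      by (simp add: add(2)[OF scalar[OF that(1)] scalar[OF that(2)]])
  qed
  have fscale: "(\<lambda>z. r *\<^sub>R f z) \<in> stem_functions U"
    "fun_calc \<Gamma> T (scalar_op (\<lambda>z. r *\<^sub>R f z)) = r *\<^sub>R fun_calc \<Gamma> T (scalar_op f)"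
    if "f \<in> stem_functions U" for r f
  proof -
    show "(\<lambda>z. r *\<^sub>R f z) \<in> stem_functions U"
      using that by (auto simp: stem_functions_iff[OF open_U] scaleR_conv_of_real
          intro!: holomorphic_on_mult holomorphic_on_const)
    have "(scalar_op (\<lambda>z. r *\<^sub>R f z) :: complex \<Rightarrow> 'v cop) = (\<lambda>z. r *\<^sub>R scalar_op f z)"
      by (rule ext) (simp add: scalar_op_def cop.scaleR_left)
    then show "fun_calc \<Gamma> T (scalar_op (\<lambda>z. r *\<^sub>R f z)) = r *\<^sub>R fun_calc \<Gamma> T (scalar_op f)"
      by (simp add: scale(2)[OF scalar[OF that]])
  qed
  have fmult: "(\<lambda>z. f z * g z) \<in> stem_functions U"
    "fun_calc \<Gamma> T (scalar_op (\<lambda>z. f z * g z)) = fun_calc \<Gamma> T (scalar_op f) o\<^sub>L fun_calc \<Gamma> T (scalar_op g)"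
    if "f \<in> stem_functions U" "g \<in> stem_functions U" for f g
  proof -
    show "(\<lambda>z. f z * g z) \<in> stem_functions U"
      using that by (auto simp: stem_functions_iff[OF open_U] intro: holomorphic_on_mult)
    \<comment> \<open>With \<open>scalar_op f\<close> in the role of \<open>F\<close>, the product
      rule (1) yields the factors in the required order.\<close>
    have "(scalar_op (\<lambda>z. f z * g z) :: complex \<Rightarrow> 'v cop) = (\<lambda>z. op_cscale (g z) (scalar_op f z))"
      by (rule ext) (simp add: scalar_op_def cop.sc_sc mult.commute)
    then show "fun_calc \<Gamma> T (scalar_op (\<lambda>z. f z * g z)) = fun_calc \<Gamma> T (scalar_op f) o\<^sub>L fun_calc \<Gamma> T (scalar_op g)"
      by (simp add: mult(2)[OF scalar[OF that(1)] that(2)])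
  qed
  have power: "(\<lambda>z. z ^ k) \<in> stem_functions U" for k
    by (auto simp: stem_functions_iff[OF open_U] intro!: holomorphic_intros)
  have fpower: "fun_calc \<Gamma> T (scalar_op (\<lambda>z. z ^ k)) = complexify (op_power T k)" for k
  \<comment> \<open>\<open>z ^ Suc k\<close> is split as \<open>z * z ^ k\<close>, matching the
    recursion of \<open>op_power\<close>; the first factor is evaluated by
    \<open>fun_calc_ident\<close>.\<close>
  proof (induction k)
    case 0
    then show ?case using one(2) by simp
  next
    case (Suc k)
    then show ?case
      using fmult(2)[OF power[of 1] power[of k]] by (simp add: fun_calc_ident complexify_compose)
  qed
  have poly: "(\<lambda>z. \<Sum>k\<le>m. op_cscale (z ^ k) (complexify (A k))) \<in> stem_op_functions n ract U \<and>
      fun_calc \<Gamma> T (\<lambda>z. \<Sum>k\<le>m. op_cscale (z ^ k) (complexify (A k))) =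
        complexify (\<Sum>k\<le>m. A k o\<^sub>L op_power T k) \<and>
      (\<Sum>k\<le>m. A k o\<^sub>L op_power T k) \<in> right_ops n ract"
    if A: "\<forall>k\<le>m. A k \<in> right_ops n ract" for m A
  proof (intro conjI)
    \<comment> \<open>The coefficient is a constant stem function, which the calculus maps to
      itself. As the left factor in (1) it stays to the left of the power of
      \<open>T\<close>.\<close>
    have summand: "(\<lambda>z. op_cscale (z ^ k) (complexify (A k))) \<in> stem_op_functions n ract U"
      "fun_calc \<Gamma> T (\<lambda>z. op_cscale (z ^ k) (complexify (A k))) = complexify (A k o\<^sub>L op_power T k)"
      if "k \<le> m" for k
      using mult[OF stem_op_const power, of "A k" k] A that
      by (simp_all add: fun_calc_const[OF complexify_clinear] fpower complexify_compose)
    \<comment> \<open>The induction runs over partial sums with \<open>j \<le> m\<close>, because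
      the coefficients are known to be right linear only up to \<open>m\<close>.\<close>
    have "(\<lambda>z. \<Sum>k\<le>j. op_cscale (z ^ k) (complexify (A k))) \<in> stem_op_functions n ract U \<and>
      fun_calc \<Gamma> T (\<lambda>z. \<Sum>k\<le>j. op_cscale (z ^ k) (complexify (A k))) =
        complexify (\<Sum>k\<le>j. A k o\<^sub>L op_power T k)" if "j \<le> m" for j
      using that
    proof (induction j)
      case 0
      then show ?case using summand[of 0] by simp
    next
      case (Suc j)
      then show ?case
        using add[OF _ summand(1)[OF Suc.prems]] summand(2)[OF Suc.prems] by (simp add: complexify_add)
    qed
    then show "(\<lambda>z. \<Sum>k\<le>m. op_cscale (z ^ k) (complexify (A k))) \<in> stem_op_functions n ract U"
      "fun_calc \<Gamma> T (\<lambda>z. \<Sum>k\<le>m. op_cscale (z ^ k) (complexify (A k))) =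
        complexify (\<Sum>k\<le>m. A k o\<^sub>L op_power T k)"
      by blast+
    show "(\<Sum>k\<le>m. A k o\<^sub>L op_power T k) \<in> right_ops n ract"
      using A right_ops_op_power[OF T] by (intro right_ops_sum) (simp add: right_ops_def)
  qed
  show ?thesis
    by (intro conjI allI ballI impI)
      (assumption | rule real_values indep add scale scalar one fadd fscale fmult mult
        poly[THEN conjunct1] poly[THEN conjunct2, THEN conjunct1] poly[THEN conjunct2, THEN conjunct2])+
qed

end
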